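(* The classes $\#\mathrm{para}_{W}\text{-}\mathrm{L}$ and $\#\mathrm{para}_{\beta}\text{-}\mathrm{L}$ are closed under para-logspace parsimonious reductions: if $F\le^{\mathrm{plog}}_{\mathrm{pars}}F'$ and $F'$ belongs to the class, then $F$ belongs to the class.
   Context: Inputs are pairs $(x,k)$, $x\in\{0,1\}^*$, parameter $k\in\mathbb N$; parameterised functions are $F:\{0,1\}^*\times\mathbb N\to\mathbb N$. Machines are TMs with random access to the input; a nondeterministic TM is a deterministic TM with an extra read-only choice tape (not counted for space), a nondeterministic step being a step in which the choice-tape head visits a new cell; $\#\mathrm{acc}_M(x,k)$ is the number of accepting computation paths. A $\mathrm{para}\text{-}\mathrm{L}$-machine uses space $O(\log|x|+f(k))$ for some computable $f$. A nondeterministic machine is $k$-bounded if for a computable $f$ it reads at most $f(k)\cdot\log|x|$ choice-tape bits on every input $(x,k)$; read-once access means the choice-tape head moves only one way. $\#\mathrm{para}_{W}\text{-}\mathrm{L}$: parameterised functions $F$ with a $k$-bounded nondeterministic $\mathrm{para}\text{-}\mathrm{L}$-machine $M$ such that $\#\mathrm{acc}_M(x,k)=F(x,k)$ for all $(x,k)$; $\#\mathrm{para}_{\beta}\text{-}\mathrm{L}$: the same with $M$ additionally having read-once access. $F\le^{\mathrm{plog}}_{\mathrm{pars}}F'$ (para-logspace parsimonious reduction) means there is a $\mathrm{para}\text{-}\mathrm{L}$ oracle TM (oracle tape exempt from space bounds) computing $F$ with oracle $F'$ such that the parameter of any oracle query is bounded by a computable function of the input parameter and the machine returns the answer of its first (only)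 oracle query. *)

theory Defs
  imports Main "HOL-Library.Discrete_Functions"
begin

datatype recf = Zr | Sc | Proj nat | Comp recf "recf list" | Prim recf recf | Mu recf

inductive reval :: "recf \<Rightarrow> nat list \<Rightarrow> nat \<Rightarrow> bool" where
  "reval Zr xs 0"
| "reval Sc (x # xs) (Suc x)"
| "i < length xs \<Longrightarrow> reval (Proj i) xs (xs ! i)"
| "list_all2 (\<lambda>g y. reval g xs y) gs ys \<Longrightarrow> reval f ys z \<Longrightarrow> reval (Comp f gs) xs z"
| "reval f xs z \<Longrightarrow> reval (Prim f g) (0 # xs) z"
| "reval (Prim f g) (n # xs) y \<Longrightarrow> reval g (y # n # xs) z \<Longrightarrow> reval (Prim f g) (Suc n # xs) z"
| "reval f (n # xs) 0 \<Longrightarrow> (\<forall>m<n. \<exists>y>0. reval f (m # xs) y) \<Longrightarrow> reval (Mu f) xs n"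

definition computable :: "(nat \<Rightarrow> nat) \<Rightarrow> bool" where
  "computable f \<longleftrightarrow> (\<exists>r. \<forall>n. reval r [n] (f n))"

fun bin :: "nat \<Rightarrow> bool list" where
  "bin 0 = []"
| "bin (Suc n) = odd (Suc n) # bin (Suc n div 2)"

text \<open>Input symbols: 0, 1 for bits, 2 for the separator; parameter in binary (LSB first).\<close>
definition enc :: "bool list \<Rightarrow> nat \<Rightarrow> nat list" where
  "enc x k = map (\<lambda>b. if b then 1 else 0) x @ [2] @ map (\<lambda>b. if b then 1 else 0) (bin k)"

text \<open>Logarithm of the input length (bit length convention, at least 1).\<close>
definition lg :: "nat \<Rightarrow> nat" where
  "lg n = floor_log n + 1"

datatype move = L | N | R

fun mv :: "move \<Rightarrow> nat \<Rightarrow> nat" where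
  "mv L h = h - 1" | "mv N h = h" | "mv R h = h + 1"

text \<open>A machine has a work tape, an index tape (alphabet: 0 blank, 1 bit 0, 2 bit 1) giving random
  access to the input, a read-only choice tape (cell 0 is a left-end marker, cells 1,2,... hold
  the choice bits), and a write-only append-only oracle tape (exempt from the space bound).
  Transition arguments: state, input symbol at index (None if out of range), work symbol,
  index symbol, choice symbol (None = left marker).  Result: new state, work symbol written,
  work move, index symbol written, index move, choice move, oracle symbol appended (if any).\<close>
record tm =
  nstates :: nat
  nsyms :: nat
  delta :: "nat \<Rightarrow> nat option \<Rightarrow> nat \<Rightarrow> nat \<Rightarrow> bool option
            \<Rightarrow> nat \<times> nat \<times> move \<times> nat \<times> move \<times> move \<times> nat option"
  accst :: nat
  rejst :: nat

definition wf_tm :: "tm \<Rightarrow> bool" where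
  "wf_tm M \<longleftrightarrow> 0 < nstates M \<and> accst M < nstates M \<and> rejst M < nstates M \<and> accst M \<noteq> rejst M
     \<and> 3 \<le> nsyms M \<and>
     (\<forall>q a s i c. q < nstates M \<longrightarrow> s < nsyms M \<longrightarrow> i < nsyms M \<longrightarrow>
        (case delta M q a s i c of (q', s', _, i', _, _, ow) \<Rightarrow>
           q' < nstates M \<and> s' < nsyms M \<and> i' < nsyms M \<and> (\<forall>b. ow = Some b \<longrightarrow> b < 3)))"

record cfg =
  st :: nat
  wt :: "nat \<Rightarrow> nat"
  wh :: nat
  it :: "nat \<Rightarrow> nat"
  ih :: nat
  ch :: nat
  orc :: "nat list"

definition idxval :: "(nat \<Rightarrow> nat) \<Rightarrow> nat" where
  "idxval t = (\<Sum>i\<in>{i. t i = 2}. 2 ^ i)"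

definition inp :: "nat list \<Rightarrow> nat \<Rightarrow> nat option" where
  "inp w p = (if p < length w then Some (w ! p) else None)"

definition chsym :: "(nat \<Rightarrow> bool) \<Rightarrow> nat \<Rightarrow> bool option" where
  "chsym c h = (if h = 0 then None else Some (c (h - 1)))"

definition init_cfg :: cfg where
  "init_cfg = \<lparr>st = 0, wt = (\<lambda>_. 0), wh = 0, it = (\<lambda>_. 0), ih = 0, ch = 0, orc = []\<rparr>"

definition step :: "tm \<Rightarrow> nat list \<Rightarrow> (nat \<Rightarrow> bool) \<Rightarrow> cfg \<Rightarrow> cfg" where
  "step M w c C =
    (if st C = accst M \<or> st C = rejst M then C else
      (case delta M (st C) (inp w (idxval (it C))) (wt C (wh C)) (it C (ih C)) (chsym c (ch C)) of
        (q', s', mw, i', mi, mc, ow) \<Rightarrow>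
          C\<lparr>st := q', wt := (wt C)(wh C := s'), wh := mv mw (wh C),
            it := (it C)(ih C := i'), ih := mv mi (ih C), ch := mv mc (ch C),
            orc := orc C @ (case ow of None \<Rightarrow> [] | Some b \<Rightarrow> [b])\<rparr>))"

definition run :: "tm \<Rightarrow> nat list \<Rightarrow> (nat \<Rightarrow> bool) \<Rightarrow> nat \<Rightarrow> cfg" where
  "run M w c t = (step M w c ^^ t) init_cfg"

text \<open>Accepting computation paths: a path is identified with the finite sequence of choice bits
  it reads (the cells visited by the choice head, i.e. its nondeterministic steps).\<close>
definition acc_path :: "tm \<Rightarrow> nat list \<Rightarrow> bool list \<Rightarrow> bool" where
  "acc_path M w u \<longleftrightarrow>
     (let c = (\<lambda>i. i < length u \<and> u ! i) in
      \<exists>t. st (run M w c t) = accst M \<and> (\<forall>t'\<le>t. ch (run M w c t') \<le> length u)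
          \<and> (\<exists>t'\<le>t. ch (run M w c t') = length u))"

definition nacc :: "tm \<Rightarrow> nat list \<Rightarrow> nat" where
  "nacc M w = card {u. acc_path M w u}"

definition paraL_space :: "tm \<Rightarrow> bool" where
  "paraL_space M \<longleftrightarrow> (\<exists>f c. computable f \<and>
     (\<forall>x k ch' t. wh (run M (enc x k) ch' t) + ih (run M (enc x k) ch' t)
                    \<le> c * (lg (length x) + f k)))"

definition k_bounded :: "tm \<Rightarrow> bool" where
  "k_bounded M \<longleftrightarrow> (\<exists>f. computable f \<and>
     (\<forall>x k c t. ch (run M (enc x k) c t) \<le> f k * lg (length x)))"

definition read_once :: "tm \<Rightarrow> bool" where
  "read_once M \<longleftrightarrow> (\<forall>x k c t. ch (run M (enc x k) c t) \<le> ch (run M (enc x k) c (Suc t)))"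

definition deterministic :: "tm \<Rightarrow> bool" where
  "deterministic M \<longleftrightarrow> (\<forall>w t. ch (run M w (\<lambda>_. False) t) = 0)"

definition sharp_para_W_L :: "(bool list \<Rightarrow> nat \<Rightarrow> nat) set" where
  "sharp_para_W_L = {F. \<exists>M. wf_tm M \<and> paraL_space M \<and> k_bounded M \<and>
                          (\<forall>x k. nacc M (enc x k) = F x k)}"

definition sharp_para_beta_L :: "(bool list \<Rightarrow> nat \<Rightarrow> nat) set" where
  "sharp_para_beta_L = {F. \<exists>M. wf_tm M \<and> paraL_space M \<and> k_bounded M \<and> read_once M \<and>
                          (\<forall>x k. nacc M (enc x k) = F x k)}"

text \<open>A deterministic para-L oracle machine that halts on every input, having written its single
  oracle query (x', k') (encoded as enc x' k') on the oracle tape; it returns the oracle answer,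
  so F x k = F' x' k'.\<close>
definition plog_pars_red :: "(bool list \<Rightarrow> nat \<Rightarrow> nat) \<Rightarrow> (bool list \<Rightarrow> nat \<Rightarrow> nat) \<Rightarrow> bool" where
  "plog_pars_red F F' \<longleftrightarrow> (\<exists>M g. wf_tm M \<and> deterministic M \<and> paraL_space M \<and> computable g \<and>
     (\<forall>x k. \<exists>t x' k'. (st (run M (enc x k) (\<lambda>_. False) t) = accst M \<or>
                        st (run M (enc x k) (\<lambda>_. False) t) = rejst M)
                     \<and> orc (run M (enc x k) (\<lambda>_. False) t) = enc x' k'
                     \<and> k' \<le> g k \<and> F x k = F' x' k'))"

end

(*
  Let R be the reduction machine and P a counting machine for F'.  The composite machine runs P on
  the query (x', k') without ever storing it: whenever P needs the query symbol at position p, R is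
  rerun from the start on (x, k), its output symbols being counted on a binary counter, until the
  p-th symbol appears (or R halts, so that p lies beyond the query).  Only the simulated steps of P
  move the choice head, one cell at a time, so the composite machine has exactly the accepting paths
  of P on (x', k'), and read-once access is inherited.

  R is deterministic and works in space s = O(log |x| + fR k), so by a pigeonhole argument on its
  configurations it halts within V ^ O(s) steps; the query is therefore that short and
  log |x'| = O(log |x| + fR k).  As k' <= g k, the parameter dependence f k' of P's space and
  choice bounds is dominated by the computable function k |-> sum of f j over j <= g k.
*)
theory Submission
  imports Defs "HOL-Library.Nat_Bijection"
begin

section \<open>Computable functions\<close>

lemma reval_proj: "i < length xs \<Longrightarrow> y = xs ! i \<Longrightarrow> reval (Proj i) xs y"
  using reval.intros(3) by simp

lemmas reval_rules = reval.intros(1,2,4,5,6,7) reval_proj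

definition radd :: recf where "radd = Prim (Proj 0) (Comp Sc [Proj 0])"

lemma reval_add: "reval radd [n, m] (n + m)"
proof (induction n)
  case 0
  then show ?case unfolding radd_def by (rule reval.intros(5)) (rule reval_proj; simp)
next
  case (Suc n)
  have "reval (Comp Sc [Proj 0]) [n + m, n, m] (Suc (n + m))"
    by (rule reval.intros(4)[where ys="[n+m]"]) (auto intro: reval_rules)
  then show ?case using Suc unfolding radd_def by (auto intro: reval_rules)
qed

definition rmul :: recf where "rmul = Prim Zr (Comp radd [Proj 0, Proj 2])"

lemma reval_mul: "reval rmul [n, m] (n * m)"
proof (induction n)
  case 0
  then show ?case unfolding rmul_def by (auto intro: reval_rules)
next
  case (Suc n)
  have "reval (Comp radd [Proj 0, Proj 2]) [n * m, n, m] (n * m + m)"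
    by (rule reval.intros(4)[where ys="[n*m, m]"]) (auto intro: reval_rules reval_add)
  then show ?case using Suc unfolding rmul_def by (auto intro: reval_rules simp: add.commute)
qed

lemma computable_const: "computable (\<lambda>_. c)"
proof (induction c)
  case 0
  then show ?case unfolding computable_def by (auto intro: reval_rules)
next
  case (Suc c)
  then obtain r where r: "\<forall>n. reval r [n] c" unfolding computable_def by auto
  have "reval (Comp Sc [r]) [n] (Suc c)" for n
    by (rule reval.intros(4)[where ys="[c]"]) (use r in \<open>auto intro: reval_rules\<close>)
  then show ?case unfolding computable_def by blast
qed

lemma computable_comp: "computable f \<Longrightarrow> computable g \<Longrightarrow> computable (\<lambda>n. f (g n))"
proof -
  assume "computable f" "computable g"
  then obtain rf rg where rf: "\<forall>n. reval rf [n] (f n)" and rg: "\<forall>n. reval rg [n] (g n)"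
    unfolding computable_def by auto
  have "reval (Comp rf [rg]) [n] (f (g n))" for n
    by (rule reval.intros(4)[where ys="[g n]"]) (use rf rg in auto)
  then show ?thesis unfolding computable_def by blast
qed

lemma computable_add: "computable f \<Longrightarrow> computable g \<Longrightarrow> computable (\<lambda>n. f n + g n)"
proof -
  assume "computable f" "computable g"
  then obtain rf rg where rf: "\<forall>n. reval rf [n] (f n)" and rg: "\<forall>n. reval rg [n] (g n)"
    unfolding computable_def by auto
  have "reval (Comp radd [rf, rg]) [n] (f n + g n)" for n
    by (rule reval.intros(4)[where ys="[f n, g n]"]) (use rf rg reval_add in auto)
  then show ?thesis unfolding computable_def by blast
qed

lemma computable_mul: "computable f \<Longrightarrow> computable g \<Longrightarrow> computable (\<lambda>n. f n * g n)"
proof -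
  assume "computable f" "computable g"
  then obtain rf rg where rf: "\<forall>n. reval rf [n] (f n)" and rg: "\<forall>n. reval rg [n] (g n)"
    unfolding computable_def by auto
  have "reval (Comp rmul [rf, rg]) [n] (f n * g n)" for n
    by (rule reval.intros(4)[where ys="[f n, g n]"]) (use rf rg reval_mul in auto)
  then show ?thesis unfolding computable_def by blast
qed

lemma computable_sum: "computable f \<Longrightarrow> computable (\<lambda>n. \<Sum>j\<le>n. f j)"
proof -
  assume "computable f"
  then obtain rf where rf: "\<forall>n. reval rf [n] (f n)" unfolding computable_def by auto
  define base where "base = Comp rf [Zr]"
  define stp where "stp = Comp radd [Proj 0, Comp rf [Comp Sc [Proj 1]]]"
  have b: "reval base [] (f 0)" unfolding base_def
    by (rule reval.intros(4)[where ys="[0]"]) (use rf in \<open>auto intro: reval_rules\<close>)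
  have s: "reval stp [y, n] (y + f (Suc n))" for y n
  proof -
    have 1: "reval (Comp Sc [Proj 1]) [y, n] (Suc n)"
      by (rule reval.intros(4)[where ys="[n]"]) (auto intro: reval_rules)
    have 2: "reval (Comp rf [Comp Sc [Proj 1]]) [y, n] (f (Suc n))"
      by (rule reval.intros(4)[where ys="[Suc n]"]) (use 1 rf in auto)
    show ?thesis unfolding stp_def
      by (rule reval.intros(4)[where ys="[y, f (Suc n)]"]) (use 2 reval_add in \<open>auto intro: reval_rules\<close>)
  qed
  have "reval (Prim base stp) [n] (\<Sum>j\<le>n. f j)" for n
  proof (induction n)
    case 0 then show ?case using b by (auto intro: reval_rules)
  next
    case (Suc n)
    show ?case using reval.intros(6)[OF Suc.IH s[of "\<Sum>j\<le>n. f j" n]] by simp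
  qed
  then show ?thesis unfolding computable_def by blast
qed

section \<open>Runs of machines\<close>

lemma run_0[simp]: "run M w c 0 = init_cfg" by (simp add: run_def)
lemma run_Suc: "run M w c (Suc t) = step M w c (run M w c t)" by (simp add: run_def)

definition halted :: "tm \<Rightarrow> cfg \<Rightarrow> bool" where
  "halted M C \<longleftrightarrow> st C = accst M \<or> st C = rejst M"

lemma step_unfold:
  assumes "\<not> halted M C"
    and "delta M (st C) (inp w (idxval (it C))) (wt C (wh C)) (it C (ih C)) (chsym c (ch C)) = (q', s', mw, i', mi, mc, ow)"
  shows "step M w c C = C\<lparr>st := q', wt := (wt C)(wh C := s'), wh := mv mw (wh C),
            it := (it C)(ih C := i'), ih := mv mi (ih C), ch := mv mc (ch C),
            orc := orc C @ (case ow of None \<Rightarrow> [] | Some b \<Rightarrow> [b])\<rparr>"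
  using assms unfolding step_def halted_def by simp

lemma delta_obtain:
  obtains q' s' mw i' mi mc ow where
    "delta M (st C) (inp w (idxval (it C))) (wt C (wh C)) (it C (ih C)) (chsym c (ch C)) = (q', s', mw, i', mi, mc, ow)"
  by (metis prod_cases7)

lemma step_halted: "halted M C \<Longrightarrow> step M w c C = C"
  by (simp add: step_def halted_def)

lemma run_halted_stay: assumes "halted M (run M w c t)" "t \<le> t'" shows "run M w c t' = run M w c t"
  using assms(2,1) proof (induction t' rule: dec_induct)
  case base then show ?case by simp
next
  case (step n) then show ?case by (simp add: run_Suc step_halted)
qed

lemma step_orc: "\<exists>zs. orc (step M w c C) = orc C @ zs \<and> length zs \<le> 1"
proof (cases "halted M C")
  case True then show ?thesis by (simp add: step_halted)
next
  case False
  obtain q' s' mw i' mi mc ow where d: "delta M (st C) (inp w (idxval (it C))) (wt C (wh C)) (it C (ih C)) (chsym c (ch C)) = (q', s', mw, i', mi, mc, ow)"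
    by (rule delta_obtain)
  show ?thesis by (simp add: step_unfold[OF False d] split: option.splits)
qed

lemma run_orc_prefix: assumes "t \<le> t'" shows "\<exists>zs. orc (run M w c t') = orc (run M w c t) @ zs"
  using assms proof (induction t' rule: dec_induct)
  case base then show ?case by simp
next
  case (step n) then show ?case using step_orc[of M w c "run M w c n"] by (auto simp: run_Suc)
qed

lemma run_orc_len: "length (orc (run M w c t)) \<le> t"
proof (induction t)
  case 0 then show ?case by (simp add: init_cfg_def)
next
  case (Suc t) then show ?case using step_orc[of M w c "run M w c t"] by (auto simp: run_Suc)
qed

lemma wf_delta:
  assumes "wf_tm M" "q < nstates M" "s < nsyms M" "i < nsyms M"
    "delta M q a s i c = (q', s', mw, i', mi, mc, ow)"
  shows "q' < nstates M \<and> s' < nsyms M \<and> i' < nsyms M \<and> (\<forall>b. ow = Some b \<longrightarrow> b < 3)"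
proof -
  note A = assms(1)[unfolded wf_tm_def, THEN conjunct2, THEN conjunct2, THEN conjunct2, THEN conjunct2, THEN conjunct2]
  note B = A[THEN spec[where x=q], THEN spec[where x=a], THEN spec[where x=s], THEN spec[where x=i], THEN spec[where x=c]]
  from B assms(2-4) have "case delta M q a s i c of (q', s', _, i', _, _, ow) \<Rightarrow>
           q' < nstates M \<and> s' < nsyms M \<and> i' < nsyms M \<and> (\<forall>b. ow = Some b \<longrightarrow> b < 3)"
    by (elim impE)
  then show ?thesis using assms(5) by simp
qed

lemma wf_run_inv:
  assumes "wf_tm M"
  shows "st (run M w c t) < nstates M \<and> (\<forall>j. wt (run M w c t) j < nsyms M) \<and> (\<forall>j. it (run M w c t) j < nsyms M)"
proof (induction t)
  case 0 then show ?case using assms by (simp add: init_cfg_def wf_tm_def)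
next
  case (Suc t)
  let ?C = "run M w c t"
  show ?case
  proof (cases "st ?C = accst M \<or> st ?C = rejst M")
    case True then show ?thesis using Suc by (simp add: run_Suc step_halted halted_def)
  next
    case False
    then have F: "\<not> halted M ?C" by (simp add: halted_def)
    obtain q' s' mw i' mi mc ow where d: "delta M (st ?C) (inp w (idxval (it ?C))) (wt ?C (wh ?C)) (it ?C (ih ?C)) (chsym c (ch ?C)) = (q', s', mw, i', mi, mc, ow)"
      by (rule delta_obtain)
    have "q' < nstates M \<and> s' < nsyms M \<and> i' < nsyms M"
      using wf_delta[OF assms, of "st ?C" "wt ?C (wh ?C)" "it ?C (ih ?C)"] Suc d by auto
    then show ?thesis using Suc by (simp add: run_Suc step_unfold[OF F d])
  qed
qed

lemma run_blank_beyond: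
  assumes "\<And>t. wh (run M w c t) \<le> S" "\<And>t. ih (run M w c t) \<le> S" "S < j"
  shows "wt (run M w c t) j = 0 \<and> it (run M w c t) j = 0"
proof (induction t)
  case 0 then show ?case by (simp add: init_cfg_def)
next
  case (Suc t)
  have ne: "wh (run M w c t) \<noteq> j" "ih (run M w c t) \<noteq> j" using assms(1,2)[of t] assms(3) by auto
  show ?case
  proof (cases "halted M (run M w c t)")
    case True then show ?thesis using Suc by (simp add: run_Suc step_halted)
  next
    case False
    obtain q' s' mw i' mi mc ow where d: "delta M (st (run M w c t)) (inp w (idxval (it (run M w c t)))) (wt (run M w c t) (wh (run M w c t))) (it (run M w c t) (ih (run M w c t))) (chsym c (ch (run M w c t))) = (q', s', mw, i', mi, mc, ow)"
      by (rule delta_obtain)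
    show ?thesis using Suc ne by (simp add: run_Suc step_unfold[OF False d])
  qed
qed

section \<open>Halting time of a deterministic space-bounded machine\<close>

definition core :: "cfg \<Rightarrow> nat \<times> (nat \<Rightarrow> nat) \<times> nat \<times> (nat \<Rightarrow> nat) \<times> nat \<times> nat" where
  "core C = (st C, wt C, wh C, it C, ih C, ch C)"

lemma core_step: assumes "core C1 = core C2" shows "core (step M w c C1) = core (step M w c C2)"
proof -
  have e: "st C1 = st C2" "wt C1 = wt C2" "wh C1 = wh C2" "it C1 = it C2" "ih C1 = ih C2" "ch C1 = ch C2"
    using assms by (auto simp: core_def)
  show ?thesis
  proof (cases "halted M C1")
    case True then show ?thesis using e assms by (simp add: step_halted halted_def)
  next
    case False
    then have choice_head_reached_by_Mp: "\<not> halted M C2" using e by (simp add: halted_def)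
    obtain q' s' mw i' mi mc ow where d: "delta M (st C1) (inp w (idxval (it C1))) (wt C1 (wh C1)) (it C1 (ih C1)) (chsym c (ch C1)) = (q', s', mw, i', mi, mc, ow)"
      by (rule delta_obtain)
    then have d2: "delta M (st C2) (inp w (idxval (it C2))) (wt C2 (wh C2)) (it C2 (ih C2)) (chsym c (ch C2)) = (q', s', mw, i', mi, mc, ow)"
      using e by simp
    show ?thesis using e by (simp add: step_unfold[OF False d] step_unfold[OF choice_head_reached_by_Mp d2] core_def)
  qed
qed

lemma core_shift:
  assumes "core (run M w c t1) = core (run M w c t2)"
  shows "core (run M w c (t1 + s)) = core (run M w c (t2 + s))"
  using assms by (induction s) (auto simp: run_Suc intro: core_step)

definition codeL :: "nat \<Rightarrow> cfg \<Rightarrow> nat list" where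
  "codeL S C = [st C] @ map (wt C) [0..<Suc S] @ map (\<lambda>j. if j = wh C then 1 else 0) [0..<Suc S]
     @ map (it C) [0..<Suc S] @ map (\<lambda>j. if j = ih C then 1 else 0) [0..<Suc S]"

lemma codeL_len: "length (codeL S C) = 4 * S + 5" by (simp add: codeL_def)

lemma map_upt_eq: "map f [0..<n] = map g [0..<n] \<Longrightarrow> j < n \<Longrightarrow> f j = g j"
  by (simp add: map_eq_conv)

lemma codeL_inj:
  assumes "codeL S C1 = codeL S C2" "wh C1 \<le> S" "wh C2 \<le> S" "ih C1 \<le> S" "ih C2 \<le> S"
    "\<forall>j>S. wt C1 j = 0 \<and> it C1 j = 0" "\<forall>j>S. wt C2 j = 0 \<and> it C2 j = 0" "ch C1 = ch C2"
  shows "core C1 = core C2"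
proof -
  let ?n = "Suc S"
  have e: "st C1 = st C2" and
    a: "map (wt C1) [0..<?n] = map (wt C2) [0..<?n]" and
    b: "map (\<lambda>j. if j = wh C1 then 1::nat else 0) [0..<?n] = map (\<lambda>j. if j = wh C2 then 1 else 0) [0..<?n]" and
    c: "map (it C1) [0..<?n] = map (it C2) [0..<?n]" and
    d: "map (\<lambda>j. if j = ih C1 then 1::nat else 0) [0..<?n] = map (\<lambda>j. if j = ih C2 then 1 else 0) [0..<?n]"
    using assms(1) unfolding codeL_def by auto
  have "wt C1 = wt C2"
  proof
    fix j show "wt C1 j = wt C2 j"
      using map_upt_eq[OF a, of j] assms(6,7) by (cases "j < ?n") auto
  qed
  moreover have "it C1 = it C2"
  proof
    fix j show "it C1 j = it C2 j"
      using map_upt_eq[OF c, of j] assms(6,7) by (cases "j < ?n") auto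
  qed
  moreover have "wh C1 = wh C2"
    using map_upt_eq[OF b, of "wh C1"] assms(2) by (auto split: if_splits)
  moreover have "ih C1 = ih C2"
    using map_upt_eq[OF d, of "ih C1"] assms(4) by (auto split: if_splits)
  ultimately show ?thesis using e assms(8) by (simp add: core_def)
qed

lemma codeL_range:
  assumes "st C < V" "\<forall>j. wt C j < V" "\<forall>j. it C j < V" "2 \<le> V"
  shows "set (codeL S C) \<subseteq> {..<V}"
  using assms unfolding codeL_def by auto

lemma halting_time_bound:
  assumes wf: "wf_tm M"
    and bw: "\<And>t. wh (run M w c t) \<le> S" and bi: "\<And>t. ih (run M w c t) \<le> S"
    and chc: "\<And>t. ch (run M w c t) = 0"
    and h: "halted M (run M w c th)"
    and hmin: "\<And>t. t < th \<Longrightarrow> \<not> halted M (run M w c t)"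
  shows "th \<le> (max (nstates M) (nsyms M)) ^ (4 * S + 5)"
proof -
  let ?V = "max (nstates M) (nsyms M)"
  let ?f = "\<lambda>t. codeL S (run M w c t)"
  have V2: "2 \<le> ?V" using wf by (auto simp: wf_tm_def)
  have inj: "inj_on ?f {..<th}"
  proof (rule inj_onI)
    fix t1 t2 assume t1: "t1 \<in> {..<th}" and t2: "t2 \<in> {..<th}" and eq: "?f t1 = ?f t2"
    have blank: "\<forall>j>S. wt (run M w c t) j = 0 \<and> it (run M w c t) j = 0" for t
      using run_blank_beyond[OF bw bi] by blast
    have core_eq: "core (run M w c t1) = core (run M w c t2)"
      by (rule codeL_inj[OF eq bw bw bi bi blank blank]) (simp add: chc)
    show "t1 = t2"
    proof (rule ccontr)
      assume ne: "t1 \<noteq> t2"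
      { fix a b assume ab: "a < b" "b < th" and ce: "core (run M w c a) = core (run M w c b)"
        have "core (run M w c (a + (th - b))) = core (run M w c (b + (th - b)))"
          by (rule core_shift[OF ce])
        then have "st (run M w c (a + (th - b))) = st (run M w c th)"
          using ab by (simp add: core_def)
        then have "halted M (run M w c (a + (th - b)))" using h by (simp add: halted_def)
        moreover have "a + (th - b) < th" using ab by simp
        ultimately have False using hmin by blast }
      then show False using ne core_eq t1 t2
        by (metis lessThan_iff linorder_neqE_nat)
    qed
  qed
  have sub: "?f ` {..<th} \<subseteq> {xs. set xs \<subseteq> {..<?V} \<and> length xs = 4 * S + 5}"
  proof
    fix xs assume "xs \<in> ?f ` {..<th}"
    then obtain t where xs: "xs = ?f t" by auto
    have "st (run M w c t) < ?V" "\<forall>j. wt (run M w c t) j < ?V" "\<forall>j. it (run M w c t) j < ?V"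
      using wf_run_inv[OF wf, of w c t] by (auto simp: less_max_iff_disj)
    then show "xs \<in> {xs. set xs \<subseteq> {..<?V} \<and> length xs = 4 * S + 5}"
      using codeL_range[OF _ _ _ V2] xs codeL_len by auto
  qed
  have "th = card (?f ` {..<th})" using card_image[OF inj] by simp
  also have "\<dots> \<le> card {xs. set xs \<subseteq> {..<?V} \<and> length xs = 4 * S + 5}"
    by (rule card_mono[OF _ sub]) (rule finite_lists_length_eq, simp)
  also have "\<dots> = ?V ^ (4 * S + 5)" by (subst card_lists_length_eq) auto
  finally show ?thesis .
qed

lemma lg_pos: "1 \<le> lg n" by (simp add: lg_def)

lemma lg_mono: "m \<le> n \<Longrightarrow> lg m \<le> lg n"
  by (simp add: lg_def floor_log_le_iff)

lemma lg_lt_pow: "n < 2 ^ lg n"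
  using floor_log_exp2_gt[of n] by (simp add: lg_def)

lemma lg_le_of_lt_pow: assumes "0 < n" "n < 2 ^ m" shows "lg n \<le> m"
proof -
  have "2 ^ floor_log n \<le> n" using floor_log_exp2_le assms(1) by auto
  then have "2 ^ floor_log n < (2::nat) ^ m" using assms(2) by linarith
  then have "floor_log n < m" by (simp add: power_strict_increasing_iff)
  then show ?thesis by (simp add: lg_def)
qed

lemma lg_pow: assumes "1 \<le> a" "m \<noteq> 0" shows "lg (a ^ m) \<le> m * lg a"
proof -
  note False = assms(2)
  have "a < 2 ^ lg a" by (rule lg_lt_pow)
  then have "a ^ m < (2 ^ lg a) ^ m" using False by (simp add: power_strict_mono)
  then have "a ^ m < 2 ^ (m * lg a)" by (metis power_mult mult.commute)
  moreover have "0 < a ^ m" using assms by simp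
  ultimately show ?thesis using lg_le_of_lt_pow by blast
qed

section \<open>The composite machine\<close>

text \<open>In phase \<open>TOP\<close> the composite machine inspects P's state, collects the symbols under P's
  heads (\<open>GW1\<close>, \<open>GX1\<close>) and restarts R (\<open>RST\<close>).  Each round \<open>MHEAD\<close>/\<open>MSTEP\<close> collects the
  symbols under R's heads (\<open>GW2\<close>, \<open>GX2\<close>), compares the output counter with P's index (\<open>CMP\<close>)
  and performs one step of R (\<open>AW2\<close>, \<open>AX2\<close>, \<open>INC\<close>); \<open>COMMIT\<close> finally performs P's step on
  the symbol found (\<open>AW1\<close>, \<open>AX1\<close>).  Every job is one sweep right (\<open>SR\<close>) and back left (\<open>SL\<close>).\<close>

datatype job = GW1 | GX1 | RST | GW2 | GX2 | CMP | AW2 | AX2 | INC | AW1 | AX1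
datatype phase = INIT | TOP | ACC | REJ | MHEAD | MSTEP | COMMIT | SR job | SL job

fun jn :: "job \<Rightarrow> nat" where
  "jn GW1 = 0" | "jn GX1 = 1" | "jn RST = 2" | "jn GW2 = 3" | "jn GX2 = 4" | "jn CMP = 5"
| "jn AW2 = 6" | "jn AX2 = 7" | "jn INC = 8" | "jn AW1 = 9" | "jn AX1 = 10"

definition jd :: "nat \<Rightarrow> job" where
  "jd n = [GW1, GX1, RST, GW2, GX2, CMP, AW2, AX2, INC, AW1, AX1] ! n"

lemma jd_jn[simp]: "jd (jn j) = j" by (cases j) (simp_all add: jd_def)
lemma jn_lt: "jn j < 11" by (cases j) simp_all

fun phn :: "phase \<Rightarrow> nat" where
  "phn INIT = 0" | "phn TOP = 1" | "phn ACC = 2" | "phn REJ = 3" | "phn MHEAD = 4" | "phn MSTEP = 5"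
| "phn COMMIT = 6" | "phn (SR j) = 7 + jn j" | "phn (SL j) = 18 + jn j"

definition phd :: "nat \<Rightarrow> phase" where
  "phd n = (if n = 0 then INIT else if n = 1 then TOP else if n = 2 then ACC else if n = 3 then REJ
     else if n = 4 then MHEAD else if n = 5 then MSTEP else if n = 6 then COMMIT
     else if n < 18 then SR (jd (n - 7)) else SL (jd (n - 18)))"

lemma phd_phn[simp]: "phd (phn p) = p"
proof (cases p)
  case (SR j) then show ?thesis using jn_lt[of j] by (simp add: phd_def)
next
  case (SL j) then show ?thesis using jn_lt[of j] by (simp add: phd_def)
qed (simp_all add: phd_def)

lemma phn_lt: "phn p < 29"
proof (cases p)
  case (SR j) then show ?thesis using jn_lt[of j] by simp
next
  case (SL j) then show ?thesis using jn_lt[of j] by simp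
qed simp_all

fun mvn :: "move \<Rightarrow> nat" where "mvn L = 0" | "mvn N = 1" | "mvn R = 2"
definition mvd :: "nat \<Rightarrow> move" where "mvd n = (if n = 0 then L else if n = 1 then N else R)"
lemma mvd_mvn[simp]: "mvd (mvn m) = m" by (cases m) (simp_all add: mvd_def)
lemma mvn_lt: "mvn m < 3" by (cases m) simp_all

definition bn :: "bool \<Rightarrow> nat" where "bn b = (if b then 1 else 0)"
lemma bn_lt: "bn b < 2" by (simp add: bn_def)
lemma bn_inv[simp]: "(bn b = 1) = b" by (simp add: bn_def)
lemma bn_inv'[simp]: "(bn b = Suc 0) = b" by (simp add: bn_def)

text \<open>A cell of the composite work tape carries several tracks: \<open>org\<close> marks cell 0;
  \<open>w1\<close>/\<open>m1\<close> and \<open>x1\<close>/\<open>n1\<close> hold P's work and index tape with their head marks; \<open>w2\<close>/\<open>m2\<close> hold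
  R's work tape and \<open>n2\<close> marks R's index head, the contents of R's index tape living on the
  composite index tape, so that R's input reads go through unchanged; \<open>bt\<close> holds one bit of
  the counter of R's output symbols.  Never-visited cells are \<open>None\<close>.\<close>

record cell =
  org :: bool
  w1 :: nat
  m1 :: bool
  x1 :: nat
  n1 :: bool
  w2 :: nat
  m2 :: bool
  n2 :: bool
  bt :: bool

text \<open>Besides the phase, the control state stores the states \<open>q1\<close>, \<open>q2\<close> of P and R and the
  symbols under their heads, the query symbol \<open>av\<close> found for P (\<open>0\<close> if the position lies beyond
  the query, else the symbol plus one), the writes and moves of the step in progress, and the flags
  \<open>eqf\<close> (counter equals P's index), \<open>inc\<close> (R has just output a symbol), \<open>pnd\<close> (a head mark
  is to be placed on the next cell of the sweep), \<open>dn\<close> (job done) and \<open>cry\<close> (carry of the counter).\<close>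

record ast =
  ph :: phase
  q1 :: nat
  q2 :: nat
  av :: nat
  s1 :: nat
  i1 :: nat
  s2 :: nat
  i2 :: nat
  eqf :: bool
  inc :: bool
  wv1 :: nat
  xv1 :: nat
  wm1 :: move
  xm1 :: move
  wv2 :: nat
  xv2 :: nat
  wm2 :: move
  xm2 :: move
  pnd :: bool
  dn :: bool
  cry :: bool

definition clist :: "cell \<Rightarrow> nat list" where
  "clist c = [bn (org c), w1 c, bn (m1 c), x1 c, bn (n1 c), w2 c, bn (m2 c), bn (n2 c), bn (bt c)]"

definition cfrom :: "nat list \<Rightarrow> cell" where
  "cfrom l = \<lparr>org = (l!0 = 1), w1 = l!1, m1 = (l!2 = 1), x1 = l!3, n1 = (l!4 = 1), w2 = l!5,
     m2 = (l!6 = 1), n2 = (l!7 = 1), bt = (l!8 = 1)\<rparr>"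

lemma cfrom_clist[simp]: "cfrom (clist c) = c" by (simp add: cfrom_def clist_def)

definition slist :: "ast \<Rightarrow> nat list" where
  "slist S = [phn (ph S), q1 S, q2 S, av S, s1 S, i1 S, s2 S, i2 S, bn (eqf S), bn (inc S),
     wv1 S, xv1 S, mvn (wm1 S), mvn (xm1 S), wv2 S, xv2 S, mvn (wm2 S), mvn (xm2 S),
     bn (pnd S), bn (dn S), bn (cry S)]"

definition sfrom :: "nat list \<Rightarrow> ast" where
  "sfrom l = \<lparr>ph = phd (l!0), q1 = l!1, q2 = l!2, av = l!3, s1 = l!4, i1 = l!5, s2 = l!6, i2 = l!7,
     eqf = (l!8 = 1), inc = (l!9 = 1), wv1 = l!10, xv1 = l!11, wm1 = mvd (l!12), xm1 = mvd (l!13),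
     wv2 = l!14, xv2 = l!15, wm2 = mvd (l!16), xm2 = mvd (l!17), pnd = (l!18 = 1), dn = (l!19 = 1),
     cry = (l!20 = 1)\<rparr>"

lemma sfrom_slist[simp]: "sfrom (slist S) = S" by (simp add: sfrom_def slist_def)

definition S0 :: ast where
  "S0 = \<lparr>ph = INIT, q1 = 0, q2 = 0, av = 0, s1 = 0, i1 = 0, s2 = 0, i2 = 0, eqf = False, inc = False,
     wv1 = 0, xv1 = 0, wm1 = N, xm1 = N, wv2 = 0, xv2 = 0, wm2 = N, xm2 = N, pnd = False, dn = False,
     cry = False\<rparr>"

text \<open>Every machine starts in state \<open>0\<close>, so \<open>S0\<close> must be encoded by \<open>0\<close>.\<close>

definition encS :: "ast \<Rightarrow> nat" where
  "encS S = (if S = S0 then 0 else Suc (list_encode (slist S)))"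
definition decS :: "nat \<Rightarrow> ast" where
  "decS n = (if n = 0 then S0 else sfrom (list_decode (n - 1)))"

lemma decS_encS[simp]: "decS (encS S) = S" by (simp add: encS_def decS_def)
lemma encS_inj: "encS S = encS S' \<longleftrightarrow> S = S'" by (metis decS_encS)
lemma encS_S0[simp]: "encS S0 = 0" by (simp add: encS_def)

definition encC :: "cell option \<Rightarrow> nat" where
  "encC co = (case co of None \<Rightarrow> 0 | Some c \<Rightarrow> Suc (list_encode (clist c)))"
definition decC :: "nat \<Rightarrow> cell option" where
  "decC n = (if n = 0 then None else Some (cfrom (list_decode (n - 1))))"

lemma decC_encC[simp]: "decC (encC co) = co" by (cases co) (simp_all add: encC_def decC_def)
lemma encC_None[simp]: "encC None = 0" by (simp add: encC_def)

definition blank_cell :: cell where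
  "blank_cell = \<lparr>org = False, w1 = 0, m1 = False, x1 = 0, n1 = False, w2 = 0, m2 = False, n2 = False, bt = False\<rparr>"
definition initial_cell :: cell where "initial_cell = blank_cell\<lparr>org := True, m1 := True, n1 := True\<rparr>"

definition ACCs :: ast where "ACCs = S0\<lparr>ph := ACC\<rparr>"
definition REJs :: ast where "REJs = S0\<lparr>ph := REJ\<rparr>"

definition is_origin :: "cell option \<Rightarrow> bool" where "is_origin co = (case co of None \<Rightarrow> False | Some c \<Rightarrow> org c)"

definition answer_symbol :: "nat \<Rightarrow> nat option" where "answer_symbol n = (if n = 0 then None else Some (n - 1))"

definition start_job :: "job \<Rightarrow> ast \<Rightarrow> ast" where
  "start_job j S = S\<lparr>ph := SR j, pnd := False, dn := False, cry := True, eqf := True\<rparr>"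

fun head_mark :: "job \<Rightarrow> cell \<Rightarrow> bool" where
  "head_mark AW1 c = m1 c" | "head_mark AX1 c = n1 c" | "head_mark AW2 c = m2 c" | "head_mark AX2 c = n2 c" | "head_mark _ c = False"
fun set_head_mark :: "job \<Rightarrow> bool \<Rightarrow> cell \<Rightarrow> cell" where
  "set_head_mark AW1 b c = c\<lparr>m1 := b\<rparr>" | "set_head_mark AX1 b c = c\<lparr>n1 := b\<rparr>" | "set_head_mark AW2 b c = c\<lparr>m2 := b\<rparr>"
| "set_head_mark AX2 b c = c\<lparr>n2 := b\<rparr>" | "set_head_mark _ b c = c"
fun set_track_value :: "job \<Rightarrow> nat \<Rightarrow> cell \<Rightarrow> nat \<Rightarrow> cell \<times> nat" where
  "set_track_value AW1 v c r = (c\<lparr>w1 := v\<rparr>, r)" | "set_track_value AX1 v c r = (c\<lparr>x1 := v\<rparr>, r)"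
| "set_track_value AW2 v c r = (c\<lparr>w2 := v\<rparr>, r)" | "set_track_value AX2 v c r = (c, v)" | "set_track_value _ v c r = (c, r)"
fun job_value :: "job \<Rightarrow> ast \<Rightarrow> nat" where
  "job_value AW1 S = wv1 S" | "job_value AX1 S = xv1 S" | "job_value AW2 S = wv2 S" | "job_value AX2 S = xv2 S" | "job_value _ S = 0"
fun job_move :: "job \<Rightarrow> ast \<Rightarrow> move" where
  "job_move AW1 S = wm1 S" | "job_move AX1 S = xm1 S" | "job_move AW2 S = wm2 S" | "job_move AX2 S = xm2 S" | "job_move _ S = N"

definition is_apply_job :: "job \<Rightarrow> bool" where "is_apply_job j \<longleftrightarrow> j \<in> {AW1, AX1, AW2, AX2}"

definition right_step :: "job \<Rightarrow> ast \<Rightarrow> cell option \<Rightarrow> nat \<Rightarrow> ast \<times> cell option \<times> nat \<times> bool" where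
  "right_step j S co r = (case co of
     None \<Rightarrow> (if pnd S then (S\<lparr>pnd := False, dn := True\<rparr>, Some (set_head_mark j True blank_cell), r, True)
              else if j = INC \<and> cry S then (S\<lparr>cry := False\<rparr>, Some (blank_cell\<lparr>bt := True\<rparr>), r, True)
              else (S, None, r, False))
   | Some c \<Rightarrow> (case j of
       GW1 \<Rightarrow> (if m1 c then S\<lparr>s1 := w1 c\<rparr> else S, Some c, r, True)
     | GX1 \<Rightarrow> (if n1 c then S\<lparr>i1 := x1 c\<rparr> else S, Some c, r, True)
     | RST \<Rightarrow> (S, Some (c\<lparr>w2 := 0, m2 := org c, n2 := org c, bt := False\<rparr>), 0, True)
     | GW2 \<Rightarrow> (if m2 c then S\<lparr>s2 := w2 c\<rparr> else S, Some c, r, True)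
     | GX2 \<Rightarrow> (if n2 c then S\<lparr>i2 := r\<rparr> else S, Some c, r, True)
     | CMP \<Rightarrow> (S\<lparr>eqf := (eqf S \<and> (bt c \<longleftrightarrow> x1 c = 2))\<rparr>, Some c, r, True)
     | INC \<Rightarrow> (S\<lparr>cry := (cry S \<and> bt c)\<rparr>, Some (c\<lparr>bt := (bt c \<noteq> cry S)\<rparr>), r, True)
     | _ \<Rightarrow> (if pnd S then (S\<lparr>pnd := False, dn := True\<rparr>, Some (set_head_mark j True c), r, True)
            else if head_mark j c \<and> \<not> dn S then
              (case set_track_value j (job_value j S) c r of (c1, r1) \<Rightarrow>
                 if job_move j S = R then (S\<lparr>pnd := True, dn := True\<rparr>, Some (set_head_mark j False c1), r1, True)
                 else (S\<lparr>dn := True\<rparr>, Some c1, r1, True))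
            else (S, Some c, r, True))))"

definition left_step :: "job \<Rightarrow> ast \<Rightarrow> cell option \<Rightarrow> nat \<Rightarrow> ast \<times> cell option \<times> nat" where
  "left_step j S co r = (case co of None \<Rightarrow> (S, co, r) | Some c \<Rightarrow>
     (if is_apply_job j \<and> job_move j S = L then
        (if pnd S then (S\<lparr>pnd := False, dn := True\<rparr>, Some (set_head_mark j True c), r)
         else if head_mark j c \<and> \<not> dn S \<and> \<not> org c then (S\<lparr>pnd := True, dn := True\<rparr>, Some (set_head_mark j False c), r)
         else (S, co, r))
      else (S, co, r)))"

definition finish_job :: "job \<Rightarrow> ast \<Rightarrow> ast" where
  "finish_job j S = (case j of
     GW1 \<Rightarrow> start_job GX1 S | GX1 \<Rightarrow> start_job RST S | RST \<Rightarrow> S\<lparr>ph := MHEAD, q2 := 0\<rparr>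
   | GW2 \<Rightarrow> start_job GX2 S | GX2 \<Rightarrow> start_job CMP S | CMP \<Rightarrow> S\<lparr>ph := MSTEP\<rparr>
   | AW2 \<Rightarrow> start_job AX2 S | AX2 \<Rightarrow> (if inc S then start_job INC S else S\<lparr>ph := MHEAD\<rparr>)
   | INC \<Rightarrow> S\<lparr>ph := MHEAD\<rparr> | AW1 \<Rightarrow> start_job AX1 S | AX1 \<Rightarrow> S\<lparr>ph := TOP\<rparr>)"

record acfg =
  AS :: ast
  AT :: "nat \<Rightarrow> cell option"
  AH :: nat
  AR :: "nat \<Rightarrow> nat"
  AG :: nat
  AC :: nat

definition A0 :: acfg where
  "A0 = \<lparr>AS = S0, AT = (\<lambda>_. None), AH = 0, AR = (\<lambda>_. 0), AG = 0, AC = 0\<rparr>"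

definition concrete :: "acfg \<Rightarrow> cfg" where
  "concrete A = \<lparr>st = encS (AS A), wt = (\<lambda>j. encC (AT A j)), wh = AH A, it = AR A, ih = AG A, ch = AC A, orc = []\<rparr>"

lemma concrete_A0: "concrete A0 = init_cfg"
  by (simp add: concrete_def A0_def init_cfg_def)

definition halted_state :: "ast \<Rightarrow> bool" where "halted_state S \<longleftrightarrow> S = ACCs \<or> S = REJs"

locale composite =
  fixes Mr Mp :: tm
  assumes wfr: "wf_tm Mr" and wfp: "wf_tm Mp"
begin

definition adelta :: "ast \<Rightarrow> nat option \<Rightarrow> cell option \<Rightarrow> nat \<Rightarrow> bool option \<Rightarrow> ast \<times> cell option \<times> nat \<times> move \<times> move \<times> move" where
  "adelta S a co r c = (case ph S of
     INIT \<Rightarrow> (S0\<lparr>ph := TOP\<rparr>, Some initial_cell, r, N, N, N)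
   | TOP \<Rightarrow> (if q1 S = accst Mp then (ACCs, co, r, N, N, N)
             else if q1 S = rejst Mp then (REJs, co, r, N, N, N)
             else (start_job GW1 S, co, r, N, N, N))
   | ACC \<Rightarrow> (S, co, r, N, N, N)
   | REJ \<Rightarrow> (S, co, r, N, N, N)
   | MHEAD \<Rightarrow> (if q2 S = accst Mr \<or> q2 S = rejst Mr then (S\<lparr>ph := COMMIT, av := 0\<rparr>, co, r, N, N, N)
               else (start_job GW2 S, co, r, N, N, N))
   | MSTEP \<Rightarrow> (case delta Mr (q2 S) a (s2 S) (i2 S) None of (q', s', mw, i', mi, _, ow) \<Rightarrow>
        (case ow of
           Some b \<Rightarrow> (if eqf S then (S\<lparr>ph := COMMIT, av := Suc b\<rparr>, co, r, N, N, N)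
                      else (start_job AW2 (S\<lparr>q2 := q', wv2 := s', wm2 := mw, xv2 := i', xm2 := mi, inc := True\<rparr>), co, r, N, N, N))
         | None \<Rightarrow> (start_job AW2 (S\<lparr>q2 := q', wv2 := s', wm2 := mw, xv2 := i', xm2 := mi, inc := False\<rparr>), co, r, N, N, N)))
   | COMMIT \<Rightarrow> (case delta Mp (q1 S) (answer_symbol (av S)) (s1 S) (i1 S) c of (q', s', mw, i', mi, mc, _) \<Rightarrow>
        (start_job AW1 (S\<lparr>q1 := q', wv1 := s', wm1 := mw, xv1 := i', xm1 := mi\<rparr>), co, r, N, N, mc))
   | SR j \<Rightarrow> (case right_step j S co r of (S', co', r', cont) \<Rightarrow>
        if cont then (S', co', r', R, R, N) else (S'\<lparr>ph := SL j, pnd := False, dn := False\<rparr>, co', r', L, L, N))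
   | SL j \<Rightarrow> (case left_step j S co r of (S', co', r') \<Rightarrow>
        if is_origin co then (finish_job j S', co', r', N, N, N) else (S', co', r', L, L, N)))"

definition validS :: "ast \<Rightarrow> bool" where
  "validS S \<longleftrightarrow> q1 S < nstates Mp \<and> q2 S < nstates Mr \<and> av S < 4 \<and> s1 S < nsyms Mp \<and> i1 S < nsyms Mp
     \<and> s2 S < nsyms Mr \<and> i2 S < nsyms Mr \<and> wv1 S < nsyms Mp \<and> xv1 S < nsyms Mp
     \<and> wv2 S < nsyms Mr \<and> xv2 S < nsyms Mr"

definition validC :: "cell option \<Rightarrow> bool" where
  "validC co \<longleftrightarrow> (case co of None \<Rightarrow> True | Some c \<Rightarrow> w1 c < nsyms Mp \<and> x1 c < nsyms Mp \<and> w2 c < nsyms Mr)"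

definition BB :: nat where "BB = 29 + nstates Mp + nstates Mr + nsyms Mp + nsyms Mr"

definition NSt :: nat where
  "NSt = Suc (Suc (list_encode [BB, BB, BB, BB, BB, BB, BB, BB, BB, BB, BB, BB, BB, BB, BB, BB, BB, BB, BB, BB, BB]))"
definition NSy :: nat where
  "NSy = Suc (Suc (list_encode [BB, BB, BB, BB, BB, BB, BB, BB, BB])) + nsyms Mr"

text \<open>Transitions leaving the valid states and cells are never taken from reachable configurations;
  sending them to the rejecting state makes \<open>cM\<close> well formed.\<close>

definition cdelta :: "nat \<Rightarrow> nat option \<Rightarrow> nat \<Rightarrow> nat \<Rightarrow> bool option \<Rightarrow> nat \<times> nat \<times> move \<times> nat \<times> move \<times> move \<times> nat option" where
  "cdelta q a s i c = (case adelta (decS q) a (decC s) i c of (S', co, r', mw, mi, mc) \<Rightarrow>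
     if validS S' \<and> validC co \<and> r' < nsyms Mr then (encS S', encC co, mw, r', mi, mc, None)
     else (encS REJs, 0, N, 0, N, N, None))"

definition cM :: tm where
  "cM = \<lparr>nstates = NSt, nsyms = NSy, delta = cdelta, accst = encS ACCs, rejst = encS REJs\<rparr>"

definition astep :: "nat list \<Rightarrow> (nat \<Rightarrow> bool) \<Rightarrow> acfg \<Rightarrow> acfg" where
  "astep w c A = (if halted_state (AS A) then A else
     (case adelta (AS A) (inp w (idxval (AR A))) (AT A (AH A)) (AR A (AG A)) (chsym c (AC A)) of
       (S', co, r', mw, mi, mc) \<Rightarrow>
         A\<lparr>AS := S', AT := (AT A)(AH A := co), AH := mv mw (AH A), AR := (AR A)(AG A := r'),
           AG := mv mi (AG A), AC := mv mc (AC A)\<rparr>))"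

definition arun :: "nat list \<Rightarrow> (nat \<Rightarrow> bool) \<Rightarrow> nat \<Rightarrow> acfg" where
  "arun w c t = (astep w c ^^ t) A0"

definition validA :: "acfg \<Rightarrow> bool" where
  "validA A \<longleftrightarrow> validS (AS A) \<and> (\<forall>j. validC (AT A j)) \<and> (\<forall>j. AR A j < nsyms Mr)"

end

lemma triangle_mono: "a \<le> b \<Longrightarrow> triangle a \<le> triangle b"
  unfolding triangle_def by (intro div_le_mono mult_le_mono) auto

lemma prod_encode_mono: "a \<le> a' \<Longrightarrow> b \<le> b' \<Longrightarrow> prod_encode (a, b) \<le> prod_encode (a', b')"
  unfolding prod_encode_def using triangle_mono[of "a + b" "a' + b'"] by simp

lemma list_encode_mono: "list_all2 (\<le>) xs ys \<Longrightarrow> list_encode xs \<le> list_encode ys"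
  by (induction rule: list_all2_induct) (auto intro: prod_encode_mono)

context composite begin

lemma BB_ge: "nstates Mp < BB" "nstates Mr < BB" "nsyms Mp < BB" "nsyms Mr < BB" "29 \<le> BB"
  by (auto simp: BB_def)

lemma bn_BB: "bn b \<le> BB" and mvn_BB: "mvn m \<le> BB"
  using bn_lt[of b] mvn_lt[of m] BB_ge(5) by linarith+

lemma validS_enc: assumes "validS S" shows "encS S < NSt"
proof -
  have "list_encode (slist S) \<le> list_encode [BB, BB, BB, BB, BB, BB, BB, BB, BB, BB, BB, BB, BB, BB, BB, BB, BB, BB, BB, BB, BB]"
    apply (rule list_encode_mono)
    using assms BB_ge phn_lt[of "ph S"] bn_BB mvn_BB
    unfolding slist_def validS_def
    by (simp add: less_imp_le)
  then show ?thesis unfolding encS_def NSt_def by auto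
qed

lemma validC_enc: assumes "validC co" shows "encC co < NSy"
proof (cases co)
  case None then show ?thesis by (simp add: NSy_def)
next
  case (Some c)
  have "list_encode (clist c) \<le> list_encode [BB, BB, BB, BB, BB, BB, BB, BB, BB]"
    apply (rule list_encode_mono)
    using assms Some BB_ge bn_BB
    unfolding clist_def validC_def
    by (simp add: less_imp_le)
  then show ?thesis using Some unfolding encC_def NSy_def by auto
qed

lemma nsyms_ge: "3 \<le> nsyms Mr" "3 \<le> nsyms Mp" "0 < nstates Mr" "0 < nstates Mp"
  using wfr wfp by (auto simp: wf_tm_def)

lemma validS_S0: "validS (S0\<lparr>ph := p\<rparr>)" using nsyms_ge by (simp add: validS_def S0_def)
lemma validS_ACCs: "validS ACCs" and validS_REJs: "validS REJs"
  using validS_S0 by (simp_all add: ACCs_def REJs_def)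

lemma validS_startR[simp]: "validS (start_job j S) = validS S" by (simp add: start_job_def validS_def)

lemma validS_finish: "validS S \<Longrightarrow> validS (finish_job j S)"
  using nsyms_ge by (cases j) (simp_all add: finish_job_def validS_def start_job_def)

lemma validC_cdef: "validC (Some blank_cell)" "validC (Some (set_head_mark j b blank_cell))" "validC (Some (blank_cell\<lparr>bt := b\<rparr>))"
  using nsyms_ge by (cases j; simp add: validC_def blank_cell_def)+

lemma validC_setm: "validC (Some c) \<Longrightarrow> validC (Some (set_head_mark j b c))"
  by (cases j) (simp_all add: validC_def)

lemma right_step_valid:
  assumes "validS S" "validC co" "r < nsyms Mr" "right_step j S co r = (S', co', r', b)"
  shows "validS S' \<and> validC co' \<and> r' < nsyms Mr"
proof (cases co)
  case None then show ?thesis using assms validC_cdef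
    by (auto simp: right_step_def validS_def split: if_splits)
next
  case (Some c)
  then have vc: "w1 c < nsyms Mp" "x1 c < nsyms Mp" "w2 c < nsyms Mr" using assms(2) by (auto simp: validC_def)
  show ?thesis
  proof (cases j)
    case AW1 then show ?thesis using assms Some vc
      by (auto simp: right_step_def validS_def validC_def split: if_splits)
  next
    case AX1 then show ?thesis using assms Some vc
      by (auto simp: right_step_def validS_def validC_def split: if_splits)
  next
    case AW2 then show ?thesis using assms Some vc
      by (auto simp: right_step_def validS_def validC_def split: if_splits)
  next
    case AX2 then show ?thesis using assms Some vc
      by (auto simp: right_step_def validS_def validC_def split: if_splits)
  qed (use assms Some vc nsyms_ge in \<open>auto simp: right_step_def validS_def validC_def split: if_splits\<close>)
qed

lemma left_step_valid:
  assumes "validS S" "validC co" "r < nsyms Mr" "left_step j S co r = (S', co', r')"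
  shows "validS S' \<and> validC co' \<and> r' < nsyms Mr"
  using assms validC_setm by (auto simp: left_step_def validS_def split: option.splits if_splits)

lemma adelta_valid:
  assumes "validS S" "validC co" "r < nsyms Mr" "adelta S a co r c = (S', co', r', mw, mi, mc)"
  shows "validS S' \<and> validC co' \<and> r' < nsyms Mr"
proof (cases "ph S")
  case INIT then show ?thesis using assms validS_S0 nsyms_ge
    by (auto simp: adelta_def validC_def initial_cell_def blank_cell_def)
next
  case TOP then show ?thesis using assms validS_ACCs validS_REJs
    by (auto simp: adelta_def split: if_splits)
next
  case MHEAD then show ?thesis using assms
    by (auto simp: adelta_def validS_def start_job_def split: if_splits)
next
  case MSTEP
  obtain q' s' mw' i' mi' mc' ow where d: "delta Mr (q2 S) a (s2 S) (i2 S) None = (q', s', mw', i', mi', mc', ow)"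
    by (metis prod_cases7)
  have b: "q' < nstates Mr \<and> s' < nsyms Mr \<and> i' < nsyms Mr \<and> (\<forall>b. ow = Some b \<longrightarrow> b < 3)"
    by (rule wf_delta[OF wfr _ _ _ d]) (use assms(1) in \<open>auto simp: validS_def\<close>)
  show ?thesis using assms MSTEP d b
    by (auto simp: adelta_def validS_def start_job_def split: if_splits option.splits)
next
  case COMMIT
  obtain q' s' mw' i' mi' mc' ow where d: "delta Mp (q1 S) (answer_symbol (av S)) (s1 S) (i1 S) c = (q', s', mw', i', mi', mc', ow)"
    by (metis prod_cases7)
  have b: "q' < nstates Mp \<and> s' < nsyms Mp \<and> i' < nsyms Mp"
    using wf_delta[OF wfp _ _ _ d] assms(1) by (auto simp: validS_def)
  show ?thesis using assms COMMIT d b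
    by (auto simp: adelta_def validS_def start_job_def)
next
  case (SR j)
  obtain S1 co1 r1 b where d: "right_step j S co r = (S1, co1, r1, b)" by (metis prod_cases4)
  show ?thesis using assms SR d right_step_valid[OF assms(1-3) d]
    by (auto simp: adelta_def validS_def split: if_splits)
next
  case (SL j)
  obtain S1 co1 r1 where d: "left_step j S co r = (S1, co1, r1)" by (metis prod_cases3)
  show ?thesis using assms SL d left_step_valid[OF assms(1-3) d] validS_finish
    by (auto simp: adelta_def split: if_splits)
qed (use assms in \<open>auto simp: adelta_def\<close>)

lemma wf_cM: "wf_tm cM"
proof -
  have "encS ACCs < NSt" "encS REJs < NSt" using validS_enc validS_ACCs validS_REJs by auto
  moreover have "encS ACCs \<noteq> encS REJs" by (simp add: encS_inj ACCs_def REJs_def S0_def)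
  moreover have "3 \<le> NSy" using nsyms_ge by (simp add: NSy_def)
  moreover have "case cdelta q a s i c of (q', s', _, i', _, _, ow) \<Rightarrow>
           q' < NSt \<and> s' < NSy \<and> i' < NSy \<and> (\<forall>b. ow = Some b \<longrightarrow> b < 3)" for q a s i c
  proof -
    obtain S' co r' mw mi mc where d: "adelta (decS q) a (decC s) i c = (S', co, r', mw, mi, mc)"
      by (metis prod_cases6)
    show ?thesis using d validS_enc validC_enc validS_REJs by (auto simp: cdelta_def NSy_def)
  qed
  ultimately show ?thesis unfolding wf_tm_def cM_def by simp
qed

lemma step_conc:
  assumes "validA A"
  shows "step cM w c (concrete A) = concrete (astep w c A) \<and> validA (astep w c A)"
proof (cases "halted_state (AS A)")
  case True
  then have "st (concrete A) = accst cM \<or> st (concrete A) = rejst cM"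
    by (auto simp: halted_state_def concrete_def cM_def)
  then show ?thesis using True assms by (simp add: step_def astep_def)
next
  case False
  then have nh: "\<not> (st (concrete A) = accst cM \<or> st (concrete A) = rejst cM)"
    by (auto simp: halted_state_def concrete_def cM_def encS_inj)
  obtain S' co r' mw mi mc where d: "adelta (AS A) (inp w (idxval (AR A))) (AT A (AH A)) (AR A (AG A)) (chsym c (AC A)) = (S', co, r', mw, mi, mc)"
    by (metis prod_cases6)
  have v: "validS S' \<and> validC co \<and> r' < nsyms Mr"
    by (rule adelta_valid[OF _ _ _ d]) (use assms in \<open>auto simp: validA_def\<close>)
  have cd: "delta cM (st (concrete A)) (inp w (idxval (it (concrete A)))) (wt (concrete A) (wh (concrete A))) (it (concrete A) (ih (concrete A))) (chsym c (ch (concrete A)))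
     = (encS S', encC co, mw, r', mi, mc, None)"
    using d v by (simp add: cM_def cdelta_def concrete_def)
  have "step cM w c (concrete A) = concrete (astep w c A)"
    unfolding step_def using nh cd False d
    by (simp add: astep_def concrete_def fun_eq_iff)
  moreover have "validA (astep w c A)" using assms v False d
    by (simp add: astep_def validA_def)
  ultimately show ?thesis by simp
qed

lemma validA_A0: "validA A0"
  using nsyms_ge by (simp add: validA_def A0_def validS_def S0_def validC_def)

lemma run_conc: "run cM w c t = concrete (arun w c t) \<and> validA (arun w c t)"
proof (induction t)
  case 0 then show ?case by (simp add: arun_def concrete_A0 validA_A0)
next
  case (Suc t)
  then show ?case using step_conc[of "arun w c t" w c] by (simp add: run_Suc arun_def)
qed

end

section \<open>Sweeps\<close>

lemma right_step_ph: "right_step j S co r = (S', co', r', b) \<Longrightarrow> ph S' = ph S"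
  by (auto simp: right_step_def split: option.splits job.splits if_splits prod.splits)

lemma left_step_ph: "left_step j S co r = (S', co', r') \<Longrightarrow> ph S' = ph S"
  by (auto simp: left_step_def split: option.splits if_splits)

lemma halted_state_ph: "halted_state S \<Longrightarrow> ph S = ACC \<or> ph S = REJ"
  by (auto simp: halted_state_def ACCs_def REJs_def S0_def)

lemma finish_job_ph: "ph (finish_job j S) \<noteq> ACC \<and> ph (finish_job j S) \<noteq> REJ"
  by (cases j) (simp_all add: finish_job_def start_job_def)

context composite begin

definition silent_run :: "nat list \<Rightarrow> (nat \<Rightarrow> bool) \<Rightarrow> acfg \<Rightarrow> nat \<Rightarrow> acfg \<Rightarrow> bool" where
  "silent_run w c A n B \<longleftrightarrow> (astep w c ^^ n) A = B \<and>
     (\<forall>s\<le>n. AC ((astep w c ^^ s) A) = AC A \<and> \<not> halted_state (AS ((astep w c ^^ s) A)))"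

lemma silent_run_trans:
  assumes "silent_run w c A n B" "silent_run w c B m D"
  shows "silent_run w c A (n + m) D"
proof -
  have B: "(astep w c ^^ n) A = B" and acB: "AC B = AC A" using assms(1) unfolding silent_run_def by auto
  have "AC ((astep w c ^^ s) A) = AC A \<and> \<not> halted_state (AS ((astep w c ^^ s) A))" if "s \<le> n + m" for s
  proof (cases "s \<le> n")
    case True then show ?thesis using assms(1) unfolding silent_run_def by auto
  next
    case False
    then have "(astep w c ^^ s) A = (astep w c ^^ (s - n)) B"
      using B by (metis funpow_add le_add_diff_inverse2 nat_le_linear comp_apply)
    then show ?thesis using assms(2) that False acB unfolding silent_run_def by auto
  qed
  moreover have "(astep w c ^^ (n + m)) A = D" using assms unfolding silent_run_def
    by (simp add: funpow_add add.commute)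
  ultimately show ?thesis unfolding silent_run_def by auto
qed

lemma silent_run_one:
  assumes "\<not> halted_state (AS A)" "astep w c A = B" "\<not> halted_state (AS B)" "AC B = AC A"
  shows "silent_run w c A 1 B"
proof -
  have "AC ((astep w c ^^ s) A) = AC A \<and> \<not> halted_state (AS ((astep w c ^^ s) A))" if "s \<le> 1" for s
  proof -
    have "s = 0 \<or> s = 1" using that by auto
    then show ?thesis using assms by auto
  qed
  then show ?thesis using assms unfolding silent_run_def by auto
qed

lemma not_ahalted_SR: "ph S = SR j \<Longrightarrow> \<not> halted_state S" and not_ahalted_SL: "ph S = SL j \<Longrightarrow> \<not> halted_state S"
  using halted_state_ph by fastforce+

lemma right_pass:
  assumes "ph (AS A) = SR j" "AH A = p" "AG A = p" "p \<le> m" "\<sigma> p = AS A"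
    "\<And>i. p \<le> i \<Longrightarrow> i < m \<Longrightarrow> right_step j (\<sigma> i) (AT A i) (AR A i) = (\<sigma> (Suc i), T' i, R' i, True)"
    "right_step j (\<sigma> m) (AT A m) (AR A m) = (Sm, T' m, R' m, False)"
  shows "silent_run w c A (Suc (m - p)) (A\<lparr>AS := Sm\<lparr>ph := SL j, pnd := False, dn := False\<rparr>,
            AT := (\<lambda>i. if p \<le> i \<and> i \<le> m then T' i else AT A i),
            AH := m - 1, AR := (\<lambda>i. if p \<le> i \<and> i \<le> m then R' i else AR A i), AG := m - 1\<rparr>)"
  using assms
proof (induction "m - p" arbitrary: p A)
  case 0
  then have pm: "p = m" by simp
  have ph: "ph Sm = SR j" using right_step_ph[OF 0(8)] 0 pm by simp
  have "astep w c A = A\<lparr>AS := Sm\<lparr>ph := SL j, pnd := False, dn := False\<rparr>, AT := (AT A)(p := T' m),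
           AH := m - 1, AR := (AR A)(p := R' m), AG := m - 1\<rparr>"
    using 0 pm not_ahalted_SR[OF 0(2)] by (simp add: astep_def adelta_def)
  moreover have "(\<lambda>i. if p \<le> i \<and> i \<le> m then T' i else AT A i) = (AT A)(p := T' m)"
    "(\<lambda>i. if p \<le> i \<and> i \<le> m then R' i else AR A i) = (AR A)(p := R' m)"
    using pm by auto
  ultimately show ?case using pm silent_run_one[of A w c] not_ahalted_SR[OF 0(2)] not_ahalted_SL[of _ j]
    by simp
next
  case (Suc d)
  let ?A1 = "A\<lparr>AS := \<sigma> (Suc p), AT := (AT A)(p := T' p), AH := Suc p, AR := (AR A)(p := R' p), AG := Suc p\<rparr>"
  have pm: "p < m" using Suc.hyps(2) by simp
  have st0: "right_step j (\<sigma> p) (AT A p) (AR A p) = (\<sigma> (Suc p), T' p, R' p, True)"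
    using Suc.prems(6)[of p] pm by simp
  then have st1: "right_step j (AS A) (AT A p) (AR A p) = (\<sigma> (Suc p), T' p, R' p, True)"
    using Suc.prems(5) by simp
  have ph1: "ph (\<sigma> (Suc p)) = SR j" using right_step_ph[OF st1] Suc.prems(1) by simp
  have a1: "astep w c A = ?A1"
    using Suc.prems(1-3) st1 not_ahalted_SR[OF Suc.prems(1)] by (simp add: astep_def adelta_def)
  have r1: "silent_run w c A 1 ?A1" using silent_run_one[OF not_ahalted_SR[OF Suc.prems(1)] a1] not_ahalted_SR[OF ph1] by simp
  have ih: "silent_run w c ?A1 (Suc (m - Suc p)) (?A1\<lparr>AS := Sm\<lparr>ph := SL j, pnd := False, dn := False\<rparr>,
            AT := (\<lambda>i. if Suc p \<le> i \<and> i \<le> m then T' i else AT ?A1 i),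
            AH := m - 1, AR := (\<lambda>i. if Suc p \<le> i \<and> i \<le> m then R' i else AR ?A1 i), AG := m - 1\<rparr>)"
    by (rule Suc.hyps(1)) (use Suc.hyps(2) Suc.prems pm ph1 in auto)
  have eq: "?A1\<lparr>AS := Sm\<lparr>ph := SL j, pnd := False, dn := False\<rparr>,
            AT := (\<lambda>i. if Suc p \<le> i \<and> i \<le> m then T' i else AT ?A1 i),
            AH := m - 1, AR := (\<lambda>i. if Suc p \<le> i \<and> i \<le> m then R' i else AR ?A1 i), AG := m - 1\<rparr>
     = A\<lparr>AS := Sm\<lparr>ph := SL j, pnd := False, dn := False\<rparr>,
            AT := (\<lambda>i. if p \<le> i \<and> i \<le> m then T' i else AT A i),
            AH := m - 1, AR := (\<lambda>i. if p \<le> i \<and> i \<le> m then R' i else AR A i), AG := m - 1\<rparr>"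
    using pm by (auto simp: fun_eq_iff)
  have "Suc (m - p) = 1 + Suc (m - Suc p)" using pm by simp
  then show ?case using silent_run_trans[OF r1 ih] eq by simp
qed

lemma left_pass:
  assumes "ph (AS A) = SL j" "AH A = p" "AG A = p" "\<tau> p = AS A"
    "\<And>i. 0 < i \<Longrightarrow> i \<le> p \<Longrightarrow> left_step j (\<tau> i) (AT A i) (AR A i) = (\<tau> (i - 1), T' i, R' i) \<and> \<not> is_origin (AT A i)"
    "left_step j (\<tau> 0) (AT A 0) (AR A 0) = (Sf, T' 0, R' 0)" "is_origin (AT A 0)"
  shows "silent_run w c A (Suc p) (A\<lparr>AS := finish_job j Sf,
            AT := (\<lambda>i. if i \<le> p then T' i else AT A i),
            AH := 0, AR := (\<lambda>i. if i \<le> p then R' i else AR A i), AG := 0\<rparr>)"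
  using assms
proof (induction p arbitrary: A)
  case 0
  have "astep w c A = A\<lparr>AS := finish_job j Sf, AT := (AT A)(0 := T' 0), AH := 0, AR := (AR A)(0 := R' 0), AG := 0\<rparr>"
    using 0 not_ahalted_SL[OF 0(1)] by (simp add: astep_def adelta_def)
  moreover have "(\<lambda>i. if i \<le> 0 then T' i else AT A i) = (AT A)(0 := T' 0)"
    "(\<lambda>i. if i \<le> (0::nat) then R' i else AR A i) = (AR A)(0 := R' 0)" by auto
  moreover have "\<not> halted_state (finish_job j Sf)" using finish_job_ph halted_state_ph by blast
  ultimately show ?case using silent_run_one[of A w c] not_ahalted_SL[OF 0(1)] by simp
next
  case (Suc p)
  let ?A1 = "A\<lparr>AS := \<tau> p, AT := (AT A)(Suc p := T' (Suc p)), AH := p, AR := (AR A)(Suc p := R' (Suc p)), AG := p\<rparr>"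
  have st1: "left_step j (\<tau> (Suc p)) (AT A (Suc p)) (AR A (Suc p)) = (\<tau> p, T' (Suc p), R' (Suc p))"
    and no: "\<not> is_origin (AT A (Suc p))" using Suc.prems(5)[of "Suc p"] by auto
  have st2: "left_step j (AS A) (AT A (Suc p)) (AR A (Suc p)) = (\<tau> p, T' (Suc p), R' (Suc p))"
    using st1 Suc.prems(4) by simp
  have ph1: "ph (\<tau> p) = SL j" using left_step_ph[OF st2] Suc.prems(1) by simp
  have a1: "astep w c A = ?A1"
    using Suc.prems(1-3) st2 no not_ahalted_SL[OF Suc.prems(1)] by (simp add: astep_def adelta_def)
  have r1: "silent_run w c A 1 ?A1" using silent_run_one[OF not_ahalted_SL[OF Suc.prems(1)] a1] not_ahalted_SL[OF ph1] by simp
  have ih: "silent_run w c ?A1 (Suc p) (?A1\<lparr>AS := finish_job j Sf,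
            AT := (\<lambda>i. if i \<le> p then T' i else AT ?A1 i),
            AH := 0, AR := (\<lambda>i. if i \<le> p then R' i else AR ?A1 i), AG := 0\<rparr>)"
    by (rule Suc.IH) (use Suc.prems ph1 in auto)
  have eq: "?A1\<lparr>AS := finish_job j Sf,
            AT := (\<lambda>i. if i \<le> p then T' i else AT ?A1 i),
            AH := 0, AR := (\<lambda>i. if i \<le> p then R' i else AR ?A1 i), AG := 0\<rparr>
     = A\<lparr>AS := finish_job j Sf,
            AT := (\<lambda>i. if i \<le> Suc p then T' i else AT A i),
            AH := 0, AR := (\<lambda>i. if i \<le> Suc p then R' i else AR A i), AG := 0\<rparr>"
    by (auto simp: fun_eq_iff le_Suc_eq)
  have "Suc (Suc p) = 1 + Suc p" by simp
  then show ?case using silent_run_trans[OF r1 ih] eq by simp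
qed

end

fun track_value :: "job \<Rightarrow> cell \<Rightarrow> nat \<Rightarrow> nat" where
  "track_value AW1 c r = w1 c" | "track_value AX1 c r = x1 c" | "track_value AW2 c r = w2 c" | "track_value AX2 c r = r" | "track_value _ c r = 0"

definition track :: "job \<Rightarrow> (nat \<Rightarrow> cell option) \<Rightarrow> (nat \<Rightarrow> nat) \<Rightarrow> nat \<Rightarrow> (nat \<Rightarrow> nat) \<Rightarrow> nat \<Rightarrow> bool" where
  "track j T Rx E vals h \<longleftrightarrow> (\<forall>i<E. track_value j (the (T i)) (Rx i) = vals i \<and> (head_mark j (the (T i)) \<longleftrightarrow> i = h))
     \<and> h < E \<and> (\<forall>i\<ge>E. vals i = 0)"

definition shape :: "(nat \<Rightarrow> cell option) \<Rightarrow> (nat \<Rightarrow> nat) \<Rightarrow> nat \<Rightarrow> bool" where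
  "shape T Rx E \<longleftrightarrow> (\<forall>i. (T i \<noteq> None) = (i < E)) \<and> (\<forall>i. is_origin (T i) = (i = 0)) \<and> 0 < E \<and> (\<forall>i\<ge>E. Rx i = 0)"

definition counter :: "(nat \<Rightarrow> cell option) \<Rightarrow> nat \<Rightarrow> nat \<Rightarrow> bool" where
  "counter T E n \<longleftrightarrow> (\<forall>i<E. bt (the (T i)) = bit n i) \<and> n < 2 ^ E"

definition is_gather_job :: "job \<Rightarrow> bool" where "is_gather_job g \<longleftrightarrow> g \<in> {GW1, GX1, GW2, GX2}"

fun gathered_track :: "job \<Rightarrow> job" where
  "gathered_track GW1 = AW1" | "gathered_track GX1 = AX1" | "gathered_track GW2 = AW2" | "gathered_track GX2 = AX2" | "gathered_track j = j"

fun gather_update :: "job \<Rightarrow> ast \<Rightarrow> nat \<Rightarrow> ast" where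
  "gather_update GW1 S v = S\<lparr>s1 := v\<rparr>" | "gather_update GX1 S v = S\<lparr>i1 := v\<rparr>" | "gather_update GW2 S v = S\<lparr>s2 := v\<rparr>"
| "gather_update GX2 S v = S\<lparr>i2 := v\<rparr>" | "gather_update _ S v = S"

lemma right_step_gather: "is_gather_job g \<Longrightarrow> right_step g S (Some c) r = (if head_mark (gathered_track g) c then gather_update g S (track_value (gathered_track g) c r) else S, Some c, r, True)"
  by (auto simp: is_gather_job_def right_step_def)

lemma gather_update_fields[simp]: "ph (gather_update g S v) = ph S" "pnd (gather_update g S v) = pnd S"
  by (cases g; simp)+

lemma gather_update_upd[simp]: "(gather_update g S v)\<lparr>ph := p, pnd := a, dn := b\<rparr> = gather_update g (S\<lparr>ph := p, pnd := a, dn := b\<rparr>) v"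
  by (cases g; simp)

lemma left_step_id: "\<not> (is_apply_job j \<and> job_move j S = L) \<Longrightarrow> left_step j S co r = (S, co, r)"
  by (auto simp: left_step_def split: option.splits)

lemma right_step_None: "\<not> pnd S \<Longrightarrow> j \<noteq> INC \<Longrightarrow> right_step j S None r = (S, None, r, False)"
  by (simp add: right_step_def)

context composite begin

lemma sweep_idle_left:
  assumes "ph (AS A) = SR j" "AH A = 0" "AG A = 0" "0 < m" "\<sigma> 0 = AS A"
    "\<And>i. i < m \<Longrightarrow> right_step j (\<sigma> i) (AT A i) (AR A i) = (\<sigma> (Suc i), T' i, R' i, True)"
    "right_step j (\<sigma> m) (AT A m) (AR A m) = (Sm, T' m, R' m, False)"
    "\<not> (is_apply_job j \<and> job_move j Sm = L)"
    "is_origin (T' 0)" "\<And>i. 0 < i \<Longrightarrow> i < m \<Longrightarrow> \<not> is_origin (T' i)"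
  shows "silent_run w c A (Suc m + m) (A\<lparr>AS := finish_job j (Sm\<lparr>ph := SL j, pnd := False, dn := False\<rparr>),
            AT := (\<lambda>i. if i \<le> m then T' i else AT A i),
            AH := 0, AR := (\<lambda>i. if i \<le> m then R' i else AR A i), AG := 0\<rparr>)"
proof -
  let ?S1 = "Sm\<lparr>ph := SL j, pnd := False, dn := False\<rparr>"
  let ?A1 = "A\<lparr>AS := ?S1, AT := (\<lambda>i. if 0 \<le> i \<and> i \<le> m then T' i else AT A i),
            AH := m - 1, AR := (\<lambda>i. if 0 \<le> i \<and> i \<le> m then R' i else AR A i), AG := m - 1\<rparr>"
  have r1: "silent_run w c A (Suc (m - 0)) ?A1"
    by (rule right_pass[where \<sigma>=\<sigma>]) (use assms in auto)
  have li: "left_step j ?S1 co r = (?S1, co, r)" for co r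
    by (rule left_step_id) (use assms(8) in \<open>cases j; simp\<close>)
  have r2: "silent_run w c ?A1 (Suc (m - 1)) (?A1\<lparr>AS := finish_job j ?S1,
            AT := (\<lambda>i. if i \<le> m - 1 then AT ?A1 i else AT ?A1 i),
            AH := 0, AR := (\<lambda>i. if i \<le> m - 1 then AR ?A1 i else AR ?A1 i), AG := 0\<rparr>)"
    by (rule left_pass[where \<tau>="\<lambda>_. ?S1"]) (use assms li in auto)
  have "Suc m + m = Suc (m - 0) + Suc (m - 1)" using assms(4) by simp
  then show ?thesis using silent_run_trans[OF r1 r2] assms(2,3) by (simp add: fun_eq_iff)
qed

lemma gather_sweep:
  assumes "ph (AS A) = SR g" "is_gather_job g" "AH A = 0" "AG A = 0" "\<not> pnd (AS A)"
    "shape (AT A) (AR A) E" "track (gathered_track g) (AT A) (AR A) E vals h"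
  shows "silent_run w c A (Suc E + E) (A\<lparr>AS := finish_job g (gather_update g ((AS A)\<lparr>ph := SL g, pnd := False, dn := False\<rparr>) (vals h))\<rparr>)"
proof -
  let ?S = "AS A"
  define \<sigma> where "\<sigma> i = (if h < i then gather_update g ?S (vals h) else ?S)" for i
  have E: "0 < E" "\<forall>i. (AT A i \<noteq> None) = (i < E)" "\<forall>i. is_origin (AT A i) = (i = 0)"
    using assms(6) by (auto simp: shape_def)
  have tr: "\<forall>i<E. track_value (gathered_track g) (the (AT A i)) (AR A i) = vals i \<and> (head_mark (gathered_track g) (the (AT A i)) \<longleftrightarrow> i = h)" "h < E"
    using assms(7) by (auto simp: track_def)
  have st: "right_step g (\<sigma> i) (AT A i) (AR A i) = (\<sigma> (Suc i), AT A i, AR A i, True)" if "i < E" for i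
  proof -
    have "AT A i \<noteq> None" using E(2) that by simp
    then obtain cl where cl: "AT A i = Some cl" by auto
    show ?thesis using tr that cl by (auto simp: right_step_gather[OF assms(2)] \<sigma>_def)
  qed
  have ng: "g \<noteq> INC" using assms(2) by (auto simp: is_gather_job_def)
  have pn: "\<not> pnd (\<sigma> E)" using assms(5) by (simp add: \<sigma>_def)
  have stE: "right_step g (\<sigma> E) (AT A E) (AR A E) = (\<sigma> E, AT A E, AR A E, False)"
    using E(2) right_step_None[OF pn ng] by auto
  have "silent_run w c A (Suc E + E) (A\<lparr>AS := finish_job g ((\<sigma> E)\<lparr>ph := SL g, pnd := False, dn := False\<rparr>),
            AT := (\<lambda>i. if i \<le> E then AT A i else AT A i),
            AH := 0, AR := (\<lambda>i. if i \<le> E then AR A i else AR A i), AG := 0\<rparr>)"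
    by (rule sweep_idle_left[where \<sigma>=\<sigma>]) (use assms E st stE in \<open>auto simp: \<sigma>_def is_apply_job_def is_gather_job_def\<close>)
  moreover have "A\<lparr>AS := X, AT := AT A, AH := 0, AR := AR A, AG := 0\<rparr> = A\<lparr>AS := X\<rparr>" for X
    using assms(3,4) by (cases A) simp
  ultimately show ?thesis using tr(2) by (simp add: \<sigma>_def)
qed

end

section \<open>Binary counters\<close>

lemma bit_sum_pow: "finite A \<Longrightarrow> bit (\<Sum>i\<in>A. (2::nat) ^ i) l \<longleftrightarrow> l \<in> A"
proof (induction A arbitrary: l rule: finite_induct)
  case empty then show ?case by simp
next
  case (insert a A)
  have "bit ((2::nat) ^ a + (\<Sum>i\<in>A. 2 ^ i)) l \<longleftrightarrow> bit ((2::nat) ^ a) l \<or> bit (\<Sum>i\<in>A. (2::nat) ^ i) l"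
    by (rule bit_disjunctive_add_iff) (use insert.IH insert.hyps in \<open>auto simp: bit_exp_iff\<close>)
  then show ?case using insert by (auto simp: bit_exp_iff)
qed

lemma bit_idxval: "finite {i. t i = 2} \<Longrightarrow> bit (idxval t) l \<longleftrightarrow> t l = 2"
  unfolding idxval_def using bit_sum_pow by auto

lemma bit_lt_pow: "(n::nat) < 2 ^ E \<Longrightarrow> E \<le> l \<Longrightarrow> \<not> bit n l"
proof -
  assume a: "n < 2 ^ E" "E \<le> l"
  have "(2::nat) ^ E \<le> 2 ^ l" using a(2) by (simp add: power_increasing)
  then have "n < 2 ^ l" using a(1) by linarith
  then have "n div 2 ^ l = 0" by simp
  then show ?thesis by (simp add: bit_iff_odd)
qed

lemma eq_by_bits: "(n::nat) < 2 ^ E \<Longrightarrow> p < 2 ^ E \<Longrightarrow> (\<forall>l<E. bit n l \<longleftrightarrow> bit p l) \<Longrightarrow> n = p"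
  by (rule bit_eqI) (metis bit_lt_pow not_less)

lemma bit_inc: "bit (Suc n) j \<longleftrightarrow> (bit n j \<noteq> (\<forall>i<j. bit n i))"
proof (induction j arbitrary: n)
  case 0 then show ?case by (simp add: bit_0)
next
  case (Suc j)
  show ?case
  proof (cases "even n")
    case True
    then have "Suc n div 2 = n div 2" by presburger
    moreover have "\<not> (\<forall>i<Suc j. bit n i)" using True by (auto simp: bit_0)
    ultimately show ?thesis by (simp add: bit_Suc)
  next
    case False
    then have "Suc n div 2 = Suc (n div 2)" by presburger
    moreover have "(\<forall>i<Suc j. bit n i) \<longleftrightarrow> (\<forall>i<j. bit (n div 2) i)"
      using False by (auto simp: bit_0 bit_Suc less_Suc_eq_0_disj)
    ultimately show ?thesis using Suc[of "n div 2"] by (simp add: bit_Suc)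
  qed
qed

lemma all_bits_pow: assumes "(n::nat) < 2 ^ E" "\<forall>l<E. bit n l" shows "Suc n = 2 ^ E"
proof -
  have "n = mask E"
  proof (rule bit_eqI)
    fix l show "bit n l \<longleftrightarrow> bit (mask E :: nat) l"
      using assms(2) bit_lt_pow[OF assms(1), of l] by (cases "l < E") (auto simp: bit_mask_iff)
  qed
  then show ?thesis by (simp add: mask_eq_exp_minus_1)
qed

lemma not_all_bits: assumes "(n::nat) < 2 ^ E" "\<not> (\<forall>l<E. bit n l)" shows "Suc n < 2 ^ E"
proof (rule ccontr)
  assume "\<not> Suc n < 2 ^ E"
  then have "Suc n = 2 ^ E" using assms(1) by simp
  then have "n = mask E" by (simp add: mask_eq_exp_minus_1)
  then show False using assms(2) by (simp add: bit_mask_iff)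
qed

section \<open>Effect of the jobs\<close>

lemma shape_Some: "shape T Rx E \<Longrightarrow> i < E \<Longrightarrow> T i = Some (the (T i))"
  by (auto simp: shape_def)
lemma shape_dom: "shape T Rx E \<Longrightarrow> (T i \<noteq> None) = (i < E)"
  by (simp add: shape_def)
lemma shape_None: "shape T Rx E \<Longrightarrow> E \<le> i \<Longrightarrow> T i = None"
  using shape_dom[of T Rx E i] by auto
lemma shape_org: "shape T Rx E \<Longrightarrow> i < E \<Longrightarrow> org (the (T i)) = (i = 0)"
  by (auto simp: shape_def is_origin_def dest!: spec[of _ i] split: option.splits)
lemma shape_R: "shape T Rx E \<Longrightarrow> E \<le> i \<Longrightarrow> Rx i = 0"
  by (auto simp: shape_def)
lemma shape_pos: "shape T Rx E \<Longrightarrow> 0 < E" by (auto simp: shape_def)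

lemma shapeI:
  assumes "\<And>i. i < E \<Longrightarrow> \<exists>c. T i = Some c \<and> org c = (i = 0)" "\<And>i. E \<le> i \<Longrightarrow> T i = None \<and> Rx i = 0" "0 < E"
  shows "shape T Rx E"
  unfolding shape_def is_origin_def
proof (intro conjI allI)
  fix i show "(T i \<noteq> None) = (i < E)" using assms by (cases "i < E") force+
next
  fix i show "(case T i of None \<Rightarrow> False | Some c \<Rightarrow> org c) = (i = 0)"
    using assms by (cases "i < E") force+
next
  show "0 < E" by fact
next
  fix i show "E \<le> i \<longrightarrow> Rx i = 0" using assms by auto
qed

definition keeps_track :: "job \<Rightarrow> cell \<Rightarrow> cell \<Rightarrow> nat \<Rightarrow> nat \<Rightarrow> bool" where
  "keeps_track j c c' r r' \<longleftrightarrow> track_value j c' r' = track_value j c r \<and> head_mark j c' = head_mark j c"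

lemma track_mono:
  assumes "track j T Rx E vals h" "E \<le> E'"
    "\<And>i. i < E \<Longrightarrow> keeps_track j (the (T i)) (the (T2 i)) (Rx i) (R2 i)"
    "\<And>i. E \<le> i \<Longrightarrow> i < E' \<Longrightarrow> track_value j (the (T2 i)) (R2 i) = 0 \<and> \<not> head_mark j (the (T2 i))"
  shows "track j T2 R2 E' vals h"
proof -
  have a: "track_value j (the (T2 i)) (R2 i) = vals i \<and> head_mark j (the (T2 i)) = (i = h)" if i: "i < E'" for i
  proof (cases "i < E")
    case True then show ?thesis using assms(1) assms(3)[of i] by (auto simp: track_def keeps_track_def)
  next
    case False then show ?thesis using assms(1) assms(4)[of i] i by (auto simp: track_def)
  qed
  have b: "h < E'" using assms(1,2) by (auto simp: track_def)
  have c: "vals i = 0" if "E' \<le> i" for i using assms(1,2) that by (auto simp: track_def)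
  show ?thesis unfolding track_def using a b c by blast
qed

lemma counter_mono:
  assumes "counter T E n" "E \<le> E'" "\<And>i. i < E \<Longrightarrow> bt (the (T2 i)) = bt (the (T i))"
    "\<And>i. E \<le> i \<Longrightarrow> i < E' \<Longrightarrow> \<not> bt (the (T2 i))"
  shows "counter T2 E' n"
  unfolding counter_def
proof (intro conjI allI impI)
  fix i assume i: "i < E'"
  show "bt (the (T2 i)) = bit n i"
  proof (cases "i < E")
    case True then show ?thesis using assms(1) assms(3)[of i] by (auto simp: counter_def)
  next
    case False then show ?thesis using assms(1) assms(4)[of i] i bit_lt_pow[of n E i] by (auto simp: counter_def)
  qed
next
  have "(2::nat) ^ E \<le> 2 ^ E'" using assms(2) by (simp add: power_increasing)
  then show "n < 2 ^ E'" using assms(1) unfolding counter_def by linarith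
qed

definition reset_cell :: "cell \<Rightarrow> cell" where "reset_cell c = c\<lparr>w2 := 0, m2 := org c, n2 := org c, bt := False\<rparr>"

context composite begin

lemma rst_sweep:
  assumes "ph (AS A) = SR RST" "AH A = 0" "AG A = 0" "\<not> pnd (AS A)" "shape (AT A) (AR A) E"
  shows "\<exists>n B. silent_run w c A n B \<and> AS B = finish_job RST ((AS A)\<lparr>ph := SL RST, pnd := False, dn := False\<rparr>)
     \<and> AH B = 0 \<and> AG B = 0 \<and> AR B = (\<lambda>_. 0)
     \<and> (\<forall>i. AT B i = (if i < E then Some (reset_cell (the (AT A i))) else None))"
proof -
  let ?S = "AS A"
  define T' where "T' i = (if i < E then Some (reset_cell (the (AT A i))) else None)" for i
  define R' where "R' i = (0::nat)" for i :: nat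
  have E0: "0 < E" using shape_pos[OF assms(5)] .
  have st: "right_step RST ((\<lambda>_. ?S) i) (AT A i) (AR A i) = ((\<lambda>_. ?S) (Suc i), T' i, R' i, True)" if i: "i < E" for i
  proof -
    obtain cl where cl: "AT A i = Some cl" using shape_Some[OF assms(5) i] by blast
    show ?thesis using cl i by (simp add: right_step_def T'_def R'_def reset_cell_def)
  qed
  have stE: "right_step RST ?S (AT A E) (AR A E) = (?S, T' E, R' E, False)"
    using shape_None[OF assms(5), of E] shape_R[OF assms(5), of E] right_step_None[OF assms(4), of RST]
    by (simp add: T'_def R'_def)
  have org0: "is_origin (T' 0)" using shape_org[OF assms(5) E0] E0 by (simp add: T'_def is_origin_def reset_cell_def)
  have orgi: "\<not> is_origin (T' i)" if "0 < i" "i < E" for i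
    using shape_org[OF assms(5) that(2)] that by (simp add: T'_def is_origin_def reset_cell_def)
  have r: "silent_run w c A (Suc E + E) (A\<lparr>AS := finish_job RST (?S\<lparr>ph := SL RST, pnd := False, dn := False\<rparr>),
            AT := (\<lambda>i. if i \<le> E then T' i else AT A i),
            AH := 0, AR := (\<lambda>i. if i \<le> E then R' i else AR A i), AG := 0\<rparr>)"
    by (rule sweep_idle_left[where \<sigma>="\<lambda>_. ?S"]) (use assms E0 st stE org0 orgi in \<open>auto simp: is_apply_job_def\<close>)
  have "(\<lambda>i. if i \<le> E then T' i else AT A i) = T'"
    using shape_None[OF assms(5)] by (auto simp: T'_def fun_eq_iff)
  moreover have "(\<lambda>i. if i \<le> E then R' i else AR A i) = (\<lambda>_. 0)"
    using shape_R[OF assms(5)] by (auto simp: R'_def fun_eq_iff)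
  ultimately have "silent_run w c A (Suc E + E) (A\<lparr>AS := finish_job RST (?S\<lparr>ph := SL RST, pnd := False, dn := False\<rparr>),
            AT := T', AH := 0, AR := (\<lambda>_. 0), AG := 0\<rparr>)" using r by simp
  then show ?thesis unfolding T'_def by (intro exI) auto
qed

lemma cmp_sweep:
  assumes "ph (AS A) = SR CMP" "AH A = 0" "AG A = 0" "\<not> pnd (AS A)" "shape (AT A) (AR A) E"
  shows "\<exists>n B. silent_run w c A n B \<and> AS B = finish_job CMP ((AS A)\<lparr>eqf := (eqf (AS A) \<and> (\<forall>l<E. bt (the (AT A l)) = (x1 (the (AT A l)) = 2))),
         ph := SL CMP, pnd := False, dn := False\<rparr>)
     \<and> AH B = 0 \<and> AG B = 0 \<and> AR B = AR A \<and> AT B = AT A"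
proof -
  let ?S = "AS A"
  define \<sigma> where "\<sigma> i = ?S\<lparr>eqf := (eqf ?S \<and> (\<forall>l<i. bt (the (AT A l)) = (x1 (the (AT A l)) = 2)))\<rparr>" for i
  have E0: "0 < E" using shape_pos[OF assms(5)] .
  have st: "right_step CMP (\<sigma> i) (AT A i) (AR A i) = (\<sigma> (Suc i), AT A i, AR A i, True)" if i: "i < E" for i
  proof -
    obtain cl where cl: "AT A i = Some cl" using shape_Some[OF assms(5) i] by blast
    show ?thesis using cl i by (auto simp: right_step_def \<sigma>_def All_less_Suc conj_ac)
  qed
  have stE: "right_step CMP (\<sigma> E) (AT A E) (AR A E) = (\<sigma> E, AT A E, AR A E, False)"
    using shape_None[OF assms(5), of E] right_step_None[of "\<sigma> E" CMP] assms(4) by (simp add: \<sigma>_def)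
  have r: "silent_run w c A (Suc E + E) (A\<lparr>AS := finish_job CMP ((\<sigma> E)\<lparr>ph := SL CMP, pnd := False, dn := False\<rparr>),
            AT := (\<lambda>i. if i \<le> E then AT A i else AT A i),
            AH := 0, AR := (\<lambda>i. if i \<le> E then AR A i else AR A i), AG := 0\<rparr>)"
  proof (rule sweep_idle_left[where \<sigma>=\<sigma>])
    show "is_origin (AT A 0)" using assms(5) E0 by (auto simp: shape_def)
    show "\<not> is_origin (AT A i)" if "0 < i" "i < E" for i using assms(5) that by (auto simp: shape_def)
  qed (use assms E0 st stE in \<open>auto simp: is_apply_job_def \<sigma>_def\<close>)
  then show ?thesis unfolding \<sigma>_def by (intro exI) auto
qed

end

lemma right_step_INC_None: "\<not> pnd S \<Longrightarrow> \<not> cry S \<Longrightarrow> right_step INC S None r = (S, None, r, False)"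
  by (simp add: right_step_def)

lemma keeps_track_bt: "is_apply_job j \<Longrightarrow> keeps_track j c (c\<lparr>bt := b\<rparr>) r r"
  by (cases j) (auto simp: keeps_track_def is_apply_job_def)

lemma blank_cell_views: "track_value j blank_cell 0 = 0" "\<not> head_mark j blank_cell" "track_value j (blank_cell\<lparr>bt := b\<rparr>) 0 = 0" "\<not> head_mark j (blank_cell\<lparr>bt := b\<rparr>)"
  by (cases j; simp add: blank_cell_def)+

context composite begin

lemma inc_sweep:
  assumes "ph (AS A) = SR INC" "AH A = 0" "AG A = 0" "\<not> pnd (AS A)" "cry (AS A)"
    "shape (AT A) (AR A) E" "counter (AT A) E n" "Suc n < 2 ^ Bnd" "E \<le> Bnd"
  shows "\<exists>k B E'. silent_run w c A k B \<and> (\<exists>S'. AS B = finish_job INC S' \<and> q1 S' = q1 (AS A) \<and> q2 S' = q2 (AS A)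
     \<and> s1 S' = s1 (AS A) \<and> i1 S' = i1 (AS A)) \<and> AH B = 0 \<and> AG B = 0 \<and> AR B = AR A
     \<and> E \<le> E' \<and> E' \<le> Bnd \<and> shape (AT B) (AR B) E' \<and> counter (AT B) E' (Suc n)
     \<and> (\<forall>j vals h. is_apply_job j \<longrightarrow> track j (AT A) (AR A) E vals h \<longrightarrow> track j (AT B) (AR B) E' vals h)"
proof -
  let ?S = "AS A"
  let ?T = "AT A" let ?R = "AR A"
  define \<sigma>0 where "\<sigma>0 i = ?S\<lparr>cry := (\<forall>l<i. bit n l)\<rparr>" for i
  have E0: "0 < E" using shape_pos[OF assms(6)] .
  have bits: "\<forall>i<E. bt (the (?T i)) = bit n i" "n < 2 ^ E" using assms(7) by (auto simp: counter_def)
  define Tn where "Tn i = Some ((the (?T i))\<lparr>bt := bit (Suc n) i\<rparr>)" for i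
  have st: "right_step INC (\<sigma>0 i) (?T i) (?R i) = (\<sigma>0 (Suc i), Tn i, ?R i, True)" if i: "i < E" for i
  proof -
    obtain cl where cl: "?T i = Some cl" using shape_Some[OF assms(6) i] by blast
    have "bt cl = bit n i" using bits i cl by auto
    then show ?thesis using cl i assms(5) by (auto simp: right_step_def \<sigma>0_def Tn_def All_less_Suc bit_inc)
  qed
  have org0: "is_origin (Tn 0)" using shape_org[OF assms(6) E0] by (simp add: Tn_def is_origin_def)
  have orgi: "\<not> is_origin (Tn i)" if "0 < i" "i < E" for i using shape_org[OF assms(6) that(2)] that by (simp add: Tn_def is_origin_def)
  have keepT: "keeps_track j (the (?T i)) (the (Tn i)) (?R i) (?R i)" if "is_apply_job j" for j i
    using keeps_track_bt[OF that] by (simp add: Tn_def)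
  show ?thesis
  proof (cases "\<forall>l<E. bit n l")
    case False
    have stE: "right_step INC (\<sigma>0 E) (?T E) (?R E) = (\<sigma>0 E, ?T E, ?R E, False)"
    proof -
      have "(\<forall>l<E. bit n l) = False" using False by simp
      then show ?thesis using shape_None[OF assms(6), of E] right_step_INC_None[of "\<sigma>0 E"] assms(4) by (simp add: \<sigma>0_def)
    qed
    have r: "silent_run w c A (Suc E + E) (A\<lparr>AS := finish_job INC ((\<sigma>0 E)\<lparr>ph := SL INC, pnd := False, dn := False\<rparr>),
            AT := (\<lambda>i. if i \<le> E then (Tn(E := ?T E)) i else ?T i),
            AH := 0, AR := (\<lambda>i. if i \<le> E then ?R i else ?R i), AG := 0\<rparr>)"
      by (rule sweep_idle_left[where \<sigma>=\<sigma>0]) (use assms E0 st stE org0 orgi in \<open>auto simp: is_apply_job_def \<sigma>0_def\<close>)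
    let ?T2 = "\<lambda>i. if i \<le> E then (Tn(E := ?T E)) i else ?T i"
    have T2: "?T2 i = (if i < E then Tn i else None)" for i
      using shape_None[OF assms(6), of i] by auto
    have sh: "shape ?T2 ?R E"
      by (rule shapeI) (use T2 shape_org[OF assms(6)] shape_R[OF assms(6)] shape_None[OF assms(6)] E0 in \<open>auto simp: Tn_def\<close>)
    have ct: "counter ?T2 E (Suc n)" using T2 not_all_bits[OF bits(2) False] by (auto simp: counter_def Tn_def)
    have tr: "track j ?T2 ?R E vals h" if "is_apply_job j" "track j ?T ?R E vals h" for j vals h
      by (rule track_mono[OF that(2) order_refl]) (use keepT[OF that(1)] T2 in auto)
    show ?thesis
      apply (rule exI[where x="Suc E + E"])
      apply (rule exI[where x="A\<lparr>AS := finish_job INC ((\<sigma>0 E)\<lparr>ph := SL INC, pnd := False, dn := False\<rparr>),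
            AT := ?T2, AH := 0, AR := (\<lambda>i. if i \<le> E then ?R i else ?R i), AG := 0\<rparr>"])
      apply (rule exI[where x=E])
      using r sh ct tr assms(9) by (auto simp: \<sigma>0_def finish_job_def)
  next
    case True
    define \<sigma> where "\<sigma> i = (if i \<le> E then \<sigma>0 i else (\<sigma>0 E)\<lparr>cry := False\<rparr>)" for i
    define T' where "T' i = (if i < E then Tn i else if i = E then Some (blank_cell\<lparr>bt := True\<rparr>) else None)" for i
    have EB: "Suc E \<le> Bnd"
    proof -
      have "Suc n = 2 ^ E" using all_bits_pow[OF bits(2) True] .
      then have "(2::nat) ^ E < 2 ^ Bnd" using assms(8) by simp
      then show ?thesis by simp
    qed
    have st': "right_step INC (\<sigma> i) (?T i) (?R i) = (\<sigma> (Suc i), T' i, ?R i, True)" if i: "i < Suc E" for i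
    proof (cases "i < E")
      case True then show ?thesis using st[of i] by (simp add: \<sigma>_def T'_def)
    next
      case False
      then have iE: "i = E" using i by simp
      have "cry (\<sigma>0 E)" using True by (simp add: \<sigma>0_def)
      then show ?thesis using iE shape_None[OF assms(6), of E] assms(4)
        by (simp add: right_step_def \<sigma>_def T'_def \<sigma>0_def)
    qed
    have stE: "right_step INC (\<sigma> (Suc E)) (?T (Suc E)) (?R (Suc E)) = (\<sigma> (Suc E), T' (Suc E), ?R (Suc E), False)"
      using shape_None[OF assms(6), of "Suc E"] right_step_INC_None[of "\<sigma> (Suc E)"] assms(4)
      by (simp add: \<sigma>_def \<sigma>0_def T'_def)
    have r: "silent_run w c A (Suc (Suc E) + Suc E) (A\<lparr>AS := finish_job INC ((\<sigma> (Suc E))\<lparr>ph := SL INC, pnd := False, dn := False\<rparr>),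
            AT := (\<lambda>i. if i \<le> Suc E then T' i else ?T i),
            AH := 0, AR := (\<lambda>i. if i \<le> Suc E then ?R i else ?R i), AG := 0\<rparr>)"
    proof (rule sweep_idle_left[where \<sigma>=\<sigma>])
      show "is_origin (T' 0)" using org0 E0 by (simp add: T'_def)
      show "\<not> is_origin (T' i)" if "0 < i" "i < Suc E" for i
        using orgi[of i] that by (cases "i < E") (auto simp: T'_def is_origin_def blank_cell_def)
    qed (use assms st' stE in \<open>auto simp: is_apply_job_def \<sigma>_def \<sigma>0_def\<close>)
    let ?T2 = "\<lambda>i. if i \<le> Suc E then T' i else ?T i"
    have T2: "?T2 i = T' i" for i
      using shape_None[OF assms(6), of i] by (auto simp: T'_def)
    have sh: "shape ?T2 ?R (Suc E)"
      by (rule shapeI) (use T2 shape_org[OF assms(6)] shape_R[OF assms(6)] shape_None[OF assms(6)] E0 in \<open>auto simp: Tn_def T'_def blank_cell_def\<close>)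
    have ct: "counter ?T2 (Suc E) (Suc n)"
    proof -
      have "bt (the (T' i)) = bit (Suc n) i" if "i < Suc E" for i
      proof (cases "i < E")
        case True then show ?thesis by (simp add: T'_def Tn_def)
      next
        case False
        then have "i = E" using that by simp
        then show ?thesis using bit_inc[of n E] True bit_lt_pow[OF bits(2), of E] by (simp add: T'_def)
      qed
      moreover have "Suc n < 2 ^ Suc E" using all_bits_pow[OF bits(2) True] by simp
      ultimately show ?thesis using T2 by (simp add: counter_def)
    qed
    have tr: "track j ?T2 ?R (Suc E) vals h" if "is_apply_job j" "track j ?T ?R E vals h" for j vals h
    proof (rule track_mono[OF that(2)])
      show "keeps_track j (the (?T i)) (the (?T2 i)) (?R i) (?R i)" if "i < E" for i
        using keepT[OF \<open>is_apply_job j\<close>, of i] that T2 by (simp add: T'_def)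
      show "track_value j (the (?T2 i)) (?R i) = 0 \<and> \<not> head_mark j (the (?T2 i))" if "E \<le> i" "i < Suc E" for i
      proof -
        have "i = E" using that by simp
        then show ?thesis using shape_R[OF assms(6), of E] blank_cell_views[of j] T2 by (simp add: T'_def)
      qed
    qed simp
    show ?thesis
      apply (rule exI[where x="Suc (Suc E) + Suc E"])
      apply (rule exI[where x="A\<lparr>AS := finish_job INC ((\<sigma> (Suc E))\<lparr>ph := SL INC, pnd := False, dn := False\<rparr>),
            AT := ?T2, AH := 0, AR := (\<lambda>i. if i \<le> Suc E then ?R i else ?R i), AG := 0\<rparr>"])
      apply (rule exI[where x="Suc E"])
      using r sh ct tr EB by (auto simp: \<sigma>_def \<sigma>0_def finish_job_def)
  qed
qed

end

lemma right_step_ap: "is_apply_job j \<Longrightarrow> right_step j S (Some c) r =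
  (if pnd S then (S\<lparr>pnd := False, dn := True\<rparr>, Some (set_head_mark j True c), r, True)
   else if head_mark j c \<and> \<not> dn S then
     (if job_move j S = R then (S\<lparr>pnd := True, dn := True\<rparr>, Some (set_head_mark j False (fst (set_track_value j (job_value j S) c r))), snd (set_track_value j (job_value j S) c r), True)
      else (S\<lparr>dn := True\<rparr>, Some (fst (set_track_value j (job_value j S) c r)), snd (set_track_value j (job_value j S) c r), True))
   else (S, Some c, r, True))"
  by (auto simp: is_apply_job_def right_step_def split: prod.splits)

lemma left_step_apL: "is_apply_job j \<Longrightarrow> job_move j S = L \<Longrightarrow> left_step j S (Some c) r =
  (if pnd S then (S\<lparr>pnd := False, dn := True\<rparr>, Some (set_head_mark j True c), r)
   else if head_mark j c \<and> \<not> dn S \<and> \<not> org c then (S\<lparr>pnd := True, dn := True\<rparr>, Some (set_head_mark j False c), r)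
   else (S, Some c, r))"
  by (simp add: left_step_def)

lemma job_move_upd[simp]: "job_move j (S\<lparr>pnd := a\<rparr>) = job_move j S" "job_move j (S\<lparr>dn := a\<rparr>) = job_move j S" "job_move j (S\<lparr>ph := p\<rparr>) = job_move j S"
  by (cases j; simp)+
lemma job_value_upd[simp]: "job_value j (S\<lparr>pnd := a\<rparr>) = job_value j S" "job_value j (S\<lparr>dn := a\<rparr>) = job_value j S" "job_value j (S\<lparr>ph := p\<rparr>) = job_value j S"
  by (cases j; simp)+

lemma set_head_mark_views: "is_apply_job j \<Longrightarrow> head_mark j (set_head_mark j b c) = b" "track_value j' (set_head_mark j b c) r = track_value j' c r"
  "is_apply_job j \<Longrightarrow> j' \<noteq> j \<Longrightarrow> head_mark j' (set_head_mark j b c) = head_mark j' c" "org (set_head_mark j b c) = org c" "bt (set_head_mark j b c) = bt c"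
  by (cases j; cases j'; simp add: is_apply_job_def)+

lemma set_track_value_views: "is_apply_job j \<Longrightarrow> track_value j (fst (set_track_value j v c r)) (snd (set_track_value j v c r)) = v"
  "head_mark j' (fst (set_track_value j v c r)) = head_mark j' c"
  "is_apply_job j \<Longrightarrow> j' \<noteq> j \<Longrightarrow> track_value j' (fst (set_track_value j v c r)) (snd (set_track_value j v c r)) = track_value j' c r"
  "org (fst (set_track_value j v c r)) = org c" "bt (fst (set_track_value j v c r)) = bt c"
  by (cases j; cases j'; simp add: is_apply_job_def)+

context composite begin

lemma ap_rpass_nR:
  assumes "ph (AS A) = SR j" "is_apply_job j" "AH A = 0" "AG A = 0" "\<not> pnd (AS A)" "\<not> dn (AS A)"
    "shape (AT A) (AR A) E" "track j (AT A) (AR A) E vals h" "job_move j (AS A) \<noteq> R"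
  shows "silent_run w c A (Suc E) (A\<lparr>AS := (AS A)\<lparr>dn := True, ph := SL j, pnd := False, dn := False\<rparr>,
     AT := (AT A)(h := Some (fst (set_track_value j (job_value j (AS A)) (the (AT A h)) (AR A h)))), AH := E - 1,
     AR := (AR A)(h := snd (set_track_value j (job_value j (AS A)) (the (AT A h)) (AR A h))), AG := E - 1\<rparr>)"
proof -
  let ?S = "AS A" let ?T = "AT A" let ?R = "AR A"
  let ?c1 = "fst (set_track_value j (job_value j ?S) (the (?T h)) (?R h))"
  let ?r1 = "snd (set_track_value j (job_value j ?S) (the (?T h)) (?R h))"
  define \<sigma> where "\<sigma> i = (if i \<le> h then ?S else ?S\<lparr>dn := True\<rparr>)" for i
  define T' where "T' i = (if i = h then Some ?c1 else ?T i)" for i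
  define R' where "R' i = (if i = h then ?r1 else ?R i)" for i
  have tr: "\<forall>i<E. head_mark j (the (?T i)) = (i = h)" "h < E" using assms(8) by (auto simp: track_def)
  have st: "right_step j (\<sigma> i) (?T i) (?R i) = (\<sigma> (Suc i), T' i, R' i, True)" if i: "i < E" for i
  proof -
    obtain cl where cl: "?T i = Some cl" using shape_Some[OF assms(7) i] by blast
    have g: "head_mark j cl = (i = h)" using tr i cl by auto
    show ?thesis using cl g assms(5,6,9) by (auto simp: right_step_ap[OF assms(2)] \<sigma>_def T'_def R'_def)
  qed
  have ne: "j \<noteq> INC" using assms(2) by (auto simp: is_apply_job_def)
  have stE: "right_step j (\<sigma> E) (?T E) (?R E) = (\<sigma> E, T' E, R' E, False)"
    using shape_None[OF assms(7), of E] right_step_None[of "\<sigma> E" j] assms(5) ne tr(2)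
    by (simp add: \<sigma>_def T'_def R'_def)
  have "silent_run w c A (Suc (E - 0)) (A\<lparr>AS := (\<sigma> E)\<lparr>ph := SL j, pnd := False, dn := False\<rparr>,
            AT := (\<lambda>i. if 0 \<le> i \<and> i \<le> E then T' i else ?T i),
            AH := E - 1, AR := (\<lambda>i. if 0 \<le> i \<and> i \<le> E then R' i else ?R i), AG := E - 1\<rparr>)"
    by (rule right_pass[where \<sigma>=\<sigma>]) (use assms st stE in \<open>auto simp: \<sigma>_def\<close>)
  moreover have "(\<lambda>i. if 0 \<le> i \<and> i \<le> E then T' i else ?T i) = ?T(h := Some ?c1)"
    "(\<lambda>i. if 0 \<le> i \<and> i \<le> E then R' i else ?R i) = ?R(h := ?r1)"
    using tr(2) by (auto simp: fun_eq_iff T'_def R'_def)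
  ultimately show ?thesis using tr(2) by (simp add: \<sigma>_def)
qed

end

definition apply_result :: "job \<Rightarrow> acfg \<Rightarrow> acfg \<Rightarrow> nat \<Rightarrow> nat \<Rightarrow> (nat \<Rightarrow> nat) \<Rightarrow> nat \<Rightarrow> bool" where
 "apply_result j A B E E' vals h \<longleftrightarrow> (\<exists>P D. AS B = finish_job j ((AS A)\<lparr>ph := SL j, pnd := P, dn := D\<rparr>)) \<and> AH B = 0 \<and> AG B = 0
   \<and> E' = max E (Suc (mv (job_move j (AS A)) h)) \<and> shape (AT B) (AR B) E'
   \<and> track j (AT B) (AR B) E' (vals(h := job_value j (AS A))) (mv (job_move j (AS A)) h)
   \<and> (\<forall>j' vals' h'. is_apply_job j' \<and> j' \<noteq> j \<longrightarrow> track j' (AT A) (AR A) E vals' h' \<longrightarrow> track j' (AT B) (AR B) E' vals' h')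
   \<and> (\<forall>n. counter (AT A) E n \<longrightarrow> counter (AT B) E' n)"

lemma apply_result_intro:
  assumes "\<exists>P D. AS B = finish_job j ((AS A)\<lparr>ph := SL j, pnd := P, dn := D\<rparr>)" "AH B = 0" "AG B = 0"
    "is_apply_job j" "shape (AT A) (AR A) E" "track j (AT A) (AR A) E vals h"
    "E' = max E (Suc (mv (job_move j (AS A)) h))"
    "\<And>i. i < E' \<Longrightarrow> AT B i \<noteq> None \<and> org (the (AT B i)) = (i = 0)"
    "\<And>i. E' \<le> i \<Longrightarrow> AT B i = None \<and> AR B i = 0"
    "\<And>i j'. i < E \<Longrightarrow> is_apply_job j' \<Longrightarrow> j' \<noteq> j \<Longrightarrow> keeps_track j' (the (AT A i)) (the (AT B i)) (AR A i) (AR B i)"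
    "\<And>i. i < E \<Longrightarrow> bt (the (AT B i)) = bt (the (AT A i))"
    "\<And>i. E \<le> i \<Longrightarrow> i < E' \<Longrightarrow> the (AT B i) = set_head_mark j True blank_cell \<and> AR B i = 0"
    "\<And>i. i < E' \<Longrightarrow> track_value j (the (AT B i)) (AR B i) = (vals(h := job_value j (AS A))) i
        \<and> head_mark j (the (AT B i)) = (i = mv (job_move j (AS A)) h)"
  shows "apply_result j A B E E' vals h"
  unfolding apply_result_def
proof (intro conjI allI impI)
  show "\<exists>P D. AS B = finish_job j ((AS A)\<lparr>ph := SL j, pnd := P, dn := D\<rparr>)" by fact
  show "AH B = 0" "AG B = 0" by fact+
  show "E' = max E (Suc (mv (job_move j (AS A)) h))" by fact
  have E0: "0 < E'" using assms(7) by simp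
  show "shape (AT B) (AR B) E'"
  proof (rule shapeI)
    fix i assume i: "i < E'"
    then obtain y where "AT B i = Some y" using assms(8)[OF i] by auto
    then show "\<exists>c. AT B i = Some c \<and> org c = (i = 0)" using assms(8)[OF i] by auto
  qed (use assms(9) E0 in auto)
  have hE: "h < E" "\<forall>i\<ge>E. vals i = 0" using assms(6) by (auto simp: track_def)
  show "track j (AT B) (AR B) E' (vals(h := job_value j (AS A))) (mv (job_move j (AS A)) h)"
    unfolding track_def using assms(13) assms(7) hE by auto
  show "track j' (AT B) (AR B) E' vals' h'" if "is_apply_job j' \<and> j' \<noteq> j" "track j' (AT A) (AR A) E vals' h'" for j' vals' h'
  proof (rule track_mono[OF that(2)])
    show "E \<le> E'" using assms(7) by simp
    show "keeps_track j' (the (AT A i)) (the (AT B i)) (AR A i) (AR B i)" if "i < E" for i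
      using assms(10) that \<open>is_apply_job j' \<and> j' \<noteq> j\<close> by blast
    show "track_value j' (the (AT B i)) (AR B i) = 0 \<and> \<not> head_mark j' (the (AT B i))" if "E \<le> i" "i < E'" for i
      using assms(12)[OF that] blank_cell_views[of j'] set_head_mark_views(2)[of j' j True blank_cell 0] set_head_mark_views(3)[OF assms(4), of j' True blank_cell]
        \<open>is_apply_job j' \<and> j' \<noteq> j\<close> by auto
  qed
  show "counter (AT B) E' n" if "counter (AT A) E n" for n
  proof (rule counter_mono[OF that])
    show "E \<le> E'" using assms(7) by simp
    show "bt (the (AT B i)) = bt (the (AT A i))" if "i < E" for i using assms(11) that by blast
    show "\<not> bt (the (AT B i))" if "E \<le> i" "i < E'" for i
      using assms(12)[OF that] set_head_mark_views(5)[of j True blank_cell] by (simp add: blank_cell_def)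
  qed
qed

context composite begin

lemma apply_N:
  assumes "ph (AS A) = SR j" "is_apply_job j" "AH A = 0" "AG A = 0" "\<not> pnd (AS A)" "\<not> dn (AS A)"
    "shape (AT A) (AR A) E" "track j (AT A) (AR A) E vals h"
    "job_move j (AS A) = N \<or> (job_move j (AS A) = L \<and> h = 0)"
  shows "\<exists>k B. silent_run w c A k B \<and> apply_result j A B E E vals h"
proof -
  let ?S = "AS A" let ?T = "AT A" let ?R = "AR A"
  let ?c1 = "fst (set_track_value j (job_value j ?S) (the (?T h)) (?R h))"
  let ?r1 = "snd (set_track_value j (job_value j ?S) (the (?T h)) (?R h))"
  let ?S1 = "?S\<lparr>dn := True, ph := SL j, pnd := False, dn := False\<rparr>"
  let ?A1 = "A\<lparr>AS := ?S1, AT := ?T(h := Some ?c1), AH := E - 1, AR := ?R(h := ?r1), AG := E - 1\<rparr>"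
  have nR: "job_move j ?S \<noteq> R" using assms(9) by auto
  have r1: "silent_run w c A (Suc E) ?A1" by (rule ap_rpass_nR) (use assms nR in auto)
  have tr: "\<forall>i<E. track_value j (the (?T i)) (?R i) = vals i \<and> head_mark j (the (?T i)) = (i = h)" "h < E" "\<forall>i\<ge>E. vals i = 0"
    using assms(8) by (auto simp: track_def)
  have E0: "0 < E" using shape_pos[OF assms(7)] .
  have orgs: "is_origin ((?T(h := Some ?c1)) i) = (i = 0)" for i
  proof (cases "i < E")
    case True
    obtain cl where cl: "?T i = Some cl" using shape_Some[OF assms(7) True] by blast
    obtain ch where ch: "?T h = Some ch" using shape_Some[OF assms(7) tr(2)] by blast
    show ?thesis using cl ch shape_org[OF assms(7) True] shape_org[OF assms(7) tr(2)] set_track_value_views(4)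
      by (auto simp: is_origin_def)
  next
    case False then show ?thesis using shape_None[OF assms(7)] tr(2) by (auto simp: is_origin_def)
  qed
  have li: "left_step j ?S1 ((?T(h := Some ?c1)) i) ((?R(h := ?r1)) i) = (?S1, (?T(h := Some ?c1)) i, (?R(h := ?r1)) i)" for i
  proof (cases "job_move j ?S = L")
    case False then show ?thesis using left_step_id[of j ?S1] by simp
  next
    case jL: True
    then have h0: "h = 0" using assms(9) by auto
    show ?thesis
    proof (cases "i < E")
      case iE: True
      obtain cl where cl: "?T i = Some cl" using shape_Some[OF assms(7) iE] by blast
      show ?thesis
      proof (cases "i = 0")
        case True then show ?thesis using h0 cl shape_org[OF assms(7) iE] set_track_value_views(4) jL
          by (simp add: left_step_apL[OF assms(2)] True)
      next
        case False then show ?thesis using h0 cl tr(1) iE left_step_apL[OF assms(2)] jL by auto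
      qed
    next
      case False then show ?thesis using shape_None[OF assms(7)] tr(2) by (simp add: left_step_def)
    qed
  qed
  have r2: "silent_run w c ?A1 (Suc (E - 1)) (?A1\<lparr>AS := finish_job j ?S1,
            AT := (\<lambda>i. if i \<le> E - 1 then (?T(h := Some ?c1)) i else AT ?A1 i),
            AH := 0, AR := (\<lambda>i. if i \<le> E - 1 then (?R(h := ?r1)) i else AR ?A1 i), AG := 0\<rparr>)"
  proof (rule left_pass[where \<tau>="\<lambda>_. ?S1"])
    show "left_step j ((\<lambda>_. ?S1) 0) (AT ?A1 0) (AR ?A1 0) = (?S1, (?T(h := Some ?c1)) 0, (?R(h := ?r1)) 0)"
      using li[of 0] by simp
    show "is_origin (AT ?A1 0)" using orgs[of 0] by simp
    show "left_step j ((\<lambda>_. ?S1) i) (AT ?A1 i) (AR ?A1 i) = ((\<lambda>_. ?S1) (i - 1), (?T(h := Some ?c1)) i, (?R(h := ?r1)) i)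
       \<and> \<not> is_origin (AT ?A1 i)" if "0 < i" "i \<le> E - 1" for i
      using li[of i] orgs[of i] that by simp
  qed simp_all
  let ?B = "?A1\<lparr>AS := finish_job j ?S1,
            AT := (\<lambda>i. if i \<le> E - 1 then (?T(h := Some ?c1)) i else AT ?A1 i),
            AH := 0, AR := (\<lambda>i. if i \<le> E - 1 then (?R(h := ?r1)) i else AR ?A1 i), AG := 0\<rparr>"
  have rB: "silent_run w c A (Suc E + Suc (E - 1)) ?B" by (rule silent_run_trans[OF r1 r2])
  have TB: "AT ?B = ?T(h := Some ?c1)" "AR ?B = ?R(h := ?r1)" by (auto simp: fun_eq_iff)
  have mvh: "mv (job_move j ?S) h = h" using assms(9) by auto
  have "apply_result j A ?B E E vals h"
  proof (rule apply_result_intro[OF _ _ _ assms(2,7,8)])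
    show "\<exists>P D. AS ?B = finish_job j (?S\<lparr>ph := SL j, pnd := P, dn := D\<rparr>)" by auto
    show "E = max E (Suc (mv (job_move j ?S) h))" using mvh tr(2) by simp
    show "AT ?B i \<noteq> None \<and> org (the (AT ?B i)) = (i = 0)" if "i < E" for i
    proof -
      have "(?T(h := Some ?c1)) i \<noteq> None" using shape_dom[OF assms(7), of i] that by auto
      then obtain x where x: "(?T(h := Some ?c1)) i = Some x" by blast
      then show ?thesis using TB orgs[of i] by (simp add: is_origin_def)
    qed
    show "AT ?B i = None \<and> AR ?B i = 0" if "E \<le> i" for i
      using TB that tr(2) shape_None[OF assms(7) that] shape_R[OF assms(7) that] by auto
    show "keeps_track j' (the (?T i)) (the (AT ?B i)) (?R i) (AR ?B i)" if "i < E" "is_apply_job j'" "j' \<noteq> j" for i j'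
      using TB set_track_value_views(2) set_track_value_views(3)[OF assms(2) that(3)] by (auto simp: keeps_track_def)
    show "bt (the (AT ?B i)) = bt (the (?T i))" if "i < E" for i using TB set_track_value_views(5) by auto
    show "the (AT ?B i) = set_head_mark j True blank_cell \<and> AR ?B i = 0" if "E \<le> i" "i < E" for i using that by simp
    show "track_value j (the (AT ?B i)) (AR ?B i) = (vals(h := job_value j ?S)) i \<and> head_mark j (the (AT ?B i)) = (i = mv (job_move j ?S) h)"
      if "i < E" for i
      using TB tr(1) that set_track_value_views(1)[OF assms(2)] set_track_value_views(2) mvh by auto
  qed (simp_all)
  then show ?thesis using rB by blast
qed


lemma apply_R:
  assumes "ph (AS A) = SR j" "is_apply_job j" "AH A = 0" "AG A = 0" "\<not> pnd (AS A)" "\<not> dn (AS A)"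
    "shape (AT A) (AR A) E" "track j (AT A) (AR A) E vals h" "job_move j (AS A) = R"
  shows "\<exists>k B. silent_run w c A k B \<and> apply_result j A B E (max E (Suc (Suc h))) vals h"
proof -
  let ?S = "AS A" let ?T = "AT A" let ?R = "AR A"
  let ?c1 = "fst (set_track_value j (job_value j ?S) (the (?T h)) (?R h))"
  let ?r1 = "snd (set_track_value j (job_value j ?S) (the (?T h)) (?R h))"
  have tr: "\<forall>i<E. track_value j (the (?T i)) (?R i) = vals i \<and> head_mark j (the (?T i)) = (i = h)" "h < E" "\<forall>i\<ge>E. vals i = 0"
    using assms(8) by (auto simp: track_def)
  define m where "m = max E (Suc (Suc h))"
  have m: "m = (if Suc h = E then Suc E else E)" using tr(2) by (auto simp: m_def)
  define \<sigma> where "\<sigma> i = (if i \<le> h then ?S else if i = Suc h then ?S\<lparr>pnd := True, dn := True\<rparr> else ?S\<lparr>pnd := False, dn := True\<rparr>)" for i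
  define nc where "nc = set_head_mark j True (if Suc h < E then the (?T (Suc h)) else blank_cell)"
  define T' where "T' i = (if i = h then Some (set_head_mark j False ?c1) else if i = Suc h then Some nc else ?T i)" for i
  define R' where "R' i = (if i = h then ?r1 else ?R i)" for i
  have ne: "j \<noteq> INC" using assms(2) by (auto simp: is_apply_job_def)
  have st: "right_step j (\<sigma> i) (?T i) (?R i) = (\<sigma> (Suc i), T' i, R' i, True)" if i: "i < m" for i
  proof (cases "i < E")
    case True
    obtain cl where cl: "?T i = Some cl" using shape_Some[OF assms(7) True] by blast
    have g: "head_mark j cl = (i = h)" using tr True cl by auto
    show ?thesis
    proof (cases "i = Suc h")
      case True then show ?thesis using cl g assms(5,6,9) \<open>i < E\<close>
        by (simp add: right_step_ap[OF assms(2)] \<sigma>_def T'_def R'_def nc_def)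
    next
      case False then show ?thesis using cl g assms(5,6,9)
        by (auto simp: right_step_ap[OF assms(2)] \<sigma>_def T'_def R'_def)
    qed
  next
    case False
    then have "i = E" "Suc h = E" using i m by (auto split: if_splits)
    then show ?thesis using shape_None[OF assms(7), of E] shape_R[OF assms(7), of E]
      by (simp add: right_step_def \<sigma>_def T'_def R'_def nc_def)
  qed
  have mge: "Suc h < m" "E \<le> m" using m tr(2) by auto
  have stE: "right_step j (\<sigma> m) (?T m) (?R m) = (\<sigma> m, T' m, R' m, False)"
  proof -
    have "\<not> pnd (\<sigma> m)" using mge assms(5) by (simp add: \<sigma>_def)
    then show ?thesis using shape_None[OF assms(7) mge(2)] right_step_None[of "\<sigma> m" j] ne mge
      by (simp add: T'_def R'_def)
  qed
  have orgT: "org (the (?T i)) = (i = 0)" if "i < E" for i using shape_org[OF assms(7) that] .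
  have orgs: "is_origin (T' i) = (i = 0)" if "i < m" for i
  proof -
    have "is_origin (?T i) = (i = 0)" using assms(7) by (simp add: shape_def)
    moreover have "org (set_head_mark j False ?c1) = (h = 0)" using set_track_value_views(4) set_head_mark_views(4) orgT[OF tr(2)] by simp
    moreover have "\<not> org nc" using set_head_mark_views(4) orgT[of "Suc h"] by (simp add: nc_def blank_cell_def)
    ultimately show ?thesis by (auto simp: T'_def is_origin_def)
  qed
  have r: "silent_run w c A (Suc m + m) (A\<lparr>AS := finish_job j ((\<sigma> m)\<lparr>ph := SL j, pnd := False, dn := False\<rparr>),
            AT := (\<lambda>i. if i \<le> m then T' i else ?T i),
            AH := 0, AR := (\<lambda>i. if i \<le> m then R' i else ?R i), AG := 0\<rparr>)"
  proof (rule sweep_idle_left[where \<sigma>=\<sigma>])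
    show "is_origin (T' 0)" using orgs[of 0] mge by simp
    show "\<not> is_origin (T' i)" if "0 < i" "i < m" for i using orgs[of i] that by simp
    show "\<not> (is_apply_job j \<and> job_move j (\<sigma> m) = L)" using assms(9) by (simp add: \<sigma>_def)
  qed (use assms st stE mge in \<open>auto simp: \<sigma>_def\<close>)
  let ?B = "A\<lparr>AS := finish_job j ((\<sigma> m)\<lparr>ph := SL j, pnd := False, dn := False\<rparr>),
            AT := (\<lambda>i. if i \<le> m then T' i else ?T i),
            AH := 0, AR := (\<lambda>i. if i \<le> m then R' i else ?R i), AG := 0\<rparr>"
  have TB: "AT ?B i = (if i < m then T' i else None)" for i
    using shape_None[OF assms(7), of i] mge stE by (auto simp: T'_def)
  have RB: "AR ?B i = (if i < m then R' i else 0)" for i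
    using shape_R[OF assms(7), of i] mge by (auto simp: R'_def)
  have mvh: "mv (job_move j ?S) h = Suc h" using assms(9) by simp
  have "apply_result j A ?B E m vals h"
  proof (rule apply_result_intro[OF _ _ _ assms(2,7,8)])
    show "\<exists>P D. AS ?B = finish_job j (?S\<lparr>ph := SL j, pnd := P, dn := D\<rparr>)" by (auto simp: \<sigma>_def)
    show "m = max E (Suc (mv (job_move j ?S) h))" using mvh m_def by simp
    show "AT ?B i \<noteq> None \<and> org (the (AT ?B i)) = (i = 0)" if "i < m" for i
    proof -
      have "T' i \<noteq> None" using that shape_dom[OF assms(7), of i] m by (auto simp: T'_def split: if_splits)
      then show ?thesis using TB orgs[OF that] that by (auto simp: is_origin_def)
    qed
    show "AT ?B i = None \<and> AR ?B i = 0" if "m \<le> i" for i using TB RB that by auto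
    show "keeps_track j' (the (?T i)) (the (AT ?B i)) (?R i) (AR ?B i)" if "i < E" "is_apply_job j'" "j' \<noteq> j" for i j'
      using TB RB mge that set_track_value_views(2) set_track_value_views(3)[OF assms(2) that(3)] set_head_mark_views(2) set_head_mark_views(3)[OF assms(2) that(3)]
      by (auto simp: keeps_track_def T'_def R'_def nc_def)
    show "bt (the (AT ?B i)) = bt (the (?T i))" if "i < E" for i
      using TB mge that set_track_value_views(5) set_head_mark_views(5) by (auto simp: T'_def nc_def)
    show "the (AT ?B i) = set_head_mark j True blank_cell \<and> AR ?B i = 0" if "E \<le> i" "i < m" for i
    proof -
      have "i = E" "Suc h = E" using that m by (auto split: if_splits)
      then show ?thesis using TB RB shape_R[OF assms(7), of E] that by (simp add: T'_def R'_def nc_def)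
    qed
    show "track_value j (the (AT ?B i)) (AR ?B i) = (vals(h := job_value j ?S)) i \<and> head_mark j (the (AT ?B i)) = (i = mv (job_move j ?S) h)"
      if "i < m" for i
    proof (cases "i < E")
      case True then show ?thesis
        using TB RB tr that set_track_value_views(1)[OF assms(2)] set_track_value_views(2) set_head_mark_views(1)[OF assms(2)] set_head_mark_views(2) mvh
        by (auto simp: T'_def R'_def nc_def)
    next
      case False
      then have "i = E" "Suc h = E" using that m by (auto split: if_splits)
      then show ?thesis using TB RB tr shape_R[OF assms(7), of E] set_head_mark_views(1)[OF assms(2)] set_head_mark_views(2) blank_cell_views mvh that
        by (simp add: T'_def R'_def nc_def)
    qed
  qed (simp_all)
  then show ?thesis using r m_def by blast
qed


lemma apply_L:
  assumes "ph (AS A) = SR j" "is_apply_job j" "AH A = 0" "AG A = 0" "\<not> pnd (AS A)" "\<not> dn (AS A)"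
    "shape (AT A) (AR A) E" "track j (AT A) (AR A) E vals h" "job_move j (AS A) = L" "0 < h"
  shows "\<exists>k B. silent_run w c A k B \<and> apply_result j A B E E vals h"
proof -
  let ?S = "AS A" let ?T = "AT A" let ?R = "AR A"
  let ?c1 = "fst (set_track_value j (job_value j ?S) (the (?T h)) (?R h))"
  let ?r1 = "snd (set_track_value j (job_value j ?S) (the (?T h)) (?R h))"
  let ?S1 = "?S\<lparr>dn := True, ph := SL j, pnd := False, dn := False\<rparr>"
  let ?T1 = "?T(h := Some ?c1)" let ?R1 = "?R(h := ?r1)"
  let ?A1 = "A\<lparr>AS := ?S1, AT := ?T1, AH := E - 1, AR := ?R1, AG := E - 1\<rparr>"
  have r1: "silent_run w c A (Suc E) ?A1" by (rule ap_rpass_nR) (use assms in auto)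
  have tr: "\<forall>i<E. track_value j (the (?T i)) (?R i) = vals i \<and> head_mark j (the (?T i)) = (i = h)" "h < E" "\<forall>i\<ge>E. vals i = 0"
    using assms(8) by (auto simp: track_def)
  have orgT: "org (the (?T i)) = (i = 0)" if "i < E" for i using shape_org[OF assms(7) that] .
  define \<tau> where "\<tau> i = (if h \<le> i then ?S1 else if i = h - 1 then ?S1\<lparr>pnd := True, dn := True\<rparr> else ?S1\<lparr>pnd := False, dn := True\<rparr>)" for i
  define T'' where "T'' i = (if i = h then Some (set_head_mark j False ?c1) else if i = h - 1 then Some (set_head_mark j True (the (?T (h - 1)))) else ?T1 i)" for i
  have jL: "job_move j ?S1 = L" "\<not> pnd ?S1" "\<not> dn ?S1" using assms(9) by simp_all
  have lst: "left_step j (\<tau> i) (?T1 i) (?R1 i) = (\<tau> (i - 1), T'' i, ?R1 i)" if i: "i < E" and i0: "0 < i" for i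
  proof -
    obtain cl where cl: "?T i = Some cl" using shape_Some[OF assms(7) i] by blast
    have g: "head_mark j cl = (i = h)" using tr i cl by auto
    have o: "org cl = (i = 0)" using orgT[OF i] cl by simp
    consider "h < i" | "i = h" | "i = h - 1" | "i < h - 1" by linarith
    then show ?thesis
    proof cases
      case 1 then show ?thesis using cl g jL by (simp add: left_step_apL[OF assms(2)] \<tau>_def T''_def)
    next
      case 2 then show ?thesis using cl g o jL assms(10) set_track_value_views(2,4)
        by (simp add: left_step_apL[OF assms(2)] \<tau>_def T''_def)
    next
      case 3
      then have "\<not> h \<le> i" "i \<noteq> h" "\<not> h \<le> i - 1" "i - 1 \<noteq> h - 1" using i0 assms(10) by auto
      then show ?thesis using cl g jL 3 by (simp add: left_step_apL[OF assms(2)] \<tau>_def T''_def)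
    next
      case 4
      then have "\<not> h \<le> i" "i \<noteq> h" "i \<noteq> h - 1" "\<not> h \<le> i - 1" "i - 1 \<noteq> h - 1" using i0 assms(10) by auto
      then show ?thesis using cl g jL 4 by (simp add: left_step_apL[OF assms(2)] \<tau>_def T''_def)
    qed
  qed
  have orgs: "is_origin (?T1 i) = (i = 0)" if "i < E" for i
    using assms(7) set_track_value_views(4) orgT[OF tr(2)] assms(10) by (auto simp: shape_def is_origin_def)
  have E1: "0 < E - 1 \<or> E = 1" using tr(2) by linarith
  let ?Sf = "?S1\<lparr>pnd := False, dn := True\<rparr>"
  have t0: "\<tau> 0 = (if h = 1 then ?S1\<lparr>pnd := True, dn := True\<rparr> else ?Sf)" using assms(10) by (auto simp: \<tau>_def)
  have lst0: "left_step j (\<tau> 0) (?T1 0) (?R1 0) = (?Sf, T'' 0, ?R1 0)"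
  proof -
    obtain cl where cl: "?T 0 = Some cl" using shape_Some[OF assms(7)] tr(2) by fastforce
    have g: "head_mark j cl = (0 = h)" using tr cl by auto
    show ?thesis
    proof (cases "h = 1")
      case True then show ?thesis using cl g jL t0 by (simp add: left_step_apL[OF assms(2)] T''_def)
    next
      case False
      then have "0 \<noteq> h - 1" "0 \<noteq> h" using assms(10) by auto
      then show ?thesis using cl g jL t0 False by (simp add: left_step_apL[OF assms(2)] T''_def)
    qed
  qed
  have r2: "silent_run w c ?A1 (Suc (E - 1)) (?A1\<lparr>AS := finish_job j ?Sf,
            AT := (\<lambda>i. if i \<le> E - 1 then T'' i else AT ?A1 i),
            AH := 0, AR := (\<lambda>i. if i \<le> E - 1 then ?R1 i else AR ?A1 i), AG := 0\<rparr>)"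
  proof (rule left_pass[where \<tau>=\<tau>])
    show "\<tau> (E - 1) = AS ?A1" using tr(2) by (simp add: \<tau>_def)
    show "left_step j (\<tau> 0) (AT ?A1 0) (AR ?A1 0) = (?Sf, T'' 0, ?R1 0)" using lst0 by simp
    show "is_origin (AT ?A1 0)" using orgs[of 0] tr(2) by simp
    show "left_step j (\<tau> i) (AT ?A1 i) (AR ?A1 i) = (\<tau> (i - 1), T'' i, ?R1 i) \<and> \<not> is_origin (AT ?A1 i)"
      if "0 < i" "i \<le> E - 1" for i
      using lst[of i] orgs[of i] that by simp
  qed simp_all
  let ?B = "?A1\<lparr>AS := finish_job j ?Sf,
            AT := (\<lambda>i. if i \<le> E - 1 then T'' i else AT ?A1 i),
            AH := 0, AR := (\<lambda>i. if i \<le> E - 1 then ?R1 i else AR ?A1 i), AG := 0\<rparr>"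
  have rB: "silent_run w c A (Suc E + Suc (E - 1)) ?B" by (rule silent_run_trans[OF r1 r2])
  have TB: "AT ?B i = (if i < E then T'' i else None)" for i
    using shape_None[OF assms(7), of i] tr(2) by (auto simp: T''_def)
  have RB: "AR ?B i = (if i < E then ?R1 i else 0)" for i
    using shape_R[OF assms(7), of i] tr(2) by auto
  have mvh: "mv (job_move j ?S) h = h - 1" using assms(9) by simp
  have "apply_result j A ?B E E vals h"
  proof (rule apply_result_intro[OF _ _ _ assms(2,7,8)])
    show "\<exists>P D. AS ?B = finish_job j (?S\<lparr>ph := SL j, pnd := P, dn := D\<rparr>)" by auto
    show "E = max E (Suc (mv (job_move j ?S) h))" using mvh tr(2) by simp
    show "AT ?B i \<noteq> None \<and> org (the (AT ?B i)) = (i = 0)" if iE: "i < E" for i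
    proof -
      obtain cl where cl: "?T i = Some cl" using shape_Some[OF assms(7) iE] by blast
      show ?thesis using TB iE cl orgT[OF that] orgT[OF tr(2)] set_track_value_views(4) set_head_mark_views(4) assms(10)
        by (auto simp: T''_def)
    qed
    show "AT ?B i = None \<and> AR ?B i = 0" if "E \<le> i" for i using TB RB that by auto
    show "keeps_track j' (the (?T i)) (the (AT ?B i)) (?R i) (AR ?B i)" if "i < E" "is_apply_job j'" "j' \<noteq> j" for i j'
      using TB RB that set_track_value_views(2) set_track_value_views(3)[OF assms(2) that(3)] set_head_mark_views(2) set_head_mark_views(3)[OF assms(2) that(3)]
      by (auto simp: keeps_track_def T''_def)
    show "bt (the (AT ?B i)) = bt (the (?T i))" if "i < E" for i
      using TB that set_track_value_views(5) set_head_mark_views(5) by (auto simp: T''_def)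
    show "the (AT ?B i) = set_head_mark j True blank_cell \<and> AR ?B i = 0" if "E \<le> i" "i < E" for i using that by simp
    show "track_value j (the (AT ?B i)) (AR ?B i) = (vals(h := job_value j ?S)) i \<and> head_mark j (the (AT ?B i)) = (i = mv (job_move j ?S) h)"
      if "i < E" for i
      using TB RB tr that set_track_value_views(1)[OF assms(2)] set_track_value_views(2) set_head_mark_views(1)[OF assms(2)] set_head_mark_views(2) mvh assms(10)
      by (auto simp: T''_def)
  qed (simp_all)
  then show ?thesis using rB by blast
qed

lemma apply_sweep:
  assumes "ph (AS A) = SR j" "is_apply_job j" "AH A = 0" "AG A = 0" "\<not> pnd (AS A)" "\<not> dn (AS A)"
    "shape (AT A) (AR A) E" "track j (AT A) (AR A) E vals h"
  shows "\<exists>k B E'. silent_run w c A k B \<and> apply_result j A B E E' vals h"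
proof (cases "job_move j (AS A)")
  case L then show ?thesis
  proof (cases "h = 0")
    case True then show ?thesis using apply_N[OF assms] L by blast
  next
    case False then show ?thesis using apply_L[OF assms L] by blast
  qed
next
  case N then show ?thesis using apply_N[OF assms] by blast
next
  case R then show ?thesis using apply_R[OF assms R] by blast
qed


lemma ctrl_step:
  assumes "\<not> halted_state (AS A)"
    "adelta (AS A) (inp w (idxval (AR A))) (AT A (AH A)) (AR A (AG A)) (chsym c (AC A)) = (S', AT A (AH A), AR A (AG A), N, N, mc)"
  shows "astep w c A = A\<lparr>AS := S', AC := mv mc (AC A)\<rparr>"
  using assms by (simp add: astep_def)

lemma halted_state_phase: "ph S \<notin> {ACC, REJ} \<Longrightarrow> \<not> halted_state S"
  using halted_state_ph by blast

lemma start_job_simps[simp]: "ph (start_job j S) = SR j" "pnd (start_job j S) = False" "dn (start_job j S) = False"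
  "cry (start_job j S) = True" "eqf (start_job j S) = True" "q1 (start_job j S) = q1 S" "q2 (start_job j S) = q2 S"
  "s1 (start_job j S) = s1 S" "i1 (start_job j S) = i1 S" "s2 (start_job j S) = s2 S" "i2 (start_job j S) = i2 S"
  "inc (start_job j S) = inc S" "wv1 (start_job j S) = wv1 S" "xv1 (start_job j S) = xv1 S" "wm1 (start_job j S) = wm1 S"
  "xm1 (start_job j S) = xm1 S" "wv2 (start_job j S) = wv2 S" "xv2 (start_job j S) = xv2 S" "wm2 (start_job j S) = wm2 S"
  "xm2 (start_job j S) = xm2 S" "av (start_job j S) = av S"
  by (simp_all add: start_job_def)

end

section \<open>Simulating R until the query symbol appears\<close>

definition tracks_Mp :: "acfg \<Rightarrow> cfg \<Rightarrow> nat \<Rightarrow> bool" where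
  "tracks_Mp A C E \<longleftrightarrow> track AW1 (AT A) (AR A) E (wt C) (wh C) \<and> track AX1 (AT A) (AR A) E (it C) (ih C)"
definition tracks_Mr :: "acfg \<Rightarrow> cfg \<Rightarrow> nat \<Rightarrow> bool" where
  "tracks_Mr A C E \<longleftrightarrow> track AW2 (AT A) (AR A) E (wt C) (wh C) \<and> track AX2 (AT A) (AR A) E (it C) (ih C)"

lemma is_apply_job_simps[simp]: "is_apply_job AW1" "is_apply_job AX1" "is_apply_job AW2" "is_apply_job AX2" by (simp_all add: is_apply_job_def)
lemma is_gather_job_simps[simp]: "is_gather_job GW1" "is_gather_job GX1" "is_gather_job GW2" "is_gather_job GX2" by (simp_all add: is_gather_job_def)

lemma track_AX2_R: "track AX2 T Rx E vals h \<Longrightarrow> shape T Rx E \<Longrightarrow> Rx = vals"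
  by (auto simp: track_def shape_def fun_eq_iff)

lemma track_vals0: "track j T Rx E vals h \<Longrightarrow> E \<le> i \<Longrightarrow> vals i = 0"
  by (auto simp: track_def)

lemma finite_idx: fixes E :: nat assumes "\<And>i. E \<le> i \<Longrightarrow> t i = (0::nat)" shows "finite {i. t i = 2}"
proof (rule finite_subset[of _ "{..<E}"])
  show "{i. t i = 2} \<subseteq> {..<E}"
  proof
    fix i assume "i \<in> {i. t i = 2}"
    then have t2: "t i = 2" by simp
    show "i \<in> {..<E}"
    proof (rule ccontr)
      assume "i \<notin> {..<E}" then have "E \<le> i" by simp
      then show False using assms[of i] t2 by simp
    qed
  qed
qed simp

lemma cmp_iff:
  assumes "track AX1 T Rx E vals h" "counter T E n"
  shows "(\<forall>l<E. bt (the (T l)) = (x1 (the (T l)) = 2)) \<longleftrightarrow> n = idxval vals"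
proof -
  have fin: "finite {i. vals i = 2}" using finite_idx[of E vals] track_vals0[OF assms(1)] by blast
  have bv: "bit (idxval vals) l \<longleftrightarrow> vals l = 2" for l using bit_idxval[OF fin] .
  have x: "\<forall>l<E. x1 (the (T l)) = vals l" using assms(1) by (auto simp: track_def)
  have b: "\<forall>l<E. bt (the (T l)) = bit n l" "n < 2 ^ E" using assms(2) by (auto simp: counter_def)
  have pE: "idxval vals < 2 ^ E"
  proof -
    have "idxval vals \<le> (\<Sum>i<E. (2::nat) ^ i)" unfolding idxval_def
    proof (rule sum_mono2)
      show "{i. vals i = 2} \<subseteq> {..<E}"
      proof
        fix i assume "i \<in> {i. vals i = 2}"
        then have t2: "vals i = 2" by simp
        show "i \<in> {..<E}"
        proof (rule ccontr)
          assume "i \<notin> {..<E}" then have "E \<le> i" by simp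
          then show False using track_vals0[OF assms(1), of i] t2 by simp
        qed
      qed
    qed auto
    also have "\<dots> < 2 ^ E" by (induction E) auto
    finally show ?thesis .
  qed
  show ?thesis
  proof
    assume "\<forall>l<E. bt (the (T l)) = (x1 (the (T l)) = 2)"
    then have "\<forall>l<E. bit n l \<longleftrightarrow> bit (idxval vals) l" using x b bv by auto
    then show "n = idxval vals" using eq_by_bits[OF b(2) pE] by blast
  next
    assume "n = idxval vals"
    then show "\<forall>l<E. bt (the (T l)) = (x1 (the (T l)) = 2)" using x b bv by auto
  qed
qed

definition at_mhead :: "nat \<Rightarrow> acfg \<Rightarrow> cfg \<Rightarrow> cfg \<Rightarrow> nat \<Rightarrow> bool" where
 "at_mhead Bnd A C' C n \<longleftrightarrow> ph (AS A) = MHEAD \<and> q1 (AS A) = st C' \<and> s1 (AS A) = wt C' (wh C') \<and> i1 (AS A) = it C' (ih C')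
   \<and> q2 (AS A) = st C \<and> AH A = 0 \<and> AG A = 0
   \<and> (\<exists>E. E \<le> Bnd \<and> shape (AT A) (AR A) E \<and> tracks_Mp A C' E \<and> tracks_Mr A C E \<and> counter (AT A) E n)"

definition at_commit :: "nat \<Rightarrow> nat list \<Rightarrow> acfg \<Rightarrow> cfg \<Rightarrow> bool" where
 "at_commit Bnd wp A C' \<longleftrightarrow> ph (AS A) = COMMIT \<and> q1 (AS A) = st C' \<and> s1 (AS A) = wt C' (wh C') \<and> i1 (AS A) = it C' (ih C')
   \<and> answer_symbol (av (AS A)) = inp wp (idxval (it C')) \<and> AH A = 0 \<and> AG A = 0
   \<and> (\<exists>E. E \<le> Bnd \<and> shape (AT A) (AR A) E \<and> tracks_Mp A C' E)"

definition at_mstep :: "nat \<Rightarrow> acfg \<Rightarrow> cfg \<Rightarrow> cfg \<Rightarrow> nat \<Rightarrow> bool" where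
 "at_mstep Bnd A C' C n \<longleftrightarrow> ph (AS A) = MSTEP \<and> q1 (AS A) = st C' \<and> s1 (AS A) = wt C' (wh C') \<and> i1 (AS A) = it C' (ih C')
   \<and> q2 (AS A) = st C \<and> s2 (AS A) = wt C (wh C) \<and> i2 (AS A) = it C (ih C) \<and> eqf (AS A) = (n = idxval (it C'))
   \<and> AH A = 0 \<and> AG A = 0
   \<and> (\<exists>E. E \<le> Bnd \<and> shape (AT A) (AR A) E \<and> tracks_Mp A C' E \<and> tracks_Mr A C E \<and> counter (AT A) E n)"

definition at_inc :: "nat \<Rightarrow> acfg \<Rightarrow> cfg \<Rightarrow> cfg \<Rightarrow> nat \<Rightarrow> bool" where
 "at_inc Bnd A C' C n \<longleftrightarrow> ph (AS A) = SR INC \<and> \<not> pnd (AS A) \<and> cry (AS A)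
   \<and> q1 (AS A) = st C' \<and> s1 (AS A) = wt C' (wh C') \<and> i1 (AS A) = it C' (ih C')
   \<and> q2 (AS A) = st C \<and> AH A = 0 \<and> AG A = 0
   \<and> (\<exists>E. E \<le> Bnd \<and> shape (AT A) (AR A) E \<and> tracks_Mp A C' E \<and> tracks_Mr A C E \<and> counter (AT A) E n)"

context composite begin

lemma mhead_to_mstep:
  assumes "at_mhead Bnd A C' C n" "\<not> halted Mr C"
  shows "\<exists>k B. silent_run w c A k B \<and> at_mstep Bnd B C' C n"
proof -
  let ?S = "AS A"
  obtain E where E: "E \<le> Bnd" "shape (AT A) (AR A) E" "tracks_Mp A C' E" "tracks_Mr A C E" "counter (AT A) E n"
    using assms(1) by (auto simp: at_mhead_def)
  have mh: "ph ?S = MHEAD" "q1 ?S = st C'" "s1 ?S = wt C' (wh C')" "i1 ?S = it C' (ih C')" "q2 ?S = st C"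
    "AH A = 0" "AG A = 0" using assms(1) by (auto simp: at_mhead_def)
  have nh: "\<not> halted_state ?S" using mh(1) halted_state_phase by simp
  let ?A1 = "A\<lparr>AS := start_job GW2 ?S, AC := mv N (AC A)\<rparr>"
  have a1: "astep w c A = ?A1"
    by (rule ctrl_step[OF nh]) (use assms(2) mh in \<open>simp add: adelta_def halted_def\<close>)
  have r1: "silent_run w c A 1 ?A1" using silent_run_one[OF nh a1] halted_state_phase by simp
  have trW2: "track AW2 (AT A) (AR A) E (wt C) (wh C)" and trX2: "track AX2 (AT A) (AR A) E (it C) (ih C)"
    using E(4) by (auto simp: tracks_Mr_def)
  let ?A2 = "?A1\<lparr>AS := finish_job GW2 (gather_update GW2 ((AS ?A1)\<lparr>ph := SL GW2, pnd := False, dn := False\<rparr>) (wt C (wh C)))\<rparr>"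
  have r2: "silent_run w c ?A1 (Suc E + E) ?A2"
    by (rule gather_sweep) (use mh E trW2 in auto)
  let ?A3 = "?A2\<lparr>AS := finish_job GX2 (gather_update GX2 ((AS ?A2)\<lparr>ph := SL GX2, pnd := False, dn := False\<rparr>) (it C (ih C)))\<rparr>"
  have r3: "silent_run w c ?A2 (Suc E + E) ?A3"
    by (rule gather_sweep) (use mh E trX2 in \<open>auto simp: finish_job_def\<close>)
  have S3: "ph (AS ?A3) = SR CMP" "\<not> pnd (AS ?A3)" "eqf (AS ?A3)" by (simp_all add: finish_job_def)
  obtain k4 B where r4: "silent_run w c ?A3 k4 B"
    and B: "AS B = finish_job CMP ((AS ?A3)\<lparr>eqf := (eqf (AS ?A3) \<and> (\<forall>l<E. bt (the (AT ?A3 l)) = (x1 (the (AT ?A3 l)) = 2))),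
       ph := SL CMP, pnd := False, dn := False\<rparr>)" "AH B = 0" "AG B = 0" "AR B = AR ?A3" "AT B = AT ?A3"
    using cmp_sweep[of ?A3 E w c] S3 mh E by auto
  have "(\<forall>l<E. bt (the (AT A l)) = (x1 (the (AT A l)) = 2)) \<longleftrightarrow> n = idxval (it C')"
    by (rule cmp_iff) (use E in \<open>auto simp: tracks_Mp_def\<close>)
  moreover have "E \<le> Bnd \<and> shape (AT B) (AR B) E \<and> tracks_Mp B C' E \<and> tracks_Mr B C E \<and> counter (AT B) E n"
    using E B(4,5) by (simp add: tracks_Mp_def tracks_Mr_def)
  ultimately have "at_mstep Bnd B C' C n"
    using B(1-3) mh unfolding at_mstep_def by (auto simp: finish_job_def)
  then show ?thesis using silent_run_trans[OF silent_run_trans[OF silent_run_trans[OF r1 r2] r3] r4] by blast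
qed

lemma inc_to_mhead:
  assumes "at_inc Bnd A C' C n" "Suc n < 2 ^ Bnd"
  shows "\<exists>k B. silent_run w c A k B \<and> at_mhead Bnd B C' C (Suc n)"
proof -
  obtain E where E: "E \<le> Bnd" "shape (AT A) (AR A) E" "tracks_Mp A C' E" "tracks_Mr A C E" "counter (AT A) E n"
    using assms(1) by (auto simp: at_inc_def)
  have S: "ph (AS A) = SR INC" "\<not> pnd (AS A)" "cry (AS A)" "AH A = 0" "AG A = 0"
    using assms(1) by (auto simp: at_inc_def)
  obtain k B E' where r: "silent_run w c A k B"
    and B: "\<exists>S'. AS B = finish_job INC S' \<and> q1 S' = q1 (AS A) \<and> q2 S' = q2 (AS A) \<and> s1 S' = s1 (AS A) \<and> i1 S' = i1 (AS A)"
      "AH B = 0" "AG B = 0" "E' \<le> Bnd" "shape (AT B) (AR B) E'" "counter (AT B) E' (Suc n)"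
      "\<forall>j vals h. is_apply_job j \<longrightarrow> track j (AT A) (AR A) E vals h \<longrightarrow> track j (AT B) (AR B) E' vals h"
    using inc_sweep[of A E n Bnd w c] S E assms(2) by blast
  have "ph (AS B) = MHEAD" "q1 (AS B) = st C'" "s1 (AS B) = wt C' (wh C')" "i1 (AS B) = it C' (ih C')"
    "q2 (AS B) = st C" using B(1) assms(1) by (auto simp: finish_job_def at_inc_def)
  moreover have "tracks_Mp B C' E'" "tracks_Mr B C E'"
    using B(7) E(3,4) by (auto simp: tracks_Mp_def tracks_Mr_def)
  ultimately have "at_mhead Bnd B C' C (Suc n)" using B unfolding at_mhead_def by auto
  then show ?thesis using r by blast
qed

end

locale simulation = composite +
  fixes w wp :: "nat list" and c :: "nat \<Rightarrow> bool" and Bnd th :: nat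
  assumes Mr_no_choice: "\<And>t. ch (run Mr w (\<lambda>_. False) t) = 0"
  and Mr_heads_bounded: "\<And>t. wh (run Mr w (\<lambda>_. False) t) < Bnd" "\<And>t. ih (run Mr w (\<lambda>_. False) t) < Bnd"
  and Mp_heads_bounded: "\<And>t. wh (run Mp wp c t) < Bnd" "\<And>t. ih (run Mp wp c t) < Bnd"
  and Mr_halts: "halted Mr (run Mr w (\<lambda>_. False) th)" and Mr_query: "orc (run Mr w (\<lambda>_. False) th) = wp"
  and query_length_bounded: "length wp < 2 ^ Bnd"
begin

abbreviation "Cr t \<equiv> run Mr w (\<lambda>_. False) t"
abbreviation "Cp t \<equiv> run Mp wp c t"

lemma Cr_halted_eq: "halted Mr (Cr t) \<Longrightarrow> Cr t = Cr th"
  by (metis Mr_halts nat_le_linear run_halted_stay)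

lemma orc_Cr_prefix: "t \<le> th \<Longrightarrow> \<exists>zs. wp = orc (Cr t) @ zs"
  using run_orc_prefix[of t th Mr w "\<lambda>_. False"] Mr_query by auto

lemma Cr_step:
  assumes "\<not> halted Mr (Cr t)"
    "delta Mr (st (Cr t)) (inp w (idxval (it (Cr t)))) (wt (Cr t) (wh (Cr t))) (it (Cr t) (ih (Cr t))) None = (q', s', mw, i', mi, mc, ow)"
  shows "Cr (Suc t) = (Cr t)\<lparr>st := q', wt := (wt (Cr t))(wh (Cr t) := s'), wh := mv mw (wh (Cr t)),
            it := (it (Cr t))(ih (Cr t) := i'), ih := mv mi (ih (Cr t)), ch := mv mc (ch (Cr t)),
            orc := orc (Cr t) @ (case ow of None \<Rightarrow> [] | Some b \<Rightarrow> [b])\<rparr>"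
proof -
  have "chsym (\<lambda>_. False) (ch (Cr t)) = None" using Mr_no_choice[of t] by (simp add: chsym_def)
  then show ?thesis using step_unfold[OF assms(1)] assms(2) by (simp add: run_Suc)
qed

lemma not_halted_before: "\<not> halted Mr (Cr t) \<Longrightarrow> t < th"
  using Mr_halts run_halted_stay[of Mr w "\<lambda>_. False" th t] by (cases "t < th") auto

lemma mhead_halted:
  assumes "at_mhead Bnd A C' (Cr t) n" "n = length (orc (Cr t))" "n \<le> idxval (it C')" "halted Mr (Cr t)"
  shows "\<exists>k B. silent_run w c A k B \<and> at_commit Bnd wp B C'"
proof -
  obtain E where E: "E \<le> Bnd" "shape (AT A) (AR A) E" "tracks_Mp A C' E"
    using assms(1) by (auto simp: at_mhead_def)
  have mh: "ph (AS A) = MHEAD" "q1 (AS A) = st C'" "s1 (AS A) = wt C' (wh C')" "i1 (AS A) = it C' (ih C')"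
    "q2 (AS A) = st (Cr t)" "AH A = 0" "AG A = 0" using assms(1) by (auto simp: at_mhead_def)
  have nh: "\<not> halted_state (AS A)" using mh(1) halted_state_phase by simp
  have "orc (Cr t) = wp" using Cr_halted_eq[OF assms(4)] Mr_query by simp
  then have inpN: "inp wp (idxval (it C')) = None" using assms(2,3) by (simp add: inp_def)
  let ?B = "A\<lparr>AS := (AS A)\<lparr>ph := COMMIT, av := 0\<rparr>, AC := mv N (AC A)\<rparr>"
  have aB: "astep w c A = ?B"
    by (rule ctrl_step[OF nh]) (use assms(4) mh in \<open>simp add: adelta_def halted_def\<close>)
  have "silent_run w c A 1 ?B" using silent_run_one[OF nh aB] halted_state_phase by simp
  moreover have "at_commit Bnd wp ?B C'" using mh E inpN by (auto simp: at_commit_def answer_symbol_def tracks_Mp_def)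
  ultimately show ?thesis by blast
qed

lemma mstep_commit:
  assumes "at_mstep Bnd A C' (Cr t) n" "n = length (orc (Cr t))" "\<not> halted Mr (Cr t)"
    "delta Mr (st (Cr t)) (inp w (idxval (it (Cr t)))) (wt (Cr t) (wh (Cr t))) (it (Cr t) (ih (Cr t))) None = (q', s', mw, i', mi, mc, Some b)"
    "n = idxval (it C')"
  shows "\<exists>k B. silent_run w c A k B \<and> at_commit Bnd wp B C'"
proof -
  obtain E where E: "E \<le> Bnd" "shape (AT A) (AR A) E" "tracks_Mp A C' E" "tracks_Mr A (Cr t) E"
    using assms(1) by (auto simp: at_mstep_def)
  have S: "ph (AS A) = MSTEP" "q1 (AS A) = st C'" "s1 (AS A) = wt C' (wh C')" "i1 (AS A) = it C' (ih C')"
    "q2 (AS A) = st (Cr t)" "s2 (AS A) = wt (Cr t) (wh (Cr t))" "i2 (AS A) = it (Cr t) (ih (Cr t))"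
    "eqf (AS A)" "AH A = 0" "AG A = 0"
    using assms(1,5) by (auto simp: at_mstep_def)
  have RA: "AR A = it (Cr t)" using track_AX2_R E(2,4) by (auto simp: tracks_Mr_def)
  have nh: "\<not> halted_state (AS A)" using S(1) halted_state_phase by simp
  let ?B = "A\<lparr>AS := (AS A)\<lparr>ph := COMMIT, av := Suc b\<rparr>, AC := mv N (AC A)\<rparr>"
  have aB: "astep w c A = ?B"
    by (rule ctrl_step[OF nh]) (use S assms(4) RA in \<open>simp add: adelta_def\<close>)
  have r: "silent_run w c A 1 ?B" using silent_run_one[OF nh aB] halted_state_phase by simp
  have "Suc t \<le> th" using not_halted_before[OF assms(3)] by simp
  then obtain zs where "wp = orc (Cr (Suc t)) @ zs" using orc_Cr_prefix by blast
  then have "wp = orc (Cr t) @ [b] @ zs" using Cr_step[OF assms(3,4)] by simp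
  then have "inp wp (idxval (it C')) = Some b" using assms(2,5) by (simp add: inp_def nth_append)
  then have "at_commit Bnd wp ?B C'" using S E by (auto simp: at_commit_def answer_symbol_def tracks_Mp_def)
  then show ?thesis using r by blast
qed

lemma mstep_apply:
  assumes "at_mstep Bnd A C' (Cr t) n" "\<not> halted Mr (Cr t)"
    "delta Mr (st (Cr t)) (inp w (idxval (it (Cr t)))) (wt (Cr t) (wh (Cr t))) (it (Cr t) (ih (Cr t))) None = (q', s', mw, i', mi, mc, ow)"
    "\<not> (\<exists>b. ow = Some b \<and> n = idxval (it C'))"
  shows "\<exists>k B. silent_run w c A k B \<and>
    (if ow = None then at_mhead Bnd B C' (Cr (Suc t)) n else at_inc Bnd B C' (Cr (Suc t)) n)"
proof -
  obtain E where E: "E \<le> Bnd" "shape (AT A) (AR A) E" "tracks_Mp A C' E" "tracks_Mr A (Cr t) E" "counter (AT A) E n"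
    using assms(1) by (auto simp: at_mstep_def)
  have S: "ph (AS A) = MSTEP" "q1 (AS A) = st C'" "s1 (AS A) = wt C' (wh C')" "i1 (AS A) = it C' (ih C')"
    "q2 (AS A) = st (Cr t)" "s2 (AS A) = wt (Cr t) (wh (Cr t))" "i2 (AS A) = it (Cr t) (ih (Cr t))"
    "eqf (AS A) = (n = idxval (it C'))" "AH A = 0" "AG A = 0"
    using assms(1) by (auto simp: at_mstep_def)
  have trW2: "track AW2 (AT A) (AR A) E (wt (Cr t)) (wh (Cr t))" and trX2: "track AX2 (AT A) (AR A) E (it (Cr t)) (ih (Cr t))"
    using E(4) by (auto simp: tracks_Mr_def)
  have RA: "AR A = it (Cr t)" using track_AX2_R[OF trX2 E(2)] .
  have nh: "\<not> halted_state (AS A)" using S(1) halted_state_phase by simp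
  let ?inc = "ow \<noteq> None"
  let ?S5 = "start_job AW2 ((AS A)\<lparr>q2 := q', wv2 := s', wm2 := mw, xv2 := i', xm2 := mi, inc := ?inc\<rparr>)"
  let ?A5 = "A\<lparr>AS := ?S5, AC := mv N (AC A)\<rparr>"
  have a5: "astep w c A = ?A5"
    by (rule ctrl_step[OF nh]) (use S assms(3,4) RA in \<open>auto simp: adelta_def split: option.splits\<close>)
  have r5: "silent_run w c A 1 ?A5" using silent_run_one[OF nh a5] halted_state_phase by simp
  have Cs: "wh (Cr (Suc t)) = mv mw (wh (Cr t))" "ih (Cr (Suc t)) = mv mi (ih (Cr t))"
    "wt (Cr (Suc t)) = (wt (Cr t))(wh (Cr t) := s')" "it (Cr (Suc t)) = (it (Cr t))(ih (Cr t) := i')"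
    "st (Cr (Suc t)) = q'" using Cr_step[OF assms(2,3)] by simp_all
  obtain k6 A6 E6 where r6: "silent_run w c ?A5 k6 A6" and ap6: "apply_result AW2 ?A5 A6 E E6 (wt (Cr t)) (wh (Cr t))"
    using apply_sweep[of ?A5 AW2 E "wt (Cr t)" "wh (Cr t)" w c] trW2 E(2) S by auto
  obtain P6 D6 where S6: "AS A6 = finish_job AW2 (?S5\<lparr>ph := SL AW2, pnd := P6, dn := D6\<rparr>)"
    using ap6 by (auto simp: apply_result_def)
  have E6: "E6 = max E (Suc (wh (Cr (Suc t))))" "shape (AT A6) (AR A6) E6" "AH A6 = 0" "AG A6 = 0"
    "track AW2 (AT A6) (AR A6) E6 (wt (Cr (Suc t))) (wh (Cr (Suc t)))"
    using ap6 Cs by (auto simp: apply_result_def)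
  have E6b: "E6 \<le> Bnd" using E6(1) E(1) Mr_heads_bounded(1)[of "Suc t"] by simp
  have fr6: "track j' (AT A6) (AR A6) E6 vals' h'" if "is_apply_job j'" "j' \<noteq> AW2" "track j' (AT A) (AR A) E vals' h'" for j' vals' h'
    using ap6 that by (auto simp: apply_result_def)
  have ct6: "counter (AT A6) E6 n" using ap6 E(5) by (auto simp: apply_result_def)
  have S6f: "ph (AS A6) = SR AX2" "\<not> pnd (AS A6)" "\<not> dn (AS A6)" "job_value AX2 (AS A6) = i'" "job_move AX2 (AS A6) = mi"
    "inc (AS A6) = ?inc" "q1 (AS A6) = st C'" "s1 (AS A6) = wt C' (wh C')" "i1 (AS A6) = it C' (ih C')" "q2 (AS A6) = q'"
    using S6 S by (simp_all add: finish_job_def)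
  have tr6: "track AX2 (AT A6) (AR A6) E6 (it (Cr t)) (ih (Cr t))" using fr6[OF _ _ trX2] by simp
  obtain k7 A7 E7 where r7: "silent_run w c A6 k7 A7" and ap7: "apply_result AX2 A6 A7 E6 E7 (it (Cr t)) (ih (Cr t))"
    using apply_sweep[of A6 AX2 E6 "it (Cr t)" "ih (Cr t)" w c] tr6 E6 S6f by auto
  obtain P7 D7 where S7: "AS A7 = finish_job AX2 ((AS A6)\<lparr>ph := SL AX2, pnd := P7, dn := D7\<rparr>)"
    using ap7 by (auto simp: apply_result_def)
  have E7: "E7 = max E6 (Suc (ih (Cr (Suc t))))" "shape (AT A7) (AR A7) E7" "AH A7 = 0" "AG A7 = 0"
    "track AX2 (AT A7) (AR A7) E7 (it (Cr (Suc t))) (ih (Cr (Suc t)))"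
    using ap7 Cs S6f by (auto simp: apply_result_def)
  have E7b: "E7 \<le> Bnd" using E7(1) E6b Mr_heads_bounded(2)[of "Suc t"] by simp
  have fr7: "track j' (AT A7) (AR A7) E7 vals' h'" if "is_apply_job j'" "j' \<noteq> AX2" "track j' (AT A6) (AR A6) E6 vals' h'" for j' vals' h'
    using ap7 that by (auto simp: apply_result_def)
  have ct7: "counter (AT A7) E7 n" using ap7 ct6 by (auto simp: apply_result_def)
  have tracks7: "tracks_Mp A7 C' E7" "tracks_Mr A7 (Cr (Suc t)) E7"
    using fr7 fr6 E(3) fr7[OF _ _ E6(5)] E7(5) by (simp_all add: tracks_Mp_def tracks_Mr_def)
  have "if ow = None then at_mhead Bnd A7 C' (Cr (Suc t)) n else at_inc Bnd A7 C' (Cr (Suc t)) n"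
  proof (cases ow)
    case None
    have "ph (AS A7) = MHEAD" "q1 (AS A7) = st C'" "s1 (AS A7) = wt C' (wh C')" "i1 (AS A7) = it C' (ih C')"
      "q2 (AS A7) = st (Cr (Suc t))" using S7 S6f None Cs by (simp_all add: finish_job_def)
    then have "at_mhead Bnd A7 C' (Cr (Suc t)) n"
      using E7 E7b tracks7 ct7 unfolding at_mhead_def by blast
    then show ?thesis using None by simp
  next
    case (Some b)
    have "ph (AS A7) = SR INC" "\<not> pnd (AS A7)" "cry (AS A7)" "q1 (AS A7) = st C'" "s1 (AS A7) = wt C' (wh C')"
      "i1 (AS A7) = it C' (ih C')" "q2 (AS A7) = st (Cr (Suc t))" using S7 S6f Some Cs by (simp_all add: finish_job_def)
    then have "at_inc Bnd A7 C' (Cr (Suc t)) n"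
      using E7 E7b tracks7 ct7 unfolding at_inc_def by blast
    then show ?thesis using Some by simp
  qed
  then show ?thesis using silent_run_trans[OF silent_run_trans[OF r5 r6] r7] by blast
qed

lemma mstep_to_mhead:
  assumes "at_mstep Bnd A C' (Cr t) n" "n = length (orc (Cr t))" "\<not> halted Mr (Cr t)"
    "delta Mr (st (Cr t)) (inp w (idxval (it (Cr t)))) (wt (Cr t) (wh (Cr t))) (it (Cr t) (ih (Cr t))) None = (q', s', mw, i', mi, mc, ow)"
    "\<not> (\<exists>b. ow = Some b \<and> n = idxval (it C'))"
  shows "\<exists>k B. silent_run w c A k B \<and> at_mhead Bnd B C' (Cr (Suc t)) (length (orc (Cr (Suc t))))"
proof -
  obtain k1 A1 where r1: "silent_run w c A k1 A1"
    and A1: "if ow = None then at_mhead Bnd A1 C' (Cr (Suc t)) n else at_inc Bnd A1 C' (Cr (Suc t)) n"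
    using mstep_apply[OF assms(1,3,4,5)] by blast
  have orc: "orc (Cr (Suc t)) = orc (Cr t) @ (case ow of None \<Rightarrow> [] | Some b \<Rightarrow> [b])"
    using Cr_step[OF assms(3,4)] by simp
  show ?thesis
  proof (cases ow)
    case None
    then show ?thesis using r1 A1 orc assms(2) by auto
  next
    case (Some b)
    have len: "length (orc (Cr (Suc t))) = Suc n" using orc Some assms(2) by simp
    have "Suc t \<le> th" using not_halted_before[OF assms(3)] by simp
    then have "length (orc (Cr (Suc t))) \<le> length wp" using orc_Cr_prefix by fastforce
    then have "Suc n < 2 ^ Bnd" using len query_length_bounded by linarith
    then obtain k2 B where "silent_run w c A1 k2 B" "at_mhead Bnd B C' (Cr (Suc t)) (Suc n)"
      using inc_to_mhead A1 Some by fastforce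
    then show ?thesis using silent_run_trans[OF r1] len by metis
  qed
qed

lemma query_symbol_search:
  assumes "at_mhead Bnd A C' (Cr t) n" "n = length (orc (Cr t))" "n \<le> idxval (it C')"
  shows "\<exists>k B. silent_run w c A k B \<and> at_commit Bnd wp B C'"
  using assms
proof (induction "th - t" arbitrary: t A n rule: less_induct)
  case less
  show ?case
  proof (cases "halted Mr (Cr t)")
    case True
    then show ?thesis using mhead_halted less.prems by blast
  next
    case running: False
    obtain k1 A1 where r1: "silent_run w c A k1 A1" and A1: "at_mstep Bnd A1 C' (Cr t) n"
      using mhead_to_mstep[OF less.prems(1) running] by blast
    obtain q' s' mw i' mi mc ow where d:
      "delta Mr (st (Cr t)) (inp w (idxval (it (Cr t)))) (wt (Cr t) (wh (Cr t))) (it (Cr t) (ih (Cr t))) None = (q', s', mw, i', mi, mc, ow)"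
      by (metis prod_cases7)
    show ?thesis
    proof (cases "\<exists>b. ow = Some b \<and> n = idxval (it C')")
      case True
      then obtain b where b: "ow = Some b" "n = idxval (it C')" by blast
      obtain k2 B where "silent_run w c A1 k2 B" "at_commit Bnd wp B C'"
        using mstep_commit[OF A1 less.prems(2) running d[unfolded b(1)] b(2)] by blast
      then show ?thesis using silent_run_trans[OF r1] by blast
    next
      case False
      obtain k2 A2 where r2: "silent_run w c A1 k2 A2"
        and A2: "at_mhead Bnd A2 C' (Cr (Suc t)) (length (orc (Cr (Suc t))))"
        using mstep_to_mhead[OF A1 less.prems(2) running d False] by blast
      have "length (orc (Cr (Suc t))) \<le> idxval (it C')"
        using Cr_step[OF running d] less.prems(2,3) False by (cases ow) auto
      moreover have "th - Suc t < th - t" using not_halted_before[OF running] by simp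
      ultimately obtain k3 B where "silent_run w c A2 k3 B" "at_commit Bnd wp B C'"
        using less.hyps[of "Suc t" A2 "length (orc (Cr (Suc t)))"] A2 by blast
      then show ?thesis using silent_run_trans[OF silent_run_trans[OF r1 r2]] by blast
    qed
  qed
qed

end

section \<open>Simulating a step of P\<close>

definition at_top :: "nat \<Rightarrow> acfg \<Rightarrow> cfg \<Rightarrow> bool" where
 "at_top Bnd A C' \<longleftrightarrow> ph (AS A) = TOP \<and> q1 (AS A) = st C' \<and> AH A = 0 \<and> AG A = 0 \<and> AC A = ch C'
   \<and> (\<exists>E. E \<le> Bnd \<and> shape (AT A) (AR A) E \<and> tracks_Mp A C' E)"

context simulation begin

lemma Cp_step:
  assumes "\<not> halted Mp (Cp t)"
    "delta Mp (st (Cp t)) (inp wp (idxval (it (Cp t)))) (wt (Cp t) (wh (Cp t))) (it (Cp t) (ih (Cp t))) (chsym c (ch (Cp t))) = (q', s', mw, i', mi, mc, ow)"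
  shows "Cp (Suc t) = (Cp t)\<lparr>st := q', wt := (wt (Cp t))(wh (Cp t) := s'), wh := mv mw (wh (Cp t)),
            it := (it (Cp t))(ih (Cp t) := i'), ih := mv mi (ih (Cp t)), ch := mv mc (ch (Cp t)),
            orc := orc (Cp t) @ (case ow of None \<Rightarrow> [] | Some b \<Rightarrow> [b])\<rparr>"
  using step_unfold[OF assms(1) assms(2)] by (simp add: run_Suc)

lemma top_to_mhead:
  assumes "at_top Bnd A C'" "\<not> halted Mp C'"
  shows "\<exists>k B. silent_run w c A k B \<and> at_mhead Bnd B C' init_cfg 0"
proof -
  let ?S = "AS A"
  obtain E where E: "E \<le> Bnd" "shape (AT A) (AR A) E" "tracks_Mp A C' E" using assms(1) by (auto simp: at_top_def)
  have tp: "ph ?S = TOP" "q1 ?S = st C'" "AH A = 0" "AG A = 0" using assms(1) by (auto simp: at_top_def)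
  have nh: "\<not> halted_state ?S" using tp(1) halted_state_phase by simp
  have trW: "track AW1 (AT A) (AR A) E (wt C') (wh C')" and trX: "track AX1 (AT A) (AR A) E (it C') (ih C')"
    using E(3) by (auto simp: tracks_Mp_def)
  let ?A1 = "A\<lparr>AS := start_job GW1 ?S, AC := mv N (AC A)\<rparr>"
  have a1: "astep w c A = ?A1"
    by (rule ctrl_step[OF nh]) (use assms(2) tp in \<open>simp add: adelta_def halted_def\<close>)
  have r1: "silent_run w c A 1 ?A1" using silent_run_one[OF nh a1] halted_state_phase by simp
  let ?A2 = "?A1\<lparr>AS := finish_job GW1 (gather_update GW1 ((AS ?A1)\<lparr>ph := SL GW1, pnd := False, dn := False\<rparr>) (wt C' (wh C')))\<rparr>"
  have r2: "silent_run w c ?A1 (Suc E + E) ?A2"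
    by (rule gather_sweep) (use tp E trW in auto)
  let ?A3 = "?A2\<lparr>AS := finish_job GX1 (gather_update GX1 ((AS ?A2)\<lparr>ph := SL GX1, pnd := False, dn := False\<rparr>) (it C' (ih C')))\<rparr>"
  have r3: "silent_run w c ?A2 (Suc E + E) ?A3"
    by (rule gather_sweep) (use tp E trX in \<open>auto simp: finish_job_def\<close>)
  have S3: "ph (AS ?A3) = SR RST" "\<not> pnd (AS ?A3)" by (simp_all add: finish_job_def)
  obtain k4 A4 where r4: "silent_run w c ?A3 k4 A4"
    and A4: "AS A4 = finish_job RST ((AS ?A3)\<lparr>ph := SL RST, pnd := False, dn := False\<rparr>)" "AH A4 = 0" "AG A4 = 0"
      "AR A4 = (\<lambda>_. 0)" "\<forall>i. AT A4 i = (if i < E then Some (reset_cell (the (AT A i))) else None)"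
    using rst_sweep[of ?A3 E w c] S3 tp E by auto
  have E0: "0 < E" using shape_pos[OF E(2)] .
  have sh4: "shape (AT A4) (AR A4) E"
    by (rule shapeI) (use A4 shape_org[OF E(2)] E0 in \<open>auto simp: reset_cell_def\<close>)
  have keep4: "keeps_track j (the (AT A i)) (the (AT A4 i)) (AR A i) (AR A4 i)" if "j = AW1 \<or> j = AX1" "i < E" for j i
    using that A4(5) by (auto simp: keeps_track_def reset_cell_def)
  have "tracks_Mp A4 C' E"
    unfolding tracks_Mp_def using track_mono[OF trW order_refl keep4] track_mono[OF trX order_refl keep4] by auto
  moreover have "tracks_Mr A4 init_cfg E"
    using A4(4,5) shape_org[OF E(2)] E0 by (auto simp: tracks_Mr_def track_def reset_cell_def init_cfg_def)
  moreover have "counter (AT A4) E 0" using A4(5) by (auto simp: counter_def reset_cell_def)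
  ultimately have "at_mhead Bnd A4 C' init_cfg 0"
    unfolding at_mhead_def using A4 sh4 E(1) tp by (auto simp: finish_job_def init_cfg_def)
  then show ?thesis using silent_run_trans[OF silent_run_trans[OF silent_run_trans[OF r1 r2] r3] r4] by blast
qed

lemma commit_to_top:
  assumes "at_commit Bnd wp B (Cp t')" "AC B = ch (Cp t')" "\<not> halted Mp (Cp t')"
  shows "\<exists>k A'. silent_run w c (astep w c B) k A' \<and> AC (astep w c B) = ch (Cp (Suc t'))
    \<and> at_top Bnd A' (Cp (Suc t'))"
proof -
  let ?C = "Cp t'"
  have cm: "ph (AS B) = COMMIT" "q1 (AS B) = st ?C" "s1 (AS B) = wt ?C (wh ?C)" "i1 (AS B) = it ?C (ih ?C)"
    "answer_symbol (av (AS B)) = inp wp (idxval (it ?C))" "AH B = 0" "AG B = 0"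
    using assms(1) by (auto simp: at_commit_def)
  obtain EB where EB: "EB \<le> Bnd" "shape (AT B) (AR B) EB" "tracks_Mp B ?C EB" using assms(1) by (auto simp: at_commit_def)
  have nhB: "\<not> halted_state (AS B)" using cm(1) halted_state_phase by simp
  obtain q' s' mw i' mi mc ow where d:
    "delta Mp (st ?C) (inp wp (idxval (it ?C))) (wt ?C (wh ?C)) (it ?C (ih ?C)) (chsym c (ch ?C)) = (q', s', mw, i', mi, mc, ow)"
    by (metis prod_cases7)
  have Cs: "wh (Cp (Suc t')) = mv mw (wh ?C)" "ih (Cp (Suc t')) = mv mi (ih ?C)"
    "wt (Cp (Suc t')) = (wt ?C)(wh ?C := s')" "it (Cp (Suc t')) = (it ?C)(ih ?C := i')"
    "st (Cp (Suc t')) = q'" "ch (Cp (Suc t')) = mv mc (ch ?C)" using Cp_step[OF assms(3) d] by simp_all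
  let ?S5 = "start_job AW1 ((AS B)\<lparr>q1 := q', wv1 := s', wm1 := mw, xv1 := i', xm1 := mi\<rparr>)"
  let ?B' = "B\<lparr>AS := ?S5, AC := mv mc (AC B)\<rparr>"
  have aB: "astep w c B = ?B'"
    by (rule ctrl_step[OF nhB]) (use cm d assms(2) in \<open>simp add: adelta_def\<close>)
  have acB': "AC (astep w c B) = ch (Cp (Suc t'))" using aB assms(2) Cs by simp
  have trW5: "track AW1 (AT ?B') (AR ?B') EB (wt ?C) (wh ?C)" and trX5: "track AX1 (AT ?B') (AR ?B') EB (it ?C) (ih ?C)"
    using EB(3) by (auto simp: tracks_Mp_def)
  obtain k6 A6 E6 where r6: "silent_run w c ?B' k6 A6" and ap6: "apply_result AW1 ?B' A6 EB E6 (wt ?C) (wh ?C)"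
    using apply_sweep[of ?B' AW1 EB "wt ?C" "wh ?C" w c] trW5 EB cm by auto
  obtain P6 D6 where S6: "AS A6 = finish_job AW1 (?S5\<lparr>ph := SL AW1, pnd := P6, dn := D6\<rparr>)"
    using ap6 by (auto simp: apply_result_def)
  have E6: "E6 = max EB (Suc (wh (Cp (Suc t'))))" "shape (AT A6) (AR A6) E6" "AH A6 = 0" "AG A6 = 0"
    "track AW1 (AT A6) (AR A6) E6 (wt (Cp (Suc t'))) (wh (Cp (Suc t')))"
    using ap6 Cs by (auto simp: apply_result_def)
  have E6b: "E6 \<le> Bnd" using E6(1) EB(1) Mp_heads_bounded(1)[of "Suc t'"] by simp
  have tr6: "track AX1 (AT A6) (AR A6) E6 (it ?C) (ih ?C)" using ap6 trX5 by (auto simp: apply_result_def)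
  have S6f: "ph (AS A6) = SR AX1" "\<not> pnd (AS A6)" "\<not> dn (AS A6)" "job_value AX1 (AS A6) = i'" "job_move AX1 (AS A6) = mi"
    "q1 (AS A6) = q'" using S6 by (simp_all add: finish_job_def)
  obtain k7 A7 E7 where r7: "silent_run w c A6 k7 A7" and ap7: "apply_result AX1 A6 A7 E6 E7 (it ?C) (ih ?C)"
    using apply_sweep[of A6 AX1 E6 "it ?C" "ih ?C" w c] tr6 E6 S6f by auto
  obtain P7 D7 where S7: "AS A7 = finish_job AX1 ((AS A6)\<lparr>ph := SL AX1, pnd := P7, dn := D7\<rparr>)"
    using ap7 by (auto simp: apply_result_def)
  have E7: "E7 = max E6 (Suc (ih (Cp (Suc t'))))" "shape (AT A7) (AR A7) E7" "AH A7 = 0" "AG A7 = 0"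
    "track AX1 (AT A7) (AR A7) E7 (it (Cp (Suc t'))) (ih (Cp (Suc t')))"
    using ap7 Cs S6f by (auto simp: apply_result_def)
  have E7b: "E7 \<le> Bnd" using E7(1) E6b Mp_heads_bounded(2)[of "Suc t'"] by simp
  have tr7: "track AW1 (AT A7) (AR A7) E7 (wt (Cp (Suc t'))) (wh (Cp (Suc t')))" using ap7 E6(5) by (auto simp: apply_result_def)
  have r57: "silent_run w c ?B' (k6 + k7) A7" by (rule silent_run_trans[OF r6 r7])
  have ac7: "AC A7 = ch (Cp (Suc t'))" using r57 acB' aB by (auto simp: silent_run_def)
  have ex7: "\<exists>E. E \<le> Bnd \<and> shape (AT A7) (AR A7) E \<and> tracks_Mp A7 (Cp (Suc t')) E"
    using E7(2,5) E7b tr7 unfolding tracks_Mp_def by blast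
  have "at_top Bnd A7 (Cp (Suc t'))"
    unfolding at_top_def using S7 S6f Cs E7 ex7 ac7 by (simp add: finish_job_def)
  then show ?thesis using r57 aB acB' by metis
qed

lemma top_step:
  assumes "at_top Bnd A (Cp t')" "\<not> halted Mp (Cp t')"
  shows "\<exists>k1 B k2 A'. silent_run w c A k1 B \<and> silent_run w c (astep w c B) k2 A' \<and> AC (astep w c B) = ch (Cp (Suc t'))
     \<and> at_top Bnd A' (Cp (Suc t'))"
proof -
  obtain k1 A1 where r1: "silent_run w c A k1 A1" and mh: "at_mhead Bnd A1 (Cp t') (Cr 0) 0"
    using top_to_mhead[OF assms] by auto
  obtain k2 B where r2: "silent_run w c A1 k2 B" and cB: "at_commit Bnd wp B (Cp t')"
    using query_symbol_search[OF mh] by (auto simp: init_cfg_def)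
  have r: "silent_run w c A (k1 + k2) B" by (rule silent_run_trans[OF r1 r2])
  then have "AC B = ch (Cp t')" using assms(1) by (auto simp: silent_run_def at_top_def)
  then show ?thesis using commit_to_top[OF cB _ assms(2)] r by blast
qed

lemma init_top:
  assumes "0 < Bnd"
  shows "at_top Bnd (astep w c A0) (Cp 0) \<and> \<not> halted_state (AS A0)"
proof -
  have nh: "\<not> halted_state (AS A0)" using halted_state_phase by (simp add: A0_def S0_def)
  have a: "astep w c A0 = A0\<lparr>AS := S0\<lparr>ph := TOP\<rparr>, AT := (\<lambda>_. None)(0 := Some initial_cell), AR := (\<lambda>_. 0)\<rparr>"
    using nh by (simp add: astep_def adelta_def A0_def S0_def fun_eq_iff)
  have sh: "shape ((\<lambda>_. None)(0 := Some initial_cell)) (\<lambda>_. 0) 1"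
    by (rule shapeI) (auto simp: initial_cell_def blank_cell_def)
  have r: "tracks_Mp (astep w c A0) (Cp 0) 1" unfolding a
    by (auto simp: tracks_Mp_def track_def init_cfg_def initial_cell_def blank_cell_def A0_def)
  have e: "\<exists>E. E \<le> Bnd \<and> shape (AT (astep w c A0)) (AR (astep w c A0)) E \<and> tracks_Mp (astep w c A0) (Cp 0) E"
    using r sh assms a by (intro exI[of _ 1]) simp
  have "at_top Bnd (astep w c A0) (Cp 0)"
    unfolding at_top_def using e a by (simp add: A0_def S0_def init_cfg_def)
  then show ?thesis using nh by simp
qed

lemma top_halt:
  assumes "at_top Bnd A (Cp t')" "halted Mp (Cp t')"
  shows "astep w c A = A\<lparr>AS := (if st (Cp t') = accst Mp then ACCs else REJs), AC := mv N (AC A)\<rparr>"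
proof -
  have nh: "\<not> halted_state (AS A)" using assms(1) halted_state_phase by (simp add: at_top_def)
  show ?thesis
    by (rule ctrl_step[OF nh]) (use assms in \<open>auto simp: adelta_def halted_def at_top_def\<close>)
qed

end

section \<open>Correctness of the simulation\<close>

definition head_inv :: "acfg \<Rightarrow> nat \<Rightarrow> bool" where
  "head_inv A E \<longleftrightarrow> (\<forall>i. (AT A i \<noteq> None) = (i < E)) \<and> AH A \<le> E \<and> AG A = AH A"

lemma right_step_dom: "right_step j S co r = (S', co', r', b) \<Longrightarrow> (co \<noteq> None \<longrightarrow> co' \<noteq> None) \<and> (b \<longrightarrow> co' \<noteq> None)"
  by (auto simp: right_step_def split: option.splits job.splits if_splits prod.splits)

lemma left_step_dom: "left_step j S co r = (S', co', r') \<Longrightarrow> (co \<noteq> None \<longrightarrow> co' \<noteq> None)"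
  by (auto simp: left_step_def split: option.splits if_splits)

context composite begin

lemma adelta_dom:
  assumes "adelta S a co r ch0 = (S', co', r', mw, mi, mc)"
  shows "mi = mw \<and> (co \<noteq> None \<longrightarrow> co' \<noteq> None) \<and> (mw = R \<longrightarrow> co' \<noteq> None)"
proof (cases "ph S")
  case (SR j)
  obtain S1 co1 r1 b where d: "right_step j S co r = (S1, co1, r1, b)" by (metis prod_cases4)
  show ?thesis using assms SR d right_step_dom[OF d] by (auto simp: adelta_def split: if_splits)
next
  case (SL j)
  obtain S1 co1 r1 where d: "left_step j S co r = (S1, co1, r1)" by (metis prod_cases3)
  show ?thesis using assms SL d left_step_dom[OF d] by (auto simp: adelta_def split: if_splits)
next
  case MSTEP then show ?thesis using assms by (auto simp: adelta_def split: if_splits prod.splits option.splits)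
next
  case COMMIT then show ?thesis using assms by (auto simp: adelta_def split: if_splits prod.splits option.splits)
qed (use assms in \<open>auto simp: adelta_def split: if_splits\<close>)

lemma head_inv_step:
  assumes "head_inv A E"
  shows "\<exists>E'. E \<le> E' \<and> head_inv (astep w c A) E'"
proof (cases "halted_state (AS A)")
  case True then show ?thesis using assms by (auto simp: astep_def)
next
  case False
  obtain S' co r' mw mi mc where d: "adelta (AS A) (inp w (idxval (AR A))) (AT A (AH A)) (AR A (AG A)) (chsym c (AC A)) = (S', co, r', mw, mi, mc)"
    by (metis prod_cases6)
  have dd: "mi = mw" "AT A (AH A) \<noteq> None \<longrightarrow> co \<noteq> None" "mw = R \<longrightarrow> co \<noteq> None" using adelta_dom[OF d] by auto
  have a: "astep w c A = A\<lparr>AS := S', AT := (AT A)(AH A := co), AH := mv mw (AH A), AR := (AR A)(AG A := r'),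
           AG := mv mi (AG A), AC := mv mc (AC A)\<rparr>" using False d by (simp add: astep_def)
  have h: "\<forall>i. (AT A i \<noteq> None) = (i < E)" "AH A \<le> E" "AG A = AH A" using assms by (auto simp: head_inv_def)
  show ?thesis
  proof (cases "AH A < E")
    case True
    then have "co \<noteq> None" using h dd by auto
    then have "head_inv (astep w c A) E" using a h dd True by (cases mw) (auto simp: head_inv_def)
    then show ?thesis by blast
  next
    case False
    then have HE: "AH A = E" using h by simp
    show ?thesis
    proof (cases co)
      case None
      then have "head_inv (astep w c A) E" using a h dd HE by (cases mw) (auto simp: head_inv_def)
      then show ?thesis by blast
    next
      case (Some x)
      then have "head_inv (astep w c A) (Suc E)" using a h dd HE by (cases mw) (auto simp: head_inv_def less_Suc_eq)
      then show ?thesis by (intro exI[of _ "Suc E"]) simp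
    qed
  qed
qed

lemma dom_step: "AT A i \<noteq> None \<Longrightarrow> AT (astep w c A) i \<noteq> None"
proof (cases "halted_state (AS A)")
  case True then show "AT A i \<noteq> None \<Longrightarrow> ?thesis" by (simp add: astep_def)
next
  case False
  assume ai: "AT A i \<noteq> None"
  obtain S' co r' mw mi mc where d: "adelta (AS A) (inp w (idxval (AR A))) (AT A (AH A)) (AR A (AG A)) (chsym c (AC A)) = (S', co, r', mw, mi, mc)"
    by (metis prod_cases6)
  show ?thesis using adelta_dom[OF d] False d ai by (auto simp: astep_def)
qed

lemma arun_Suc: "arun w c (Suc t) = astep w c (arun w c t)" by (simp add: arun_def)
lemma arun_add: "arun w c (t + s) = (astep w c ^^ s) (arun w c t)" by (simp add: arun_def funpow_add add.commute)

lemma head_inv_arun: "\<exists>E. head_inv (arun w c t) E"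
proof (induction t)
  case 0 then show ?case by (intro exI[of _ 0]) (simp add: head_inv_def arun_def A0_def)
next
  case (Suc t) then show ?case using head_inv_step by (metis arun_Suc)
qed

lemma dom_arun: "t \<le> t' \<Longrightarrow> AT (arun w c t) i \<noteq> None \<Longrightarrow> AT (arun w c t') i \<noteq> None"
proof (induction t' rule: dec_induct)
  case base then show ?case by simp
next
  case (step n) then show ?case using dom_step by (simp add: arun_Suc)
qed

lemma head_bound:
  assumes "t \<le> T" "shape (AT (arun w c T)) Rx E"
  shows "AH (arun w c t) \<le> E \<and> AG (arun w c t) = AH (arun w c t)"
proof -
  obtain E0 where h: "head_inv (arun w c t) E0" using head_inv_arun by blast
  have "E0 \<le> E"
  proof (rule ccontr)
    assume "\<not> E0 \<le> E"
    then have "AT (arun w c t) E \<noteq> None" using h by (simp add: head_inv_def)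
    then have "AT (arun w c T) E \<noteq> None" using dom_arun[OF assms(1)] by blast
    then show False using shape_dom[OF assms(2), of E] by simp
  qed
  then show ?thesis using h by (auto simp: head_inv_def)
qed

lemma silent_run_arun:
  assumes "silent_run w c (arun w c T) k B" "s \<le> k"
  shows "AC (arun w c (T + s)) = AC (arun w c T) \<and> \<not> halted_state (AS (arun w c (T + s)))"
  using assms by (simp add: silent_run_def arun_add)

lemma silent_run_arun_end: "silent_run w c (arun w c T) k B \<Longrightarrow> arun w c (T + k) = B"
  by (simp add: silent_run_def arun_add)

end

context simulation begin

lemma Bnd_pos: "0 < Bnd" using Mp_heads_bounded(1)[of 0] by simp

abbreviation "K t \<equiv> arun w c t"

text \<open>At composite time \<open>T\<close> the simulation has reached step \<open>t'\<close> of P; meanwhile the composite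
  choice head has visited only positions of P's choice head and moved only along with it.\<close>

definition top_sync :: "nat \<Rightarrow> nat \<Rightarrow> bool" where
  "top_sync t' T \<longleftrightarrow> t' < T \<and> at_top Bnd (K T) (Cp t') \<and> (\<forall>s\<le>T. \<not> halted_state (AS (K s)))
    \<and> (\<forall>s\<le>T. \<exists>s'\<le>t'. AC (K s) = ch (Cp s')) \<and> (\<forall>s'\<le>t'. \<exists>s\<le>T. AC (K s) = ch (Cp s'))
    \<and> (\<forall>s<T. AC (K (Suc s)) = AC (K s) \<or> (\<exists>s'<t'. AC (K s) = ch (Cp s') \<and> AC (K (Suc s)) = ch (Cp (Suc s'))))"

lemma top_sync_0: "top_sync 0 1"
proof -
  have it: "at_top Bnd (astep w c A0) (Cp 0)" "\<not> halted_state (AS A0)" using init_top[OF Bnd_pos] by auto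
  have K1: "K 1 = astep w c A0" by (simp add: arun_def)
  have K0: "K 0 = A0" by (simp add: arun_def)
  have ac: "AC (K 0) = 0" "AC (K 1) = 0" "ch (Cp 0) = 0"
    using it K1 by (auto simp: K0 A0_def at_top_def init_cfg_def)
  have nh1: "\<not> halted_state (AS (K 1))" using it K1 halted_state_phase by (simp add: at_top_def)
  show "top_sync 0 1"
    unfolding top_sync_def
  proof (intro conjI allI impI)
    show "at_top Bnd (K 1) (Cp 0)" using it K1 by simp
    fix s assume "s \<le> (1::nat)" then have "s = 0 \<or> s = 1" by auto
    then show "\<not> halted_state (AS (K s))" using it nh1 K0 by auto
  next
    fix s assume "s \<le> (1::nat)" then have "s = 0 \<or> s = 1" by auto
    then show "\<exists>s'\<le>0. AC (K s) = ch (Cp s')" using ac by auto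
  next
    fix s' :: nat assume "s' \<le> 0" then show "\<exists>s\<le>1. AC (K s) = ch (Cp s')" using ac by (intro exI[of _ 0]) auto
  next
    fix s :: nat assume "s < 1" then show "AC (K (Suc s)) = AC (K s) \<or> (\<exists>s'<0. AC (K s) = ch (Cp s') \<and> AC (K (Suc s)) = ch (Cp (Suc s')))"
      using ac by auto
  qed simp
qed

lemma top_sync_Suc:
  assumes T: "top_sync t' T" and nh: "\<not> halted Mp (Cp t')"
  shows "\<exists>T'. top_sync (Suc t') T'"
proof -
  have tp: "at_top Bnd (K T) (Cp t')" using T by (simp add: top_sync_def)
  obtain k1 B k2 A' where r1: "silent_run w c (K T) k1 B" and r2: "silent_run w c (astep w c B) k2 A'"
    and acB: "AC (astep w c B) = ch (Cp (Suc t'))" and tpA: "at_top Bnd A' (Cp (Suc t'))"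
    using top_step[OF tp nh] by blast
  have KB: "K (T + k1) = B" using silent_run_arun_end[OF r1] .
  have KB1: "K (Suc (T + k1)) = astep w c B" using KB by (simp add: arun_Suc)
  have r2': "silent_run w c (K (Suc (T + k1))) k2 A'" using r2 KB1 by simp
  have KA: "K (Suc (T + k1) + k2) = A'" using silent_run_arun_end[OF r2'] .
  let ?T' = "Suc (T + k1) + k2"
  have acT: "AC (K T) = ch (Cp t')" using tp by (simp add: at_top_def)
  have seg1: "AC (K s) = ch (Cp t') \<and> \<not> halted_state (AS (K s))" if "T \<le> s" "s \<le> T + k1" for s
    using silent_run_arun[OF r1, of "s - T"] that acT by simp
  have seg2: "AC (K s) = ch (Cp (Suc t')) \<and> \<not> halted_state (AS (K s))" if "Suc (T + k1) \<le> s" "s \<le> ?T'" for s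
    using silent_run_arun[OF r2', of "s - Suc (T + k1)"] that acB KB1 by simp
  have old: "\<forall>s\<le>T. \<not> halted_state (AS (K s))" "\<forall>s\<le>T. \<exists>s'\<le>t'. AC (K s) = ch (Cp s')"
    "\<forall>s'\<le>t'. \<exists>s\<le>T. AC (K s) = ch (Cp s')"
    "\<forall>s<T. AC (K (Suc s)) = AC (K s) \<or> (\<exists>s'<t'. AC (K s) = ch (Cp s') \<and> AC (K (Suc s)) = ch (Cp (Suc s')))"
    "t' < T" using T by (auto simp: top_sync_def)
  have "top_sync (Suc t') ?T'"
    unfolding top_sync_def
  proof (intro conjI allI impI)
    show "Suc t' < ?T'" using old(5) by simp
    show "at_top Bnd (K ?T') (Cp (Suc t'))" using tpA KA by simp
    fix s assume s: "s \<le> ?T'"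
    show "\<not> halted_state (AS (K s))"
      using old(1) seg1 seg2 s by (metis not_less_eq_eq nat_le_linear)
  next
    fix s assume s: "s \<le> ?T'"
    show "\<exists>s'\<le>Suc t'. AC (K s) = ch (Cp s')"
    proof (cases "s \<le> T")
      case True then show ?thesis using old(2) by (meson le_Suc_eq)
    next
      case False
      then show ?thesis
      proof (cases "s \<le> T + k1")
        case True then show ?thesis using seg1[of s] False by (intro exI[of _ t']) auto
      next
        case False then show ?thesis using seg2[of s] s by (intro exI[of _ "Suc t'"]) auto
      qed
    qed
  next
    fix s' assume s': "s' \<le> Suc t'"
    show "\<exists>s\<le>?T'. AC (K s) = ch (Cp s')"
    proof (cases "s' \<le> t'")
      case True then obtain s where "s \<le> T" "AC (K s) = ch (Cp s')" using old(3) by blast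
      then show ?thesis by (intro exI[of _ s]) auto
    next
      case False then have "s' = Suc t'" using s' by simp
      then show ?thesis using seg2[of ?T'] by (intro exI[of _ ?T']) auto
    qed
  next
    fix s assume s: "s < ?T'"
    show "AC (K (Suc s)) = AC (K s) \<or> (\<exists>s'<Suc t'. AC (K s) = ch (Cp s') \<and> AC (K (Suc s)) = ch (Cp (Suc s')))"
    proof (cases "s < T")
      case True then show ?thesis using old(4) by (meson less_SucI)
    next
      case nT: False
      show ?thesis
      proof (cases "s < T + k1")
        case True then show ?thesis using seg1[of s] seg1[of "Suc s"] nT by auto
      next
        case False
        show ?thesis
        proof (cases "s = T + k1")
          case True then show ?thesis using seg1[of s] seg2[of "Suc s"] nT by auto
        next
          case ne: False
          then show ?thesis using seg2[of s] seg2[of "Suc s"] s False by auto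
        qed
      qed
    qed
  qed
  then show ?thesis by blast
qed

lemma top_sync_exists: "(\<forall>s<t'. \<not> halted Mp (Cp s)) \<Longrightarrow> \<exists>T. top_sync t' T"
proof (induction t')
  case 0 show ?case using top_sync_0 by blast
next
  case (Suc t')
  then obtain T where "top_sync t' T" by auto
  then show ?case using top_sync_Suc Suc.prems by blast
qed

lemma K_halted_stay: "halted_state (AS (K t)) \<Longrightarrow> K (t + s) = K t"
  by (induction s) (auto simp: arun_Suc astep_def)

lemma Mp_first_halt:
  assumes "\<exists>s. halted Mp (Cp s)"
  obtains th' T where "halted Mp (Cp th')" "\<forall>s<th'. \<not> halted Mp (Cp s)" "top_sync th' T"
    "\<And>s. K (Suc T + s) = (K T)\<lparr>AS := (if st (Cp th') = accst Mp then ACCs else REJs)\<rparr>"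
proof -
  define th' where "th' = (LEAST s. halted Mp (Cp s))"
  have h: "halted Mp (Cp th')" "\<forall>s<th'. \<not> halted Mp (Cp s)"
    using assms LeastI_ex[OF assms] not_less_Least unfolding th'_def by auto
  obtain T where T: "top_sync th' T" using top_sync_exists h(2) by blast
  have tp: "at_top Bnd (K T) (Cp th')" using T by (simp add: top_sync_def)
  have "K (Suc T) = (K T)\<lparr>AS := (if st (Cp th') = accst Mp then ACCs else REJs), AC := mv N (AC (K T))\<rparr>"
    using top_halt[OF tp h(1)] by (simp add: arun_Suc)
  then have K1: "K (Suc T) = (K T)\<lparr>AS := (if st (Cp th') = accst Mp then ACCs else REJs)\<rparr>" by simp
  have "halted_state (AS (K (Suc T)))" using K1 by (simp add: halted_state_def)
  then have "K (Suc T + s) = K (Suc T)" for s using K_halted_stay by blast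
  then show ?thesis using that[OF h T] K1 by simp
qed

lemma heads_bounded: "AH (K t) \<le> Bnd \<and> AG (K t) = AH (K t)"
proof (cases "\<exists>s. halted Mp (Cp s)")
  case False
  then obtain T where T: "top_sync t T" using top_sync_exists by blast
  then obtain E where "E \<le> Bnd" "shape (AT (K T)) (AR (K T)) E" by (auto simp: top_sync_def at_top_def)
  then show ?thesis using head_bound[of t T] T by (force simp: top_sync_def)
next
  case True
  obtain th' T where "halted Mp (Cp th')" "\<forall>s<th'. \<not> halted Mp (Cp s)" and T: "top_sync th' T"
    and KT: "\<And>s. K (Suc T + s) = (K T)\<lparr>AS := (if st (Cp th') = accst Mp then ACCs else REJs)\<rparr>"
    by (rule Mp_first_halt[OF True]) blast
  obtain E where E: "E \<le> Bnd" "shape (AT (K T)) (AR (K T)) E" using T by (auto simp: top_sync_def at_top_def)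
  show ?thesis
  proof (cases "t \<le> T")
    case True then show ?thesis using head_bound[OF True E(2)] E(1) by simp
  next
    case False
    then have "K t = (K T)\<lparr>AS := (if st (Cp th') = accst Mp then ACCs else REJs)\<rparr>"
      using KT[of "t - Suc T"] by simp
    then show ?thesis using T by (simp add: top_sync_def at_top_def)
  qed
qed

lemma choice_head_reached_by_Mp: "\<exists>t'. AC (K t) = ch (Cp t')"
proof (cases "\<exists>s. halted Mp (Cp s)")
  case False
  then obtain T where T: "top_sync t T" using top_sync_exists by blast
  then have "t \<le> T" by (simp add: top_sync_def)
  then show ?thesis using T unfolding top_sync_def by blast
next
  case True
  obtain th' T where "halted Mp (Cp th')" "\<forall>s<th'. \<not> halted Mp (Cp s)" and T: "top_sync th' T"
    and KT: "\<And>s. K (Suc T + s) = (K T)\<lparr>AS := (if st (Cp th') = accst Mp then ACCs else REJs)\<rparr>"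
    by (rule Mp_first_halt[OF True]) blast
  show ?thesis
  proof (cases "t \<le> T")
    case True then show ?thesis using T by (auto simp: top_sync_def)
  next
    case False
    then have "K t = (K T)\<lparr>AS := (if st (Cp th') = accst Mp then ACCs else REJs)\<rparr>"
      using KT[of "t - Suc T"] by simp
    then show ?thesis using T by (auto simp: top_sync_def at_top_def)
  qed
qed

lemma choice_head_mono:
  assumes "\<And>t'. ch (Cp t') \<le> ch (Cp (Suc t'))"
  shows "AC (K t) \<le> AC (K (Suc t))"
proof -
  have step: "AC (K t) \<le> AC (K (Suc t))" if "top_sync t' T" "t < T" for t' T
    using that assms by (force simp: top_sync_def)
  show ?thesis
  proof (cases "\<exists>s. halted Mp (Cp s)")
    case False
    then obtain T where T: "top_sync t T" using top_sync_exists by blast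
    then show ?thesis using step[OF T] by (simp add: top_sync_def)
  next
    case True
    obtain th' T where "halted Mp (Cp th')" "\<forall>s<th'. \<not> halted Mp (Cp s)" and T: "top_sync th' T"
      and KT: "\<And>s. K (Suc T + s) = (K T)\<lparr>AS := (if st (Cp th') = accst Mp then ACCs else REJs)\<rparr>"
      by (rule Mp_first_halt[OF True]) blast
    show ?thesis
    proof (cases "t < T")
      case True then show ?thesis using step[OF T] by simp
    next
      case False
      then have "K (Suc t) = (K T)\<lparr>AS := (if st (Cp th') = accst Mp then ACCs else REJs)\<rparr>"
        using KT[of "t - T"] by simp
      moreover have "AC (K t) = AC (K T)"
        using KT[of "t - Suc T"] False by (cases "t = T") simp_all
      ultimately show ?thesis by simp
    qed
  qed
qed

lemma Mp_accepts_if_composite_accepts: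
  assumes "AS (K t) = ACCs" "\<forall>s\<le>t. AC (K s) \<le> Lx" "\<exists>s\<le>t. AC (K s) = Lx"
  shows "\<exists>t'. st (Cp t') = accst Mp \<and> (\<forall>s\<le>t'. ch (Cp s) \<le> Lx) \<and> (\<exists>s\<le>t'. ch (Cp s) = Lx)"
proof -
  have halts: "\<exists>s. halted Mp (Cp s)"
  proof (rule ccontr)
    assume "\<not> ?thesis"
    then obtain T where "top_sync t T" using top_sync_exists by blast
    then have "\<not> halted_state (AS (K t))" by (auto simp: top_sync_def)
    then show False using assms(1) by (simp add: halted_state_def)
  qed
  obtain th' T where "halted Mp (Cp th')" "\<forall>s<th'. \<not> halted Mp (Cp s)" and T: "top_sync th' T"
    and KT: "\<And>s. K (Suc T + s) = (K T)\<lparr>AS := (if st (Cp th') = accst Mp then ACCs else REJs)\<rparr>"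
    by (rule Mp_first_halt[OF halts]) blast
  have tT: "T < t"
  proof (rule ccontr)
    assume "\<not> T < t" then have "\<not> halted_state (AS (K t))" using T by (auto simp: top_sync_def)
    then show False using assms(1) by (simp add: halted_state_def)
  qed
  have Kt: "K t = (K T)\<lparr>AS := (if st (Cp th') = accst Mp then ACCs else REJs)\<rparr>"
    using KT[of "t - Suc T"] tT by simp
  have acc: "st (Cp th') = accst Mp"
  proof (rule ccontr)
    assume "st (Cp th') \<noteq> accst Mp"
    then have "AS (K t) = REJs" using Kt by simp
    then show False using assms(1) by (simp add: ACCs_def REJs_def S0_def)
  qed
  have below: "\<forall>s'\<le>th'. ch (Cp s') \<le> Lx"
  proof (intro allI impI)
    fix s' assume "s' \<le> th'"
    then obtain s where "s \<le> T" "AC (K s) = ch (Cp s')" using T by (auto simp: top_sync_def)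
    then show "ch (Cp s') \<le> Lx" using assms(2) tT by (metis less_imp_le_nat order.trans)
  qed
  have reached: "\<exists>s'\<le>th'. ch (Cp s') = Lx"
  proof -
    obtain s where s: "s \<le> t" "AC (K s) = Lx" using assms(3) by blast
    obtain s0 where s0: "s0 \<le> T" "AC (K s0) = Lx"
    proof (cases "s \<le> T")
      case True then show ?thesis using that s by blast
    next
      case False then show ?thesis using that[of T] KT[of "s - Suc T"] s by simp
    qed
    then obtain s' where "s' \<le> th'" "AC (K s0) = ch (Cp s')" using T by (auto simp: top_sync_def)
    then show ?thesis using s0 by metis
  qed
  show ?thesis using acc below reached by blast
qed

lemma composite_accepts_if_Mp_accepts:
  assumes "st (Cp ta) = accst Mp" "\<forall>s\<le>ta. ch (Cp s) \<le> Lx" "\<exists>s\<le>ta. ch (Cp s) = Lx"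
  shows "\<exists>t. AS (K t) = ACCs \<and> (\<forall>s\<le>t. AC (K s) \<le> Lx) \<and> (\<exists>s\<le>t. AC (K s) = Lx)"
proof -
  have halts: "\<exists>s. halted Mp (Cp s)" using assms(1) by (auto simp: halted_def)
  obtain th' T where h: "halted Mp (Cp th')" "\<forall>s<th'. \<not> halted Mp (Cp s)" and T: "top_sync th' T"
    and KT: "\<And>s. K (Suc T + s) = (K T)\<lparr>AS := (if st (Cp th') = accst Mp then ACCs else REJs)\<rparr>"
    by (rule Mp_first_halt[OF halts]) blast
  have le: "th' \<le> ta" using h(2) assms(1) by (metis halted_def not_le)
  have same: "Cp s = Cp th'" if "th' \<le> s" for s using run_halted_stay[OF h(1) that] .
  have acc: "st (Cp th') = accst Mp" using same[OF le] assms(1) by simp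
  have below: "\<forall>s\<le>th'. ch (Cp s) \<le> Lx" using assms(2) le by auto
  have reached: "\<exists>s\<le>th'. ch (Cp s) = Lx"
  proof -
    obtain s where s: "s \<le> ta" "ch (Cp s) = Lx" using assms(3) by blast
    show ?thesis
    proof (cases "s \<le> th'")
      case True then show ?thesis using s by blast
    next
      case False then show ?thesis using same[of s] s by (intro exI[of _ th']) auto
    qed
  qed
  have KS: "K (Suc T) = (K T)\<lparr>AS := ACCs\<rparr>" using KT[of 0] acc by simp
  have "AC (K s) \<le> Lx" if s: "s \<le> Suc T" for s
  proof -
    have "AC (K s) = AC (K (min s T))" using s KS by (cases "s \<le> T") (simp_all add: min_def le_Suc_eq)
    moreover obtain s' where "s' \<le> th'" "AC (K (min s T)) = ch (Cp s')"
      using T min.cobounded2[of s T] unfolding top_sync_def by blast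
    ultimately show ?thesis using below by simp
  qed
  moreover have "\<exists>s\<le>Suc T. AC (K s) = Lx"
  proof -
    obtain s' where "s' \<le> th'" "ch (Cp s') = Lx" using reached by blast
    then obtain s where "s \<le> T" "AC (K s) = Lx" using T unfolding top_sync_def by metis
    then show ?thesis by (intro exI[of _ s]) auto
  qed
  ultimately show ?thesis using KS by (intro exI[of _ "Suc T"]) simp
qed

lemma accepting_iff:
  "(\<exists>t. AS (K t) = ACCs \<and> (\<forall>s\<le>t. AC (K s) \<le> Lx) \<and> (\<exists>s\<le>t. AC (K s) = Lx)) \<longleftrightarrow>
   (\<exists>t'. st (Cp t') = accst Mp \<and> (\<forall>s\<le>t'. ch (Cp s) \<le> Lx) \<and> (\<exists>s\<le>t'. ch (Cp s) = Lx))"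
proof
  assume "\<exists>t. AS (K t) = ACCs \<and> (\<forall>s\<le>t. AC (K s) \<le> Lx) \<and> (\<exists>s\<le>t. AC (K s) = Lx)"
  then show "\<exists>t'. st (Cp t') = accst Mp \<and> (\<forall>s\<le>t'. ch (Cp s) \<le> Lx) \<and> (\<exists>s\<le>t'. ch (Cp s) = Lx)"
    using Mp_accepts_if_composite_accepts by blast
next
  assume "\<exists>t'. st (Cp t') = accst Mp \<and> (\<forall>s\<le>t'. ch (Cp s) \<le> Lx) \<and> (\<exists>s\<le>t'. ch (Cp s) = Lx)"
  then show "\<exists>t. AS (K t) = ACCs \<and> (\<forall>s\<le>t. AC (K s) \<le> Lx) \<and> (\<exists>s\<le>t. AC (K s) = Lx)"
    using composite_accepts_if_Mp_accepts by blast
qed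

end

section \<open>Resource bounds\<close>

lemma simulation_intro:
  assumes "wf_tm Mr" "wf_tm Mp" "\<And>t. ch (run Mr w (\<lambda>_. False) t) = 0"
    "\<And>t. wh (run Mr w (\<lambda>_. False) t) < Bnd" "\<And>t. ih (run Mr w (\<lambda>_. False) t) < Bnd"
    "\<And>t. wh (run Mp wp c t) < Bnd" "\<And>t. ih (run Mp wp c t) < Bnd"
    "halted Mr (run Mr w (\<lambda>_. False) th)" "orc (run Mr w (\<lambda>_. False) th) = wp" "length wp < 2 ^ Bnd"
  shows "simulation Mr Mp w wp c Bnd th"
  using assms by (auto simp: simulation_def simulation_axioms_def composite_def)

lemma len_enc: "length x \<le> length (enc x k)" by (simp add: enc_def)

locale red_setting =
  fixes Mr Mp :: tm and g fR f1 fk :: "nat \<Rightarrow> nat" and cR c1 :: nat and F F' :: "bool list \<Rightarrow> nat \<Rightarrow> nat"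
  assumes wfr: "wf_tm Mr" and Mr_deterministic: "deterministic Mr"
    and Mr_space: "\<And>x k ch' t. wh (run Mr (enc x k) ch' t) + ih (run Mr (enc x k) ch' t) \<le> cR * (lg (length x) + fR k)"
    and Mr_reduces: "\<And>x k. \<exists>t x' k'. (st (run Mr (enc x k) (\<lambda>_. False) t) = accst Mr \<or> st (run Mr (enc x k) (\<lambda>_. False) t) = rejst Mr)
                     \<and> orc (run Mr (enc x k) (\<lambda>_. False) t) = enc x' k' \<and> k' \<le> g k \<and> F x k = F' x' k'"
    and wfp: "wf_tm Mp"
    and Mp_space: "\<And>x k ch' t. wh (run Mp (enc x k) ch' t) + ih (run Mp (enc x k) ch' t) \<le> c1 * (lg (length x) + f1 k)"
    and Mp_choice_bound: "\<And>x k c t. ch (run Mp (enc x k) c t) \<le> fk k * lg (length x)"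
    and Mp_counts: "\<And>x k. nacc Mp (enc x k) = F' x k"
    and cg: "computable g" and cfR: "computable fR" and cf1: "computable f1" and cfk: "computable fk"
begin

definition lg_alphabet :: nat where "lg_alphabet = lg (max (nstates Mr) (nsyms Mr))"
definition space_Mr :: "bool list \<Rightarrow> nat \<Rightarrow> nat" where "space_Mr x k = cR * (lg (length x) + fR k)"
definition lg_time_Mr :: "bool list \<Rightarrow> nat \<Rightarrow> nat" where "lg_time_Mr x k = (4 * space_Mr x k + 5) * lg_alphabet"
definition f1_upto :: "nat \<Rightarrow> nat" where "f1_upto k = (\<Sum>j\<le>g k. f1 j)"
definition fk_upto :: "nat \<Rightarrow> nat" where "fk_upto k = (\<Sum>j\<le>g k. fk j)"
text \<open>The summand \<open>lg_time_Mr x k\<close> makes room for the counter of R's output symbols.\<close>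

definition tape_bound :: "bool list \<Rightarrow> nat \<Rightarrow> nat" where "tape_bound x k = space_Mr x k + 1 + c1 * (lg_time_Mr x k + f1_upto k) + lg_time_Mr x k"

lemma reduction_instance:
  "\<exists>x' k' th. k' \<le> g k \<and> F x k = F' x' k' \<and> (\<forall>c. simulation Mr Mp (enc x k) (enc x' k') c (tape_bound x k) th)
     \<and> lg (length x') \<le> lg_time_Mr x k"
proof -
  let ?w = "enc x k" let ?F = "\<lambda>_::nat. False"
  obtain t x' k' where t: "halted Mr (run Mr ?w ?F t)" "orc (run Mr ?w ?F t) = enc x' k'" "k' \<le> g k" "F x k = F' x' k'"
    using Mr_reduces[of x k] by (auto simp: halted_def)
  define th0 where "th0 = (LEAST s. halted Mr (run Mr ?w ?F s))"
  have h0: "halted Mr (run Mr ?w ?F th0)" "\<And>s. s < th0 \<Longrightarrow> \<not> halted Mr (run Mr ?w ?F s)"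
    using LeastI[of "\<lambda>s. halted Mr (run Mr ?w ?F s)", OF t(1)] not_less_Least unfolding th0_def by auto
  have bw: "wh (run Mr ?w ?F s) \<le> space_Mr x k" "ih (run Mr ?w ?F s) \<le> space_Mr x k" for s
    using Mr_space[of x k ?F s] unfolding space_Mr_def by linarith+
  have chz: "ch (run Mr ?w ?F s) = 0" for s using Mr_deterministic by (simp add: deterministic_def)
  have thb: "th0 \<le> (max (nstates Mr) (nsyms Mr)) ^ (4 * space_Mr x k + 5)"
    by (rule halting_time_bound[OF wfr bw(1) bw(2) chz h0])
  have "th0 \<le> t" unfolding th0_def using t(1) by (rule Least_le)
  then have "run Mr ?w ?F t = run Mr ?w ?F th0" using run_halted_stay[OF h0(1)] by blast
  then have orc0: "orc (run Mr ?w ?F th0) = enc x' k'" using t(2) by simp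
  have lw: "length (enc x' k') \<le> th0" using run_orc_len[of Mr ?w ?F th0] orc0 by simp
  have V1: "1 \<le> max (nstates Mr) (nsyms Mr)" using wfr by (auto simp: wf_tm_def)
  have lgth: "lg th0 \<le> lg_time_Mr x k"
  proof -
    have "lg th0 \<le> lg ((max (nstates Mr) (nsyms Mr)) ^ (4 * space_Mr x k + 5))" by (rule lg_mono[OF thb])
    also have "\<dots> \<le> (4 * space_Mr x k + 5) * lg_alphabet" unfolding lg_alphabet_def by (rule lg_pow[OF V1]) simp
    finally show ?thesis by (simp add: lg_time_Mr_def)
  qed
  have lgx: "lg (length x') \<le> lg_time_Mr x k"
    using lg_mono[OF order.trans[OF len_enc[of x' k'] lw]] lgth by simp
  have f1b: "f1 k' \<le> f1_upto k" unfolding f1_upto_def using t(3) by (intro member_le_sum) auto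
  have S1b: "c1 * (lg (length x') + f1 k') \<le> c1 * (lg_time_Mr x k + f1_upto k)"
    using lgx f1b by (intro mult_le_mono2) simp
  have query_length_bounded: "length (enc x' k') < 2 ^ tape_bound x k"
  proof -
    have "length (enc x' k') < 2 ^ lg (length (enc x' k'))" by (rule lg_lt_pow)
    also have "\<dots> \<le> 2 ^ lg_time_Mr x k" using lg_mono[OF lw] lgth by (intro power_increasing) auto
    also have "\<dots> \<le> 2 ^ tape_bound x k" by (intro power_increasing) (auto simp: tape_bound_def)
    finally show ?thesis .
  qed
  have "simulation Mr Mp ?w (enc x' k') c (tape_bound x k) th0" for c
  proof (rule simulation_intro[OF wfr wfp chz])
    show "wh (run Mr ?w ?F s) < tape_bound x k" "ih (run Mr ?w ?F s) < tape_bound x k" for s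
      using bw[of s] by (auto simp: tape_bound_def)
    show "wh (run Mp (enc x' k') c s) < tape_bound x k" "ih (run Mp (enc x' k') c s) < tape_bound x k" for s
    proof -
      have "wh (run Mp (enc x' k') c s) + ih (run Mp (enc x' k') c s) \<le> c1 * (lg_time_Mr x k + f1_upto k)"
        by (rule order.trans[OF Mp_space S1b])
      then show "wh (run Mp (enc x' k') c s) < tape_bound x k" "ih (run Mp (enc x' k') c s) < tape_bound x k"
        unfolding tape_bound_def by linarith+
    qed
  qed (use h0 orc0 query_length_bounded in auto)
  then show ?thesis using t lgx by blast
qed

end

sublocale red_setting \<subseteq> composite Mr Mp using wfr wfp by unfold_locales

context red_setting begin

lemma acc_cM: "st (run cM w c t) = accst cM \<longleftrightarrow> AS (arun w c t) = ACCs"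
  using run_conc[of w c t] by (simp add: concrete_def cM_def encS_inj)

lemma acc_path_eq:
  assumes "simulation Mr Mp w wp (\<lambda>i. i < length u \<and> u ! i) Bnd th"
  shows "acc_path cM w u \<longleftrightarrow> acc_path Mp wp u"
proof -
  let ?c = "\<lambda>i. i < length u \<and> u ! i"
  have ch: "ch (run cM w ?c t) = AC (arun w ?c t)" for t using run_conc[of w ?c t] by (simp add: concrete_def)
  have "acc_path cM w u \<longleftrightarrow> (\<exists>t. AS (arun w ?c t) = ACCs \<and> (\<forall>s\<le>t. AC (arun w ?c s) \<le> length u) \<and> (\<exists>s\<le>t. AC (arun w ?c s) = length u))"
    unfolding acc_path_def Let_def acc_cM ch ..
  also have "\<dots> \<longleftrightarrow> acc_path Mp wp u"
    unfolding acc_path_def Let_def by (rule simulation.accepting_iff[OF assms])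
  finally show ?thesis .
qed

lemma nacc_cM: "nacc cM (enc x k) = F x k"
proof -
  obtain x' k' th where p: "k' \<le> g k" "F x k = F' x' k'" "\<forall>c. simulation Mr Mp (enc x k) (enc x' k') c (tape_bound x k) th"
    using reduction_instance[of k x] by blast
  have "{u. acc_path cM (enc x k) u} = {u. acc_path Mp (enc x' k') u}"
    using acc_path_eq p(3) by blast
  then show ?thesis using p(2) Mp_counts[of x' k'] by (simp add: nacc_def)
qed

lemma read_once_cM: "read_once Mp \<Longrightarrow> read_once cM"
proof -
  assume ro: "read_once Mp"
  show "read_once cM" unfolding read_once_def
  proof (intro allI)
    fix x k c t
    obtain x' k' th where p: "\<forall>c. simulation Mr Mp (enc x k) (enc x' k') c (tape_bound x k) th"
      using reduction_instance[of k x] by blast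
    have "AC (arun (enc x k) c t) \<le> AC (arun (enc x k) c (Suc t))"
      by (rule simulation.choice_head_mono[OF p[rule_format, of c]]) (use ro in \<open>simp add: read_once_def\<close>)
    then show "ch (run cM (enc x k) c t) \<le> ch (run cM (enc x k) c (Suc t))"
      using run_conc[of "enc x k" c t] run_conc[of "enc x k" c "Suc t"] by (simp add: concrete_def)
  qed
qed

lemma tape_bound_linear: "2 * tape_bound x k \<le> (2 * (cR + 1 + c1 * (4 * cR + 5) * lg_alphabet + c1 + (4 * cR + 5) * lg_alphabet)) * (lg (length x) + (fR k + f1_upto k))"
proof -
  let ?P = "lg (length x) + (fR k + f1_upto k)"
  have P1: "1 \<le> ?P" using lg_pos[of "length x"] by simp
  have sm: "space_Mr x k \<le> cR * ?P" unfolding space_Mr_def by (intro mult_le_mono2) simp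
  have lt: "lg_time_Mr x k \<le> (4 * cR + 5) * lg_alphabet * ?P"
  proof -
    have "4 * space_Mr x k + 5 \<le> 4 * (cR * ?P) + 5 * ?P"
      by (rule add_mono) (use sm P1 in simp_all)
    also have "\<dots> = (4 * cR + 5) * ?P" by (simp add: algebra_simps)
    finally have "4 * space_Mr x k + 5 \<le> (4 * cR + 5) * ?P" .
    then have "(4 * space_Mr x k + 5) * lg_alphabet \<le> (4 * cR + 5) * ?P * lg_alphabet" by (rule mult_le_mono1)
    then show ?thesis by (simp add: lg_time_Mr_def algebra_simps)
  qed
  have sf: "f1_upto k \<le> ?P" by simp
  have "c1 * (lg_time_Mr x k + f1_upto k) \<le> c1 * ((4 * cR + 5) * lg_alphabet * ?P + ?P)"
    using lt sf by (intro mult_le_mono2 add_mono) auto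
  also have "\<dots> = (c1 * (4 * cR + 5) * lg_alphabet + c1) * ?P" by (simp add: algebra_simps)
  finally have c: "c1 * (lg_time_Mr x k + f1_upto k) \<le> (c1 * (4 * cR + 5) * lg_alphabet + c1) * ?P" .
  have "tape_bound x k \<le> cR * ?P + ?P + (c1 * (4 * cR + 5) * lg_alphabet + c1) * ?P + (4 * cR + 5) * lg_alphabet * ?P"
    unfolding tape_bound_def using sm P1 c lt by linarith
  also have "\<dots> = (cR + 1 + c1 * (4 * cR + 5) * lg_alphabet + c1 + (4 * cR + 5) * lg_alphabet) * ?P" by (simp add: algebra_simps)
  finally have "2 * tape_bound x k \<le> 2 * ((cR + 1 + c1 * (4 * cR + 5) * lg_alphabet + c1 + (4 * cR + 5) * lg_alphabet) * ?P)" by simp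
  then show ?thesis by (simp only: mult.assoc)
qed

lemma paraL_space_cM: "paraL_space cM"
  unfolding paraL_space_def
proof (intro exI conjI allI)
  show "computable (\<lambda>k. fR k + f1_upto k)"
    unfolding f1_upto_def by (intro computable_add cfR computable_comp[OF computable_sum[OF cf1] cg])
  fix x k ch' t
  obtain x' k' th where p: "\<forall>c. simulation Mr Mp (enc x k) (enc x' k') c (tape_bound x k) th"
    using reduction_instance[of k x] by blast
  have f1: "AH (arun (enc x k) ch' t) \<le> tape_bound x k \<and> AG (arun (enc x k) ch' t) = AH (arun (enc x k) ch' t)"
    by (rule simulation.heads_bounded[OF p[rule_format, of ch']])
  have "wh (run cM (enc x k) ch' t) + ih (run cM (enc x k) ch' t) \<le> 2 * tape_bound x k"
    using run_conc[of "enc x k" ch' t] f1 by (simp add: concrete_def)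
  also have "\<dots> \<le> (2 * (cR + 1 + c1 * (4 * cR + 5) * lg_alphabet + c1 + (4 * cR + 5) * lg_alphabet)) * (lg (length x) + (fR k + f1_upto k))"
    by (rule tape_bound_linear)
  finally show "wh (run cM (enc x k) ch' t) + ih (run cM (enc x k) ch' t)
      \<le> (2 * (cR + 1 + c1 * (4 * cR + 5) * lg_alphabet + c1 + (4 * cR + 5) * lg_alphabet)) * (lg (length x) + (fR k + f1_upto k))" .
qed

lemma k_bounded_cM: "k_bounded cM"
  unfolding k_bounded_def
proof (intro exI conjI allI)
  show "computable (\<lambda>k. fk_upto k * ((4 * cR + 5) * lg_alphabet * (1 + fR k)))"
    unfolding fk_upto_def
    by (intro computable_mul computable_comp[OF computable_sum[OF cfk] cg] computable_const computable_add cfR)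
  fix x k c t
  obtain x' k' th where p: "k' \<le> g k" "\<forall>c. simulation Mr Mp (enc x k) (enc x' k') c (tape_bound x k) th" "lg (length x') \<le> lg_time_Mr x k"
    using reduction_instance[of k x] by blast
  obtain t' where t': "AC (arun (enc x k) c t) = ch (run Mp (enc x' k') c t')"
    using simulation.choice_head_reached_by_Mp[OF p(2)[rule_format, of c]] by blast
  have fk: "fk k' \<le> fk_upto k" unfolding fk_upto_def using p(1) by (intro member_le_sum) auto
  let ?n = "lg (length x)"
  have n1: "1 \<le> ?n" by (rule lg_pos)
  have lt: "lg_time_Mr x k \<le> (4 * cR + 5) * lg_alphabet * (1 + fR k) * ?n"
  proof -
    have sm: "space_Mr x k \<le> cR * ((1 + fR k) * ?n)" unfolding space_Mr_def
      using n1 by (intro mult_le_mono2) (simp add: algebra_simps)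
    have "4 * space_Mr x k + 5 \<le> 4 * (cR * ((1 + fR k) * ?n)) + 5 * ((1 + fR k) * ?n)"
    proof (rule add_mono)
      show "4 * space_Mr x k \<le> 4 * (cR * ((1 + fR k) * ?n))" using sm by simp
      have "1 \<le> (1 + fR k) * ?n" using n1 by (metis le_add1 mult_le_mono nat_mult_1 plus_1_eq_Suc)
      then show "5 \<le> 5 * ((1 + fR k) * ?n)" by simp
    qed
    also have "\<dots> = (4 * cR + 5) * (1 + fR k) * ?n" by (simp add: algebra_simps)
    finally have "4 * space_Mr x k + 5 \<le> (4 * cR + 5) * (1 + fR k) * ?n" .
    then have "(4 * space_Mr x k + 5) * lg_alphabet \<le> (4 * cR + 5) * (1 + fR k) * ?n * lg_alphabet" by (rule mult_le_mono1)
    then show ?thesis by (simp add: lg_time_Mr_def algebra_simps)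
  qed
  have "ch (run cM (enc x k) c t) = ch (run Mp (enc x' k') c t')"
    using run_conc[of "enc x k" c t] t' by (simp add: concrete_def)
  also have "\<dots> \<le> fk k' * lg (length x')" by (rule Mp_choice_bound)
  also have "\<dots> \<le> fk_upto k * lg_time_Mr x k" using fk p(3) by (rule mult_le_mono)
  also have "\<dots> \<le> fk_upto k * ((4 * cR + 5) * lg_alphabet * (1 + fR k) * ?n)" using lt by (rule mult_le_mono2)
  also have "\<dots> = fk_upto k * ((4 * cR + 5) * lg_alphabet * (1 + fR k)) * ?n" by (simp add: algebra_simps)
  finally show "ch (run cM (enc x k) c t) \<le> fk_upto k * ((4 * cR + 5) * lg_alphabet * (1 + fR k)) * lg (length x)" .
qed

end

lemma composite_machine_exists:
  fixes F F' :: "bool list \<Rightarrow> nat \<Rightarrow> nat"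
  assumes reduction: "plog_pars_red F F'"
    and wfp: "wf_tm Mp" and Mp_space: "paraL_space Mp" and Mp_choice_bound: "k_bounded Mp" and Mp_counts: "\<forall>x k. nacc Mp (enc x k) = F' x k"
  shows "\<exists>M. wf_tm M \<and> paraL_space M \<and> k_bounded M \<and> (\<forall>x k. nacc M (enc x k) = F x k)
           \<and> (read_once Mp \<longrightarrow> read_once M)"
proof -
  obtain Mr g where r: "wf_tm Mr" "deterministic Mr" "paraL_space Mr" "computable g"
    and rd: "\<forall>x k. \<exists>t x' k'. (st (run Mr (enc x k) (\<lambda>_. False) t) = accst Mr \<or>
                        st (run Mr (enc x k) (\<lambda>_. False) t) = rejst Mr)
                     \<and> orc (run Mr (enc x k) (\<lambda>_. False) t) = enc x' k'
                     \<and> k' \<le> g k \<and> F x k = F' x' k'"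
    using reduction unfolding plog_pars_red_def by blast
  obtain fR cR where fR: "computable fR" "\<forall>x k ch' t. wh (run Mr (enc x k) ch' t) + ih (run Mr (enc x k) ch' t)
                    \<le> cR * (lg (length x) + fR k)"
    using r(3) unfolding paraL_space_def by blast
  obtain f1 c1 where f1: "computable f1" "\<forall>x k ch' t. wh (run Mp (enc x k) ch' t) + ih (run Mp (enc x k) ch' t)
                    \<le> c1 * (lg (length x) + f1 k)"
    using Mp_space unfolding paraL_space_def by blast
  obtain fk where fk: "computable fk" "\<forall>x k c t. ch (run Mp (enc x k) c t) \<le> fk k * lg (length x)"
    using Mp_choice_bound unfolding k_bounded_def by blast
  interpret red_setting Mr Mp g fR f1 fk cR c1 F F'
    by unfold_locales (use r rd fR f1 fk wfp Mp_counts in auto)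
  show ?thesis using wf_cM paraL_space_cM k_bounded_cM nacc_cM read_once_cM by blast
qed

theorem lemma11:
  fixes F F' :: "bool list \<Rightarrow> nat \<Rightarrow> nat"
  assumes "plog_pars_red F F'"
  shows "(F' \<in> sharp_para_W_L \<longrightarrow> F \<in> sharp_para_W_L)
       \<and> (F' \<in> sharp_para_beta_L \<longrightarrow> F \<in> sharp_para_beta_L)"
proof (intro conjI impI)
  assume "F' \<in> sharp_para_W_L"
  then obtain Mp where "wf_tm Mp" "paraL_space Mp" "k_bounded Mp" "\<forall>x k. nacc Mp (enc x k) = F' x k"
    unfolding sharp_para_W_L_def by blast
  then obtain M where "wf_tm M \<and> paraL_space M \<and> k_bounded M \<and> (\<forall>x k. nacc M (enc x k) = F x k)"
    using composite_machine_exists[OF assms] by blast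
  then show "F \<in> sharp_para_W_L" unfolding sharp_para_W_L_def by blast
next
  assume "F' \<in> sharp_para_beta_L"
  then obtain Mp where "wf_tm Mp" "paraL_space Mp" "k_bounded Mp" "read_once Mp" "\<forall>x k. nacc Mp (enc x k) = F' x k"
    unfolding sharp_para_beta_L_def by blast
  then obtain M where "wf_tm M \<and> paraL_space M \<and> k_bounded M \<and> (\<forall>x k. nacc M (enc x k) = F x k) \<and> read_once M"
    using composite_machine_exists[OF assms] by blast
  then show "F \<in> sharp_para_beta_L" unfolding sharp_para_beta_L_def by blast
qed

end
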